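(* Under the standing assumptions on the law of $(A,B)$ listed in the context, let $\nu$ be the invariant Radon measure defined there. Then for any $0<a<b$ there are constants $c_1\le C_1<\infty$ such that $$c_1\le\liminf_{t\to\infty}\nu\big(\{z\in\mathbb R_+^d:|z|\in[ta,tb]\}\big)\le\limsup_{t\to\infty}\nu\big(\{z\in\mathbb R_+^d:|z|\in[ta,tb]\}\big)\le C_1 .$$ Moreover, if $b/a>\varkappa d$, then $c_1$ can be taken strictly positive.
   Context: Notation. Fix an integer $d\ge1$; $\mathbb R_+=[0,\infty)$; $|v|=\sum_{i=1}^d|\langle v,e_i\rangle|$ for $v\in\mathbb R^d$, with $(e_i)$ the standard basis. A $d\times d$ matrix with nonnegative entries is allowable if every row and every column has at least one strictly positive entry. $\mathbb M$ is the semigroup of allowable nonnegative $d\times d$ matrices and $\mathbb M_+\subset\mathbb M$ the subsemigroup of matrices with strictly positive entries. For $g\in\mathbb M_+$, $\lambda_g$ is its Perron–Frobenius eigenvalue (spectral radius). For $g\in\mathbb M$: $\|g\|=\sup_{v\in\mathbb R_+^d\setminus\{0\}}|gv|/|v|$, $\iota(g)=\inf_{v\in\mathbb R_+^d\setminus\{0\}}|gv|/|v|$, $N(g)=\max\{\iota(g)^{-1},\|g\|\}$. Let $(A_n,B_n)_{n\ge1}$ be i.i.d. copies of a random pair $(A,B)$ with values in $\mathbb M\times\mathbb R_+^d$ (no independence between $A$ and $B$ is assumed). Let $\overline\mu$ be the law of $A$, $\operatorname{supp}\overline\mu$ its support in $\mathbb M$, and $\Gamma$ the smallest subsemigroup of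 $\mathbb M$ that contains $\operatorname{supp}\overline\mu$ and is closed in $\mathbb M$. Standing assumptions. (1) Every $g\in\Gamma$ is allowable and $\Gamma$ contains at least one matrix with strictly positive entries. (2) There is $\delta>0$ with $\mathbb E[N(A)^\delta]<\infty$, $\mathbb P(\iota(A)\ge1+\delta)>0$, $\mathbb E(|B|^\delta)<\infty$ and $\mathbb E(|B|^{-\delta})<\infty$. (3) The additive subgroup of $\mathbb R$ generated by $\{\log\lambda_g:g\in\Gamma\cap\mathbb M_+\}$ is dense in $\mathbb R$. (4) The Lyapunov exponent $\lambda=\lim_{n\to\infty}\frac1n\log\|A_n\cdots A_1\|$ (a.s. limit) equals $0$. (5) There is a constant $\varkappa>1$ (the constant in the claim) such that $\max_{i,j}g_{i,j}/\min_{i,j}g_{i,j}\le\varkappa$ for all $g\in\operatorname{supp}\overline\mu$ (in particular such $g$ have strictly positive entries). (6) There is no affine subspace $W\subset\mathbb R^d$ such that $W\cap\mathbb R_+^d$ contains a nonzero vector, is bounded, and is invariant under the action of all $g\in\operatorname{supp}\overline\mu$. Under these assumptions there is (known result) a nonzero Radon measure $\nu$ on $\mathbb R_+^d$, unique up to a positive multiplicative constant, which is invariant: $\nu(f)=\mathbb E\int_{\mathbb R_+^d}f(Ax+B)\,\nu(dx)$ for all bounded measurable compactly supported $f$ on $\mathbb R_+^d$; it has infinite total mass. Fix such a $\nu$. *)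

theory Defs
  imports "HOL-Probability.Probability" "HOL-Computational_Algebra.Group_Closure"
begin

(* The dimension d is CARD('n) for an arbitrary finite index type 'n; it is automatically >= 1. *)

definition nonneg_orthant :: "(real^'n) set" where
  "nonneg_orthant = {v. \<forall>i. 0 \<le> v $ i}"

definition l1norm :: "real^'n \<Rightarrow> real" where
  "l1norm v = (\<Sum>i\<in>UNIV. \<bar>v $ i\<bar>)"

definition allowable :: "(real^'n^'n) set" where
  "allowable = {g. (\<forall>i j. 0 \<le> g $ i $ j) \<and> (\<forall>i. \<exists>j. 0 < g $ i $ j) \<and> (\<forall>j. \<exists>i. 0 < g $ i $ j)}"

definition pos_matrices :: "(real^'n^'n) set" where
  "pos_matrices = {g. \<forall>i j. 0 < g $ i $ j}"

definition matnorm :: "real^'n^'n \<Rightarrow> real" where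
  "matnorm g = (SUP v\<in>nonneg_orthant - {0}. l1norm (g *v v) / l1norm v)"

definition iota_min :: "real^'n^'n \<Rightarrow> real" where
  "iota_min g = (INF v\<in>nonneg_orthant - {0}. l1norm (g *v v) / l1norm v)"

(* iota_min g > 0 for allowable g, so the inverse is a genuine one where Nmax is used. *)
definition Nmax :: "real^'n^'n \<Rightarrow> real" where
  "Nmax g = max (inverse (iota_min g)) (matnorm g)"

definition complex_eigenvalues :: "real^'n^'n \<Rightarrow> complex set" where
  "complex_eigenvalues g =
     {z. \<exists>v::complex^'n. v \<noteq> 0 \<and> (\<chi> i j. complex_of_real (g $ i $ j)) *v v = z *s v}"

(* The set of eigenvalues is finite and nonempty, so the supremum is a maximum. *)
definition spec_radius :: "real^'n^'n \<Rightarrow> real" where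
  "spec_radius g = (SUP z\<in>complex_eigenvalues g. cmod z)"

(* Topological support, in the space of allowable matrices, of a Borel law on matrices. *)
definition msupport :: "(real^'n^'n) measure \<Rightarrow> (real^'n^'n) set" where
  "msupport \<mu> = {g \<in> allowable. \<forall>U. open U \<and> g \<in> U \<longrightarrow> emeasure \<mu> U \<noteq> 0}"

(* Closedness is relative to the set of allowable matrices. *)
definition closed_semigroup_gen :: "(real^'n^'n) set \<Rightarrow> (real^'n^'n) set" where
  "closed_semigroup_gen S =
     \<Inter>{T. S \<subseteq> T \<and> T \<subseteq> allowable \<and> closedin (top_of_set allowable) T \<and>
         (\<forall>g\<in>T. \<forall>h\<in>T. g ** h \<in> T)}"

(* left_prod X n = X n ** ... ** X 1 *)
primrec left_prod :: "(nat \<Rightarrow> real^'n^'n) \<Rightarrow> nat \<Rightarrow> real^'n^'n" where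
  "left_prod X 0 = mat 1"
| "left_prod X (Suc n) = X (Suc n) ** left_prod X n"

definition radon_on_orthant :: "(real^'n) measure \<Rightarrow> bool" where
  "radon_on_orthant \<nu> \<longleftrightarrow> sets \<nu> = sets (restrict_space borel nonneg_orthant) \<and>
     (\<forall>K. compact K \<and> K \<subseteq> nonneg_orthant \<longrightarrow> emeasure \<nu> K < \<infinity>)"

(* Bochner integrals of non-integrable functions are 0 by convention, so the existence of the
   integrals on the right-hand side of the invariance equation is stated explicitly. *)
definition invariant_measure ::
  "'w measure \<Rightarrow> ('w \<Rightarrow> real^'n^'n) \<Rightarrow> ('w \<Rightarrow> real^'n) \<Rightarrow> (real^'n) measure \<Rightarrow> bool" where
  "invariant_measure M A B \<nu> \<longleftrightarrow>
     (\<forall>f::real^'n \<Rightarrow> real.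
        f \<in> borel_measurable \<nu> \<and> bounded (f ` nonneg_orthant) \<and>
        (\<exists>K. compact K \<and> K \<subseteq> nonneg_orthant \<and> (\<forall>x\<in>nonneg_orthant - K. f x = 0)) \<longrightarrow>
        (AE \<omega> in M. integrable \<nu> (\<lambda>x. f (A \<omega> *v x + B \<omega>))) \<and>
        integrable M (\<lambda>\<omega>. \<integral>x. f (A \<omega> *v x + B \<omega>) \<partial>\<nu>) \<and>
        (\<integral>x. f x \<partial>\<nu>) = (\<integral>\<omega>. (\<integral>x. f (A \<omega> *v x + B \<omega>) \<partial>\<nu>) \<partial>M))"

end

theory Submission
  imports Defs
begin

text \<open>On a logarithmic scale the linear chain \<open>x \<mapsto> A x\<close> is a centred walk, because the Lyapunov exponent
vanishes. Averaging \<open>ln \<bar>A_n ... A_1 x\<bar>\<close> and passing to limits gives a function \<open>h\<close> that differs from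
\<open>ln \<bar>x\<bar>\<close> by a bounded amount and satisfies \<open>E h(A x) = h x\<close> exactly (\<open>harmonic_exists\<close>). The
boundedness rests on two facts: entries of a matrix in the support are comparable, so that the
means \<open>a_n = E ln \<bar>A_n ... A_1 e\<bar>\<close> are additive up to \<open>ln \<kappa>\<close>, and \<open>a_n / n \<rightarrow> 0\<close>
(\<open>growth_bounded\<close>, \<open>growth_rate_zero\<close>).

For the affine chain with transition operator \<open>P\<close>, put \<open>H = max h 0\<close>. Since \<open>B\<close> is nonnegative and \<open>h\<close>
is monotone, \<open>P H \<ge> H\<close>; and \<open>P H \<le> H + O(exp (- \<gamma> H))\<close>, because far from the origin \<open>B\<close> is a small
perturbation. The tent functions \<open>w_T = max (T - H) 0\<close> have compact support, so invariance of \<open>\<nu>\<close> gives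
\<open>\<integral> (P w_T - w_T) d\<nu> = 0\<close>. This balance is read in two ways.

First, \<open>P w_T - w_T\<close> is negative at most by \<open>O(exp (- \<gamma> H))\<close>, and only where \<open>H < T\<close>, while a few steps of
the chain make it positive on the shell \<open>T \<le> H \<le> T + 1\<close>, since some product of matrices in the support
contracts (\<open>contracting_element\<close>). Hence the mass of that shell is at most a constant times
\<open>\<integral> exp (- \<gamma> H) d\<nu>\<close> over \<open>H < T\<close>. A discrete Gronwall argument turns this into a uniform bound on shell
masses (\<open>shell_mass_bounded\<close>), which is the upper estimate.

Second, \<open>P w_T - w_T\<close> is positive at most by \<open>O(exp (- \<gamma> \<bar>H - T\<bar>))\<close>, that is, only near level \<open>T\<close>. From the set
\<open>H = 0\<close>, which has positive mass for a suitable normalisation of \<open>h\<close>, a few steps lower \<open>w_T\<close> by a fixed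
amount on average. So a fixed amount has to be compensated near level \<open>T\<close>, and with the bound on shell
masses some window \<open>\<bar>H - T\<bar> \<le> R\<close>, with \<open>R\<close> independent of \<open>T\<close>, carries mass bounded below
(\<open>window_mass_positive\<close>).

To pass from this wide window to a prescribed annulus, the density of the logarithms of the spectral
radii is used: the norms \<open>\<bar>g x\<bar>\<close>, with \<open>g\<close> a product of matrices in the support, are dense in
\<open>(0,\<infinity>)\<close> for every \<open>x \<noteq> 0\<close> (\<open>orbit_norms_dense\<close>). At large scale \<open>B\<close> is negligible, so by compactness the
chain moves from the window into the annulus within boundedly many steps with probability bounded
below (\<open>reaches_uniformly\<close>), and invariance transports the mass (\<open>annulus_mass_ge\<close>).\<close>

section \<open>The l1 norm and allowable matrices\<close>

abbreviation punctured_orthant :: "(real^'n) set" where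
  "punctured_orthant \<equiv> nonneg_orthant - {0}"

lemma l1norm_orthant: "x \<in> nonneg_orthant \<Longrightarrow> l1norm x = (\<Sum>i\<in>UNIV. x $ i)"
  by (simp add: l1norm_def nonneg_orthant_def)

lemma l1norm_nonneg [simp]: "0 \<le> l1norm x"
  by (simp add: l1norm_def sum_nonneg)

lemma l1norm_eq_0_iff [simp]: "l1norm x = 0 \<longleftrightarrow> x = 0"
  by (simp add: l1norm_def sum_nonneg_eq_0_iff vec_eq_iff)

lemma l1norm_0 [simp]: "l1norm 0 = 0"
  by simp

lemma l1norm_pos_iff [simp]: "0 < l1norm x \<longleftrightarrow> x \<noteq> 0"
  using l1norm_nonneg[of x] l1norm_eq_0_iff[of x] by linarith

lemma l1norm_le_0_iff [simp]: "l1norm x \<le> 0 \<longleftrightarrow> x = 0"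
  using l1norm_pos_iff[of x] by linarith

lemma l1norm_scaleR [simp]: "l1norm (c *\<^sub>R x) = \<bar>c\<bar> * l1norm x"
  by (simp add: l1norm_def abs_mult sum_distrib_left)

lemma l1norm_triangle: "l1norm (x + y) \<le> l1norm x + l1norm y"
  unfolding l1norm_def sum.distrib[symmetric] by (intro sum_mono) (simp add: abs_triangle_ineq)

lemma norm_le_l1norm: "norm x \<le> l1norm x"
  unfolding l1norm_def by (rule norm_le_l1_cart)

lemma continuous_on_l1norm [continuous_intros]:
  "continuous_on S f \<Longrightarrow> continuous_on S (\<lambda>x. l1norm (f x :: real^'n))"
  unfolding l1norm_def by (intro continuous_intros)

lemma tendsto_l1norm [tendsto_intros]:
  "(f \<longlongrightarrow> (a :: real^'n)) F \<Longrightarrow> ((\<lambda>x. l1norm (f x)) \<longlongrightarrow> l1norm a) F"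
  unfolding l1norm_def by (intro tendsto_intros)

lemma l1norm_measurable [measurable]: "l1norm \<in> borel_measurable borel"
  by (intro borel_measurable_continuous_onI continuous_intros)

lemma closed_nonneg_orthant: "closed (nonneg_orthant :: (real^'n) set)"
proof -
  have "closed (\<Inter>i. {v :: real^'n. 0 \<le> v $ i})"
    by (intro closed_INT ballI closed_Collect_le continuous_intros)
  moreover have "nonneg_orthant = (\<Inter>i. {v :: real^'n. 0 \<le> v $ i})"
    by (auto simp: nonneg_orthant_def)
  ultimately show ?thesis by metis
qed

lemma nonneg_orthant_borel [measurable]: "nonneg_orthant \<in> sets borel"
  using closed_nonneg_orthant by (rule borel_closed)

lemma compact_orthant_ball: "compact {x \<in> nonneg_orthant. l1norm (x :: real^'n) \<le> r}"
proof (rule compact_eq_bounded_closed[THEN iffD2], intro conjI)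
  show "bounded {x \<in> nonneg_orthant. l1norm (x :: real^'n) \<le> r}"
    unfolding bounded_iff using norm_le_l1norm order_trans by blast
  have "{x \<in> nonneg_orthant. l1norm (x :: real^'n) \<le> r} = nonneg_orthant \<inter> {x. l1norm x \<le> r}"
    by auto
  then show "closed {x \<in> nonneg_orthant. l1norm (x :: real^'n) \<le> r}"
    by (auto intro!: closed_Int closed_nonneg_orthant closed_Collect_le continuous_intros)
qed

lemma orthant_0 [simp]: "0 \<in> nonneg_orthant"
  by (simp add: nonneg_orthant_def)

lemma orthant_add [intro]: "x \<in> nonneg_orthant \<Longrightarrow> y \<in> nonneg_orthant \<Longrightarrow> x + y \<in> nonneg_orthant"
  by (simp add: nonneg_orthant_def)

lemma orthant_scaleR [intro]: "x \<in> nonneg_orthant \<Longrightarrow> 0 \<le> c \<Longrightarrow> c *\<^sub>R x \<in> nonneg_orthant"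
  by (simp add: nonneg_orthant_def)

lemma l1norm_mono:
  assumes "x \<in> nonneg_orthant" "\<And>i. x $ i \<le> y $ i"
  shows "l1norm x \<le> l1norm y"
  unfolding l1norm_def
proof (rule sum_mono)
  fix i show "\<bar>x $ i\<bar> \<le> \<bar>y $ i\<bar>"
    using assms(1) assms(2)[of i] by (auto simp: nonneg_orthant_def)
qed

lemma l1norm_le_add:
  assumes "x \<in> nonneg_orthant" "b \<in> nonneg_orthant"
  shows "l1norm x \<le> l1norm (x + b)"
  using assms by (intro l1norm_mono) (auto simp: nonneg_orthant_def)

lemma punctured_orthant_add:
  assumes "x \<in> punctured_orthant" "b \<in> nonneg_orthant"
  shows "x + b \<in> punctured_orthant"
proof -
  have "0 < l1norm (x + b)"
    using assms l1norm_le_add[of x b] l1norm_pos_iff[of x] by (metis Diff_iff insertI1 order_less_le_trans)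
  then show ?thesis using assms by auto
qed

lemma allowable_mult_orthant:
  assumes "g \<in> allowable" "x \<in> nonneg_orthant"
  shows "g *v x \<in> nonneg_orthant"
  using assms by (auto simp: nonneg_orthant_def allowable_def matrix_vector_mult_def intro!: sum_nonneg)

lemma allowable_mult_mono:
  assumes "g \<in> allowable" "\<And>i. x $ i \<le> y $ i"
  shows "(g *v x) $ i \<le> (g *v y) $ i"
  using assms by (auto simp: allowable_def matrix_vector_mult_def intro!: sum_mono mult_left_mono)

definition colsum :: "real^'n^'n \<Rightarrow> 'n \<Rightarrow> real" where
  "colsum g j = (\<Sum>i\<in>UNIV. g $ i $ j)"

lemma l1norm_mult:
  assumes "g \<in> allowable" "x \<in> nonneg_orthant"
  shows "l1norm (g *v x) = (\<Sum>j\<in>UNIV. colsum g j * x $ j)"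
proof -
  have "l1norm (g *v x) = (\<Sum>i\<in>UNIV. \<Sum>j\<in>UNIV. g $ i $ j * x $ j)"
    unfolding l1norm_orthant[OF allowable_mult_orthant[OF assms]]
    by (simp add: matrix_vector_mult_def)
  also have "\<dots> = (\<Sum>j\<in>UNIV. colsum g j * x $ j)"
    unfolding colsum_def sum_distrib_right by (rule sum.swap)
  finally show ?thesis .
qed

lemma colsum_pos:
  assumes "g \<in> allowable"
  shows "0 < colsum g j"
proof -
  obtain i where "0 < g $ i $ j" using assms unfolding allowable_def by blast
  then show ?thesis
    unfolding colsum_def using assms by (intro sum_pos2[where i = i]) (auto simp: allowable_def)
qed

lemma axis_in_punctured_orthant: "axis j (1::real) \<in> punctured_orthant"
  by (auto simp: nonneg_orthant_def axis_def vec_eq_iff)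

lemma l1norm_axis [simp]: "l1norm (axis j (1::real)) = 1"
  by (simp add: l1norm_def axis_def if_distrib cong: if_cong)

lemma l1norm_mult_axis: "g \<in> allowable \<Longrightarrow> l1norm (g *v axis j 1) = colsum g j"
  using axis_in_punctured_orthant[of j]
  by (subst l1norm_mult) (auto simp: axis_def if_distrib cong: if_cong)

lemma ratio_bounds:
  assumes g: "g \<in> allowable" and x: "x \<in> punctured_orthant"
  shows "l1norm (g *v x) / l1norm x \<le> Max (range (colsum g))"
    and "Min (range (colsum g)) \<le> l1norm (g *v x) / l1norm x"
proof -
  have x0: "0 < l1norm x" "x \<in> nonneg_orthant" using x by auto
  have "(\<Sum>j\<in>UNIV. colsum g j * x $ j) \<le> (\<Sum>j\<in>UNIV. Max (range (colsum g)) * x $ j)"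
    using x0 by (intro sum_mono mult_right_mono) (auto simp: nonneg_orthant_def)
  then show "l1norm (g *v x) / l1norm x \<le> Max (range (colsum g))"
    using x0 by (simp add: l1norm_mult[OF g] l1norm_orthant sum_distrib_left[symmetric] divide_le_eq)
  have "(\<Sum>j\<in>UNIV. Min (range (colsum g)) * x $ j) \<le> (\<Sum>j\<in>UNIV. colsum g j * x $ j)"
    using x0 by (intro sum_mono mult_right_mono) (auto simp: nonneg_orthant_def)
  then show "Min (range (colsum g)) \<le> l1norm (g *v x) / l1norm x"
    using x0 by (simp add: l1norm_mult[OF g] l1norm_orthant sum_distrib_left[symmetric] le_divide_eq)
qed

text \<open>On nonnegative vectors \<open>\<bar>g x\<bar>\<close> is the linear form given by the column sums of \<open>g\<close>; its extreme values on
the unit simplex are attained at the vertices. This makes \<open>matnorm\<close> and \<open>iota_min\<close> maxima and minima of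
finitely many measurable functions.\<close>

lemma matnorm_eq: assumes g: "g \<in> allowable" shows "matnorm g = Max (range (colsum g))"
proof -
  have "Max (range (colsum g)) \<in> range (colsum g)" by (intro Max_in) auto
  then obtain j where "Max (range (colsum g)) = colsum g j" by (rule rangeE)
  then have "Max (range (colsum g)) = l1norm (g *v axis j 1) / l1norm (axis j (1::real))"
    by (simp add: l1norm_mult_axis[OF g])
  then show ?thesis
    unfolding matnorm_def
  proof (intro cSup_eq_maximum)
    fix y assume "y \<in> (\<lambda>v. l1norm (g *v v) / l1norm v) ` punctured_orthant"
    then show "y \<le> Max (range (colsum g))" using ratio_bounds(1)[OF g] by blast
  qed (rule image_eqI[OF _ axis_in_punctured_orthant])
qed

lemma iota_min_eq: assumes g: "g \<in> allowable" shows "iota_min g = Min (range (colsum g))"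
proof -
  have "Min (range (colsum g)) \<in> range (colsum g)" by (intro Min_in) auto
  then obtain j where "Min (range (colsum g)) = colsum g j" by (rule rangeE)
  then have "Min (range (colsum g)) = l1norm (g *v axis j 1) / l1norm (axis j (1::real))"
    by (simp add: l1norm_mult_axis[OF g])
  then show ?thesis
    unfolding iota_min_def
  proof (intro cInf_eq_minimum)
    fix y assume "y \<in> (\<lambda>v. l1norm (g *v v) / l1norm v) ` punctured_orthant"
    then show "Min (range (colsum g)) \<le> y" using ratio_bounds(2)[OF g] by blast
  qed (rule image_eqI[OF _ axis_in_punctured_orthant])
qed

lemma l1norm_mult_le:
  assumes "g \<in> allowable" "x \<in> nonneg_orthant"
  shows "l1norm (g *v x) \<le> matnorm g * l1norm x"
proof (cases "x = 0")
  case False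
  then have "0 < l1norm x" by simp
  then show ?thesis
    using ratio_bounds(1)[OF assms(1), of x] assms False unfolding matnorm_eq[OF assms(1)]
    by (simp add: divide_le_eq del: l1norm_pos_iff)
qed simp

lemma l1norm_mult_ge:
  assumes "g \<in> allowable" "x \<in> nonneg_orthant"
  shows "iota_min g * l1norm x \<le> l1norm (g *v x)"
proof (cases "x = 0")
  case False
  then have "0 < l1norm x" by simp
  then show ?thesis
    using ratio_bounds(2)[OF assms(1), of x] assms False unfolding iota_min_eq[OF assms(1)]
    by (simp add: le_divide_eq del: l1norm_pos_iff)
qed simp

lemma iota_min_pos: "g \<in> allowable \<Longrightarrow> 0 < iota_min g"
  by (simp add: iota_min_eq colsum_pos)

lemma iota_le_matnorm: "g \<in> allowable \<Longrightarrow> iota_min g \<le> matnorm g"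
  using Min_le[of "range (colsum g)" "colsum g undefined"] Max_ge[of "range (colsum g)" "colsum g undefined"]
  by (simp add: iota_min_eq matnorm_eq)

lemma Nmax_ge_1: assumes g: "g \<in> allowable" shows "1 \<le> Nmax g"
proof (cases "1 \<le> matnorm g")
  case False
  then have "iota_min g \<le> 1" using iota_le_matnorm[OF g] by simp
  then show ?thesis unfolding Nmax_def using iota_min_pos[OF g] using one_le_inverse[of "iota_min g"] by auto
qed (simp add: Nmax_def)

lemma l1norm_mult_le_Nmax:
  assumes "g \<in> allowable" "x \<in> nonneg_orthant"
  shows "l1norm (g *v x) \<le> Nmax g * l1norm x"
  using l1norm_mult_le[OF assms] mult_right_mono[of "matnorm g" "Nmax g" "l1norm x"]
  by (simp add: Nmax_def)

lemma l1norm_le_Nmax_mult: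
  assumes "g \<in> allowable" "x \<in> nonneg_orthant"
  shows "l1norm x \<le> Nmax g * l1norm (g *v x)"
proof -
  have "l1norm x \<le> inverse (iota_min g) * l1norm (g *v x)"
    using l1norm_mult_ge[OF assms] iota_min_pos[OF assms(1)] by (simp add: field_simps)
  also have "\<dots> \<le> Nmax g * l1norm (g *v x)" by (intro mult_right_mono) (auto simp: Nmax_def)
  finally show ?thesis .
qed

lemma allowable_mult_punctured:
  assumes "g \<in> allowable" "x \<in> punctured_orthant"
  shows "g *v x \<in> punctured_orthant"
  using assms l1norm_mult_ge[of g x] iota_min_pos[of g] allowable_mult_orthant[of g x]
    l1norm_pos_iff[of x]
  by (auto simp: mult_le_0_iff simp del: l1norm_pos_iff)

lemma allowable_mult: assumes g: "g \<in> allowable" and h: "h \<in> allowable" shows "g ** h \<in> allowable"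
proof -
  have nn: "0 \<le> g $ i $ j" "0 \<le> h $ i $ j" for i j using g h by (auto simp: allowable_def)
  have pos: "0 < (g ** h) $ i $ j" if "0 < g $ i $ k" "0 < h $ k $ j" for i j k
    unfolding matrix_matrix_mult_def using that nn
    by (auto intro!: sum_pos2[where i = k])
  have "0 \<le> (g ** h) $ i $ j" for i j
    unfolding matrix_matrix_mult_def by (auto intro!: sum_nonneg mult_nonneg_nonneg nn)
  moreover have "\<exists>j. 0 < (g ** h) $ i $ j" for i
    using g h pos unfolding allowable_def by simp meson
  moreover have "\<exists>i. 0 < (g ** h) $ i $ j" for j
    using g h pos unfolding allowable_def by simp meson
  ultimately show ?thesis by (simp add: allowable_def)
qed

lemma pos_matrices_allowable: "pos_matrices \<subseteq> allowable"
  by (auto simp: pos_matrices_def allowable_def less_imp_le)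

lemma allowable_borel [measurable]: "allowable \<in> sets (borel :: (real^'n^'n) measure)"
proof -
  have c: "(\<lambda>g :: real^'n^'n. g $ i $ j) \<in> borel_measurable borel" for i j
    by (intro borel_measurable_continuous_onI continuous_intros)
  have "allowable = {g \<in> space (borel :: (real^'n^'n) measure).
      (\<forall>i j. 0 \<le> g $ i $ j) \<and> (\<forall>i. \<exists>j. 0 < g $ i $ j) \<and> (\<forall>j. \<exists>i. 0 < g $ i $ j)}"
    by (simp add: allowable_def)
  also have "\<dots> \<in> sets borel" using c by measurable
  finally show ?thesis .
qed

definition unif_vec :: "real^'n" where "unif_vec = (\<chi> i. 1 / real CARD('n))"

lemma unif_vec_orthant [simp]: "unif_vec \<in> nonneg_orthant" "unif_vec \<noteq> 0"
  by (auto simp: unif_vec_def nonneg_orthant_def vec_eq_iff)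

lemma l1norm_unif_vec [simp]: "l1norm unif_vec = 1"
  by (simp add: unif_vec_def l1norm_def)

text \<open>A maximum of nonnegative column sums is at most their sum. So the norm of \<open>g\<close> can be read off from the
single vector \<open>g e\<close>, up to a factor that depends on the dimension alone.\<close>

lemma matnorm_le_unif:
  assumes g: "(g :: real^'n^'n) \<in> allowable"
  shows "matnorm g \<le> real CARD('n) * l1norm (g *v unif_vec)"
proof -
  have "real CARD('n) * l1norm (g *v unif_vec) = (\<Sum>j\<in>UNIV. colsum g j)"
    by (subst l1norm_mult[OF g]) (simp_all, simp add: unif_vec_def sum_divide_distrib[symmetric])
  moreover have "colsum g j \<le> (\<Sum>j\<in>UNIV. colsum g j)" for j
    by (rule member_le_sum) (auto simp: colsum_pos[OF g] less_imp_le)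
  ultimately show ?thesis by (simp add: matnorm_eq[OF g])
qed

lemma Nmax_measurable:
  assumes [measurable]: "A \<in> borel_measurable M" and A: "\<And>\<omega>. \<omega> \<in> space M \<Longrightarrow> A \<omega> \<in> allowable"
  shows "(\<lambda>\<omega>. Nmax (A \<omega> :: real^'n^'n)) \<in> borel_measurable M"
    and "(\<lambda>\<omega>. iota_min (A \<omega>)) \<in> borel_measurable M"
proof -
  have c: "(\<lambda>\<omega>. colsum (A \<omega>) j) \<in> borel_measurable M" for j
    unfolding colsum_def
    by (rule measurable_compose[OF assms(1)]) (intro borel_measurable_continuous_onI continuous_intros)
  have i: "(\<lambda>\<omega>. Min (range (colsum (A \<omega>)))) \<in> borel_measurable M"
    and m: "(\<lambda>\<omega>. Max (range (colsum (A \<omega>)))) \<in> borel_measurable M"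
    using c by (auto intro!: borel_measurable_Min borel_measurable_Max)
  show "(\<lambda>\<omega>. iota_min (A \<omega>)) \<in> borel_measurable M"
    using i A by (subst measurable_cong[where g = "\<lambda>\<omega>. Min (range (colsum (A \<omega>)))"])
      (auto simp: iota_min_eq)
  have "(\<lambda>\<omega>. max (inverse (Min (range (colsum (A \<omega>))))) (Max (range (colsum (A \<omega>))))) \<in> borel_measurable M"
    using i m by measurable
  then show "(\<lambda>\<omega>. Nmax (A \<omega>)) \<in> borel_measurable M"
    using A by (subst measurable_cong[where g =
      "\<lambda>\<omega>. max (inverse (Min (range (colsum (A \<omega>))))) (Max (range (colsum (A \<omega>))))"])
      (auto simp: iota_min_eq matnorm_eq Nmax_def)
qed

lemma measurable_mult_vec [measurable]:
  assumes "f \<in> borel_measurable N" "g \<in> borel_measurable N"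
  shows "(\<lambda>x. (f x :: real^'n^'n) *v g x) \<in> borel_measurable N"
  using assms
proof (rule borel_measurable_continuous_Pair)
  show "continuous_on UNIV (\<lambda>p. (fst p :: real^'n^'n) *v snd p)"
    unfolding matrix_vector_mult_def by (intro continuous_intros)
qed

lemma continuous_on_mult_vec [continuous_intros]:
  "continuous_on S f \<Longrightarrow> continuous_on S g \<Longrightarrow> continuous_on S (\<lambda>x. (f x :: real^'n^'m) *v g x)"
  unfolding matrix_vector_mult_def by (intro continuous_intros)

section \<open>Additive semigroups of real numbers\<close>

text \<open>A multiple of \<open>a\<close> nearly cancels a multiple of an element of opposite sign, by Dirichlet's
approximation theorem; removing one copy of \<open>a\<close> leaves an element of \<open>T\<close> close to \<open>- a\<close>.\<close>

lemma real_closed_semigroup_is_group: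
  fixes T :: "real set"
  assumes T: "closed T" "\<And>x y. x \<in> T \<Longrightarrow> y \<in> T \<Longrightarrow> x + y \<in> T" "0 \<in> T"
    and p: "p \<in> T" "0 < p" and q: "q \<in> T" "q < 0"
    and a: "a \<in> T"
  shows "- a \<in> T"
proof -
  have mult: "real n * x \<in> T" if "x \<in> T" for n x
    using that T by (induction n) (auto simp: algebra_simps)
  have *: "\<exists>t\<in>T. \<bar>t - (- a)\<bar> < \<epsilon>" if "\<epsilon> > 0" and c: "c \<in> T" "c \<noteq> 0" and ac: "a / c < 0" for \<epsilon> c
  proof -
    define r where "r = - a / c"
    have r: "r > 0" using ac by (simp add: r_def)
    obtain N :: nat where N: "N > 0" "\<bar>c\<bar> / real N < \<epsilon>"
    proof -
      obtain N :: nat where "\<bar>c\<bar> / \<epsilon> < real N" using reals_Archimedean2 by blast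
      then have "0 < real N" using divide_nonneg_pos[OF abs_ge_zero \<open>\<epsilon> > 0\<close>, of c] by linarith
      with \<open>\<bar>c\<bar> / \<epsilon> < real N\<close> show ?thesis using that[of N] \<open>\<epsilon> > 0\<close> by (simp add: field_simps)
    qed
    obtain h k where hk: "0 < k" "k \<le> int N" "\<bar>of_int k * r - of_int h\<bar> < 1 / real N"
      using Dirichlet_approx[OF N(1)] by metis
    have "1 / real N \<le> 1" using N by simp
    moreover have "0 < of_int k * r" using hk r by simp
    ultimately have "of_int h > (-1::real)" using hk by linarith
    then have h: "h \<ge> 0" by linarith
    define t where "t = real (nat (k - 1)) * a + real (nat h) * c"
    have "t \<in> T" unfolding t_def using mult a c T by blast
    moreover have "\<bar>t - (- a)\<bar> < \<epsilon>"
    proof -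
      have "t - (- a) = of_int k * a + of_int h * c"
        using hk h by (simp add: t_def algebra_simps)
      also have "\<dots> = - c * (of_int k * r - of_int h)"
        using c by (simp add: r_def field_simps)
      finally have "\<bar>t - (- a)\<bar> = \<bar>c\<bar> * \<bar>of_int k * r - of_int h\<bar>" by (simp add: abs_mult)
      also have "\<dots> \<le> \<bar>c\<bar> * (1 / real N)" using hk(3) by (intro mult_left_mono) auto
      finally show ?thesis using N by simp
    qed
    ultimately show ?thesis by blast
  qed
  show ?thesis
  proof (cases "a = 0")
    case False
    then obtain c where "c \<in> T" "c \<noteq> 0" "a / c < 0"
      using p q by (metis divide_neg_pos divide_pos_neg less_irrefl linorder_neqE_linordered_idom)
    then have "- a \<in> closure T" using * unfolding closure_approachable dist_real_def by blast
    then show ?thesis using T by simp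
  qed (use T in simp)
qed

text \<open>The closure of the generated semigroup is a closed semigroup with elements of both signs, hence a group,
hence everything. This is how density of a generated group, where inverses are allowed, yields small
values of genuine products of matrices.\<close>

lemma small_positive_combination:
  fixes S :: "real set"
  assumes dense: "closure (group_closure S) = UNIV"
    and p: "p \<in> S" "0 < p" and q: "q \<in> S" "q < 0" and \<eta>: "0 < \<eta>"
  obtains xs where "set xs \<subseteq> S" "0 < sum_list xs" "sum_list xs < \<eta>"
proof -
  define T0 where "T0 = sum_list ` lists S"
  define T where "T = closure T0"
  have T0_add: "x + y \<in> T0" if "x \<in> T0" "y \<in> T0" for x y
  proof -
    obtain xs ys where "x = sum_list xs" "y = sum_list ys" "xs \<in> lists S" "ys \<in> lists S"
      using \<open>x \<in> T0\<close> \<open>y \<in> T0\<close> unfolding T0_def by auto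
    then show ?thesis unfolding T0_def by (intro image_eqI[of _ _ "xs @ ys"]) auto
  qed
  have ST: "S \<subseteq> T"
  proof
    fix x assume "x \<in> S"
    then have "x \<in> T0" unfolding T0_def by (intro image_eqI[of _ _ "[x]"]) auto
    then show "x \<in> T" unfolding T_def using closure_subset by blast
  qed
  have zero: "0 \<in> T"
  proof -
    have "0 \<in> T0" unfolding T0_def by (intro image_eqI[of _ _ "[]"]) auto
    then show ?thesis unfolding T_def using closure_subset by blast
  qed
  have T_add: "x + y \<in> T" if xy: "x \<in> T" "y \<in> T" for x y
  proof -
    obtain f g where "\<And>n. f n \<in> T0" "f \<longlonglongrightarrow> x" "\<And>n. g n \<in> T0" "g \<longlonglongrightarrow> y"
      using xy unfolding T_def closure_sequential by blast
    then show ?thesis unfolding T_def closure_sequential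
      by (intro exI[of _ "\<lambda>n. f n + g n"]) (auto intro!: tendsto_add T0_add)
  qed
  have neg: "- a \<in> T" if "a \<in> T" for a
    using p q ST T_add that zero
    by (intro real_closed_semigroup_is_group[of T p q]) (auto simp: T_def)
  have "group_closure S \<subseteq> T"
  proof
    fix x assume "x \<in> group_closure S"
    then show "x \<in> T"
    proof induction
      case (diff s t) then show ?case using T_add[of s "- t"] neg[of t] by simp
    qed (use ST zero in auto)
  qed
  then have "closure (group_closure S) \<subseteq> T"
    unfolding T_def by (intro closure_minimal) auto
  then have "\<eta> / 2 \<in> closure T0" using dense by (auto simp: T_def)
  then obtain t where "t \<in> T0" "dist t (\<eta> / 2) < \<eta> / 2"
    using \<eta> unfolding closure_approachable by (meson half_gt_zero)
  then have "t \<in> T0" "0 < t" "t < \<eta>" by (auto simp: dist_real_def abs_if split: if_splits)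
  then obtain xs where "t = sum_list xs" "xs \<in> lists S" unfolding T0_def by blast
  with \<open>0 < t\<close> \<open>t < \<eta>\<close> show ?thesis by (intro that[of xs]) auto
qed

section \<open>Perron--Frobenius theory and dense orbits\<close>

text \<open>A fixed point of \<open>x \<mapsto> g x / \<bar>g x\<bar>\<close> on the simplex, by Brouwer. Positivity of \<open>g\<close> makes all its
coordinates positive.\<close>

lemma perron_eigenvector:
  fixes g :: "real^'n^'n"
  assumes g: "g \<in> pos_matrices"
  obtains v \<rho> where "\<And>i. 0 < v $ i" "0 < \<rho>" "g *v v = \<rho> *\<^sub>R v"
proof -
  let ?S = "{x \<in> nonneg_orthant. l1norm (x :: real^'n) = 1}"
  let ?f = "\<lambda>x. (1 / l1norm (g *v x)) *\<^sub>R (g *v x)"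
  have al: "g \<in> allowable" using g pos_matrices_allowable by blast
  have pos: "g *v x \<in> punctured_orthant" if "x \<in> ?S" for x
    using that by (intro allowable_mult_punctured al) auto
  have "compact ?S"
  proof -
    have "?S = {x \<in> nonneg_orthant. l1norm x \<le> 1} \<inter> {x. l1norm x = 1}" by auto
    then show ?thesis
      by (simp only:) (intro compact_Int_closed compact_orthant_ball closed_Collect_eq continuous_intros)
  qed
  moreover have "convex ?S"
  proof (rule convexI)
    fix x y :: "real^'n" and s t :: real
    assume *: "x \<in> ?S" "y \<in> ?S" "0 \<le> s" "0 \<le> t" "s + t = 1"
    then have o: "s *\<^sub>R x + t *\<^sub>R y \<in> nonneg_orthant" by auto
    have "l1norm (s *\<^sub>R x + t *\<^sub>R y) = s * (\<Sum>i\<in>UNIV. x $ i) + t * (\<Sum>i\<in>UNIV. y $ i)"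
      unfolding l1norm_orthant[OF o] by (simp add: sum.distrib sum_distrib_left)
    also have "\<dots> = s * l1norm x + t * l1norm y"
      using * l1norm_orthant[of x] l1norm_orthant[of y] by simp
    finally have "l1norm (s *\<^sub>R x + t *\<^sub>R y) = s * l1norm x + t * l1norm y" .
    with o * show "s *\<^sub>R x + t *\<^sub>R y \<in> ?S" by simp
  qed
  moreover have "?S \<noteq> {}"
  proof -
    have "unif_vec \<in> ?S" by simp
    then show ?thesis by (metis empty_iff)
  qed
  moreover have "continuous_on ?S ?f"
  proof (intro continuous_intros ballI)
    fix x assume "x \<in> ?S"
    from pos[OF this] show "l1norm (g *v x) \<noteq> 0" by simp
  qed
  moreover have "?f \<in> ?S \<rightarrow> ?S"
  proof
    fix x assume "x \<in> ?S"
    from pos[OF this] have "l1norm (g *v x) > 0" "g *v x \<in> nonneg_orthant" by auto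
    then show "?f x \<in> ?S" by (simp add: orthant_scaleR)
  qed
  ultimately obtain v where v: "v \<in> ?S" "?f v = v" by (rule brouwer)
  define \<rho> where "\<rho> = l1norm (g *v v)"
  have \<rho>: "0 < \<rho>" unfolding \<rho>_def using pos[OF v(1)] by auto
  have "\<rho> *\<^sub>R ?f v = g *v v" using \<rho> by (simp add: \<rho>_def)
  then have ev: "g *v v = \<rho> *\<^sub>R v" using v(2) by simp
  have "0 < v $ i" for i
  proof -
    have "v \<noteq> 0" using v(1) by auto
    then obtain j where "v $ j \<noteq> 0" by (auto simp: vec_eq_iff)
    moreover have nn: "0 \<le> v $ k" for k using v(1) by (auto simp: nonneg_orthant_def)
    ultimately have "0 < v $ j" by (simp add: order.strict_iff_order)
    then have "0 < (g *v v) $ i" unfolding matrix_vector_mult_def using g nn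
      by (auto simp: pos_matrices_def less_imp_le intro!: sum_pos2[where i = j])
    then show ?thesis using ev \<rho> by (simp add: zero_less_mult_iff)
  qed
  then show ?thesis using \<rho> ev that by blast
qed

lemma perron_pair:
  fixes g :: "real^'n^'n"
  assumes g: "g \<in> pos_matrices"
  obtains u v \<rho> where "\<And>i. 0 < u $ i" "\<And>i. 0 < v $ i" "0 < \<rho>"
    "g *v v = \<rho> *\<^sub>R v" "u v* g = \<rho> *\<^sub>R u"
proof -
  obtain v \<rho> where v: "\<And>i. 0 < v $ i" "0 < \<rho>" "g *v v = \<rho> *\<^sub>R v"
    using perron_eigenvector[OF g] by metis
  have "transpose g \<in> pos_matrices" using g by (simp add: pos_matrices_def transpose_def)
  then obtain u \<sigma> where u: "\<And>i. 0 < u $ i" "0 < \<sigma>" "transpose g *v u = \<sigma> *\<^sub>R u"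
    using perron_eigenvector by metis
  have "0 < u \<bullet> v" unfolding inner_vec_def using u v by (intro sum_pos) auto
  moreover have "\<sigma> * (u \<bullet> v) = \<rho> * (u \<bullet> v)"
    using dot_lmul_matrix[of u g v] u v by simp
  ultimately have "\<sigma> = \<rho>" by simp
  then show ?thesis using u v by (intro that[of u v \<rho>]) simp_all
qed

text \<open>Pairing \<open>\<bar>z\<bar> \<bar>w\<bar> \<le> g \<bar>w\<bar>\<close>, valid for a complex eigenvector \<open>w\<close>, with the positive left eigenvector \<open>u\<close>
bounds every eigenvalue by \<open>\<rho>\<close>.\<close>

lemma spec_radius_eq_perron_root:
  fixes g :: "real^'n^'n"
  assumes g: "g \<in> pos_matrices"
    and u: "\<And>i. 0 < u $ i" and v: "\<And>i. 0 < v $ i" and \<rho>: "0 < \<rho>"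
    and ev: "g *v v = \<rho> *\<^sub>R v" and eu: "u v* g = \<rho> *\<^sub>R u"
  shows "spec_radius g = \<rho>"
proof -
  have gp: "0 < g $ i $ j" for i j using g by (simp add: pos_matrices_def)
  have le: "cmod z \<le> \<rho>" if "z \<in> complex_eigenvalues g" for z
  proof -
    obtain w where w: "w \<noteq> 0" "(\<chi> i j. complex_of_real (g $ i $ j)) *v w = z *s w"
      using \<open>z \<in> complex_eigenvalues g\<close>[unfolded complex_eigenvalues_def mem_Collect_eq]
      by (elim exE conjE) (rule that)
    define W where "W = (\<Sum>i\<in>UNIV. u $ i * cmod (w $ i))"
    obtain k where "w $ k \<noteq> 0" using w(1) by (auto simp: vec_eq_iff)
    then have "0 < W" unfolding W_def using u
      by (intro sum_pos2[where i = k]) (auto simp: less_imp_le)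
    have row: "cmod z * cmod (w $ i) \<le> (\<Sum>j\<in>UNIV. g $ i $ j * cmod (w $ j))" for i
    proof -
      have "z * w $ i = (\<Sum>j\<in>UNIV. complex_of_real (g $ i $ j) * w $ j)"
        using w(2) by (simp add: vec_eq_iff matrix_vector_mult_def)
      then have "cmod (z * w $ i) \<le> (\<Sum>j\<in>UNIV. cmod (complex_of_real (g $ i $ j) * w $ j))"
        by (simp add: norm_sum)
      then show ?thesis using gp by (simp add: norm_mult less_imp_le)
    qed
    have "cmod z * W = (\<Sum>i\<in>UNIV. u $ i * (cmod z * cmod (w $ i)))"
      unfolding W_def by (simp add: sum_distrib_left algebra_simps)
    also have "\<dots> \<le> (\<Sum>i\<in>UNIV. u $ i * (\<Sum>j\<in>UNIV. g $ i $ j * cmod (w $ j)))"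
      using u row by (intro sum_mono mult_left_mono) (auto simp: less_imp_le)
    also have "\<dots> = (\<Sum>j\<in>UNIV. (\<Sum>i\<in>UNIV. g $ i $ j * u $ i) * cmod (w $ j))"
      unfolding sum_distrib_left sum_distrib_right by (subst sum.swap) (simp add: algebra_simps)
    also have "\<dots> = (\<Sum>j\<in>UNIV. \<rho> * u $ j * cmod (w $ j))"
      using eu by (simp add: vec_eq_iff vector_matrix_mult_def mult.commute)
    also have "\<dots> = \<rho> * W" unfolding W_def by (simp add: sum_distrib_left algebra_simps)
    finally show ?thesis using \<open>0 < W\<close> by simp
  qed
  have "complex_of_real \<rho> \<in> complex_eigenvalues g"
  proof -
    let ?v = "\<chi> i. complex_of_real (v $ i)"
    have "(\<Sum>j\<in>UNIV. complex_of_real (g $ i $ j) * complex_of_real (v $ j)) = complex_of_real (\<rho> * v $ i)" for i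
    proof -
      have "(\<Sum>j\<in>UNIV. g $ i $ j * v $ j) = \<rho> * v $ i"
        using ev by (simp add: vec_eq_iff matrix_vector_mult_def)
      then show ?thesis by (metis (no_types, lifting) of_real_mult of_real_sum sum.cong)
    qed
    then have "(\<chi> i j. complex_of_real (g $ i $ j)) *v ?v = complex_of_real \<rho> *s ?v"
      by (simp add: vec_eq_iff matrix_vector_mult_def)
    moreover have "?v \<noteq> 0"
    proof
      assume "?v = 0"
      then have "\<forall>i. v $ i = 0" by (simp add: vec_eq_iff)
      then show False using v by (metis less_irrefl)
    qed
    ultimately show ?thesis unfolding complex_eigenvalues_def by (intro CollectI exI[of _ ?v] conjI)
  qed
  then show ?thesis unfolding spec_radius_def using le \<rho>
    by (intro cSup_eq_maximum) (auto intro!: image_eqI[of _ _ "complex_of_real \<rho>"])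
qed

text \<open>Subtracting from \<open>g / \<rho>\<close> a small multiple of the rank one matrix \<open>v u\<^sup>T\<close> changes nothing on the
hyperplane orthogonal to \<open>u\<close> and keeps the entries nonnegative. It lowers the factor by which the
norm weighted by \<open>u\<close> can grow from \<open>1\<close> to some \<open>\<theta> < 1\<close>.\<close>

lemma perron_contraction:
  fixes g :: "real^'n^'n"
  assumes g: "g \<in> pos_matrices"
    and u: "\<And>i. 0 < u $ i" and v: "\<And>i. 0 < v $ i" and \<rho>: "0 < \<rho>"
    and ev: "g *v v = \<rho> *\<^sub>R v" and eu: "u v* g = \<rho> *\<^sub>R u"
  obtains \<theta> where "0 \<le> \<theta>" "\<theta> < 1"
    "\<And>y. u \<bullet> y = 0 \<Longrightarrow>
      (\<Sum>i\<in>UNIV. u $ i * \<bar>((1 / \<rho>) *\<^sub>R (g *v y)) $ i\<bar>) \<le> \<theta> * (\<Sum>i\<in>UNIV. u $ i * \<bar>y $ i\<bar>)"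
proof -
  define c where "c = u \<bullet> v"
  have c: "0 < c" unfolding c_def inner_vec_def using u v by (intro sum_pos) auto
  define q where "q = (\<lambda>(i, j). g $ i $ j / (\<rho> * v $ i * u $ j))"
  \<comment> \<open>The second term keeps \<open>g / \<rho> - \<epsilon> v u\<^sup>T\<close> nonnegative, the first one keeps \<open>\<theta> = 1 - \<epsilon> c\<close> nonnegative.\<close>
  define \<epsilon> where "\<epsilon> = min (1 / c) (Min (range q))"
  have qpos: "0 < q p" for p using g u v \<rho> by (auto simp: q_def pos_matrices_def split: prod.splits)
  have \<epsilon>: "0 < \<epsilon>" "\<epsilon> * c \<le> 1"
  proof -
    have "0 < Min (range q)" using qpos by (subst Min_gr_iff) auto
    then show "0 < \<epsilon>" using c by (simp add: \<epsilon>_def)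
    have "\<epsilon> * c \<le> 1 / c * c" unfolding \<epsilon>_def using c by (intro mult_right_mono) auto
    then show "\<epsilon> * c \<le> 1" using c by simp
  qed
  define G where "G i j = g $ i $ j / \<rho> - \<epsilon> * v $ i * u $ j" for i j
  have Gnn: "0 \<le> G i j" for i j
  proof -
    have "\<epsilon> \<le> q (i, j)" unfolding \<epsilon>_def by (simp add: min.coboundedI2)
    then have "\<epsilon> * (v $ i * u $ j) \<le> q (i, j) * (v $ i * u $ j)"
      using u[of j] v[of i] by (intro mult_right_mono) auto
    also have "\<dots> = g $ i $ j / \<rho>" using u[of j] v[of i] \<rho> by (simp add: q_def field_simps)
    finally show ?thesis by (simp add: G_def algebra_simps)
  qed
  show ?thesis
  proof (rule that[of "1 - \<epsilon> * c"])
    fix y assume y: "u \<bullet> y = 0"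
    have Gy: "((1 / \<rho>) *\<^sub>R (g *v y)) $ i = (\<Sum>j\<in>UNIV. G i j * y $ j)" for i
    proof -
      have "(\<Sum>j\<in>UNIV. G i j * y $ j) = (\<Sum>j\<in>UNIV. g $ i $ j * y $ j) / \<rho> - \<epsilon> * v $ i * (u \<bullet> y)"
        by (simp add: G_def left_diff_distrib sum_subtractf sum_distrib_left sum_divide_distrib
            inner_vec_def algebra_simps)
      then show ?thesis using y by (simp add: matrix_vector_mult_def)
    qed
    have "(\<Sum>i\<in>UNIV. u $ i * \<bar>((1 / \<rho>) *\<^sub>R (g *v y)) $ i\<bar>)
        \<le> (\<Sum>i\<in>UNIV. u $ i * (\<Sum>j\<in>UNIV. G i j * \<bar>y $ j\<bar>))"
      unfolding Gy
    proof (intro sum_mono mult_left_mono)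
      fix i show "\<bar>\<Sum>j\<in>UNIV. G i j * y $ j\<bar> \<le> (\<Sum>j\<in>UNIV. G i j * \<bar>y $ j\<bar>)"
        using sum_abs[of "\<lambda>j. G i j * y $ j" UNIV] Gnn by (simp add: abs_mult)
    qed (use u in \<open>auto simp: less_imp_le\<close>)
    also have "\<dots> = (\<Sum>j\<in>UNIV. (\<Sum>i\<in>UNIV. u $ i * G i j) * \<bar>y $ j\<bar>)"
      unfolding sum_distrib_left sum_distrib_right by (subst sum.swap) (simp add: algebra_simps)
    also have "\<dots> = (\<Sum>j\<in>UNIV. (1 - \<epsilon> * c) * u $ j * \<bar>y $ j\<bar>)"
    proof -
      have "(\<Sum>i\<in>UNIV. u $ i * G i j) = (1 - \<epsilon> * c) * u $ j" for j
      proof -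
        have "(\<Sum>i\<in>UNIV. g $ i $ j * u $ i) = \<rho> * u $ j"
          using eu by (simp add: vec_eq_iff vector_matrix_mult_def mult.commute)
        moreover have "(\<Sum>i\<in>UNIV. u $ i * G i j)
            = (\<Sum>i\<in>UNIV. g $ i $ j * u $ i) / \<rho> - \<epsilon> * u $ j * c"
          by (simp add: G_def right_diff_distrib sum_subtractf sum_distrib_left sum_divide_distrib
              inner_vec_def c_def algebra_simps)
        ultimately show ?thesis using \<rho> by (simp add: algebra_simps)
      qed
      then show ?thesis by simp
    qed
    finally show "(\<Sum>i\<in>UNIV. u $ i * \<bar>((1 / \<rho>) *\<^sub>R (g *v y)) $ i\<bar>)
        \<le> (1 - \<epsilon> * c) * (\<Sum>i\<in>UNIV. u $ i * \<bar>y $ i\<bar>)"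
      by (simp add: sum_distrib_left algebra_simps)
  qed (use \<epsilon> c in auto)
qed

text \<open>The component along \<open>v\<close> is preserved by \<open>g / \<rho>\<close> and the rest decays. The limit is independent of the
sequences, which is what lets several such limits be composed.\<close>

lemma perron_convergence:
  fixes g :: "real^'n^'n"
  assumes g: "g \<in> pos_matrices" and x': "x' \<in> punctured_orthant"
  shows "\<exists>y\<in>punctured_orthant. \<forall>x n. x \<longlonglongrightarrow> x' \<longrightarrow> filterlim n at_top sequentially \<longrightarrow>
    (\<lambda>j. exp (- real (n j) * ln (spec_radius g)) *\<^sub>R (((*v) g ^^ n j) (x j))) \<longlonglongrightarrow> y"
proof -
  obtain u v \<rho> where u: "\<And>i. 0 < u $ i" and v: "\<And>i. 0 < v $ i" and \<rho>: "0 < \<rho>"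
    and ev: "g *v v = \<rho> *\<^sub>R v" and eu: "u v* g = \<rho> *\<^sub>R u"
    using perron_pair[OF g] by metis
  have sr: "spec_radius g = \<rho>" using spec_radius_eq_perron_root[OF g u v \<rho> ev eu] .
  define wn where "wn y = (\<Sum>i\<in>UNIV. u $ i * \<bar>y $ i\<bar>)" for y :: "real^'n"
  define G where "G y = (1 / \<rho>) *\<^sub>R (g *v y)" for y
  obtain \<theta> where \<theta>: "0 \<le> \<theta>" "\<theta> < 1" "\<And>y. u \<bullet> y = 0 \<Longrightarrow> wn (G y) \<le> \<theta> * wn y"
    using perron_contraction[OF g u v \<rho> ev eu] unfolding wn_def G_def by blast
  have inv: "u \<bullet> G y = u \<bullet> y" for y
    using dot_lmul_matrix[of u g y, symmetric] \<rho> by (simp add: G_def eu)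
  have Giter: "(G ^^ m) y = exp (- real m * ln \<rho>) *\<^sub>R (((*v) g ^^ m) y)" for m y
  proof (induction m)
    case (Suc m)
    have "exp (- real (Suc m) * ln \<rho>) = 1 / \<rho> * exp (- real m * ln \<rho>)"
      using \<rho> by (simp add: algebra_simps exp_add exp_diff exp_minus field_simps)
    then show ?case using Suc by (simp add: G_def matrix_vector_mult_scaleR)
  qed simp
  have Glin: "(G ^^ m) (y + c *\<^sub>R v) = (G ^^ m) y + c *\<^sub>R v" for m y c
    by (induction m) (simp_all add: G_def matrix_vector_right_distrib matrix_vector_mult_scaleR
        ev scaleR_add_right \<rho> less_imp_neq[OF \<rho>, symmetric])
  have it: "u \<bullet> (G ^^ m) y = 0 \<and> wn ((G ^^ m) y) \<le> \<theta> ^ m * wn y" if "u \<bullet> y = 0" for m y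
  proof (induction m)
    case (Suc m)
    then have "wn (G ((G ^^ m) y)) \<le> \<theta> * wn ((G ^^ m) y)" using \<theta> by blast
    also have "\<dots> \<le> \<theta> * (\<theta> ^ m * wn y)" using Suc \<theta> by (intro mult_left_mono) auto
    finally show ?case using Suc inv by (simp add: algebra_simps)
  qed (use that in simp)
  have uv: "0 < u \<bullet> v" unfolding inner_vec_def using u v by (intro sum_pos) auto
  define c' where "c' = (u \<bullet> x') / (u \<bullet> v)"
  have "(\<lambda>j. exp (- real (n j) * ln (spec_radius g)) *\<^sub>R (((*v) g ^^ n j) (x j))) \<longlonglongrightarrow> c' *\<^sub>R v"
    if x: "x \<longlonglongrightarrow> x'" and n: "filterlim n at_top sequentially" for x and n :: "nat \<Rightarrow> nat"
  proof -
  define c where "c j = (u \<bullet> x j) / (u \<bullet> v)" for j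
  have cl: "c \<longlonglongrightarrow> c'" unfolding c_def c'_def using uv by (intro tendsto_intros x) auto
  define r where "r j = (G ^^ n j) (x j - c j *\<^sub>R v)" for j
  have dec: "(G ^^ n j) (x j) = r j + c j *\<^sub>R v" for j
    using Glin[of "n j" "x j - c j *\<^sub>R v" "c j"] by (simp add: r_def)
  have wr: "wn (r j) \<le> \<theta> ^ n j * wn (x j - c j *\<^sub>R v)" for j
    using it[of "x j - c j *\<^sub>R v" "n j"] uv by (simp add: r_def c_def inner_diff_right)
  have "(\<lambda>j. wn (x j - c j *\<^sub>R v)) \<longlonglongrightarrow> wn (x' - c' *\<^sub>R v)"
    unfolding wn_def by (intro tendsto_intros x cl)
  moreover have "(\<lambda>j. \<theta> ^ n j) \<longlonglongrightarrow> 0"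
    using filterlim_compose[OF LIMSEQ_realpow_zero[OF \<theta>(1,2)] n] .
  ultimately have "(\<lambda>j. \<theta> ^ n j * wn (x j - c j *\<^sub>R v)) \<longlonglongrightarrow> 0 * wn (x' - c' *\<^sub>R v)"
    by (intro tendsto_mult)
  then have lim0: "(\<lambda>j. \<theta> ^ n j * wn (x j - c j *\<^sub>R v)) \<longlonglongrightarrow> 0" by simp
  have wnn: "0 \<le> wn y" for y unfolding wn_def using u by (auto intro!: sum_nonneg simp: less_imp_le)
  have "(\<lambda>j. wn (r j)) \<longlonglongrightarrow> 0"
    by (rule tendsto_sandwich[OF _ _ tendsto_const lim0]) (auto simp: wnn wr)
  have "r \<longlonglongrightarrow> 0"
  proof (rule vec_tendstoI)
    fix i
    have "u $ i * \<bar>r j $ i\<bar> \<le> wn (r j)" for j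
      unfolding wn_def using u by (intro member_le_sum[where f = "\<lambda>i. u $ i * \<bar>r j $ i\<bar>"]) (auto simp: less_imp_le)
    then have b: "norm (r j $ i) \<le> wn (r j) / u $ i" for j using u[of i] by (simp add: field_simps)
    have ev: "\<forall>\<^sub>F j in sequentially. norm (r j $ i) \<le> wn (r j) / u $ i"
      by (rule always_eventually) (rule allI, rule b)
    have "(\<lambda>j. wn (r j) / u $ i) \<longlonglongrightarrow> 0"
      using tendsto_divide[OF \<open>(\<lambda>j. wn (r j)) \<longlonglongrightarrow> 0\<close> tendsto_const[of "u $ i"]] u[of i] by simp
    from Lim_null_comparison[OF ev this] have "(\<lambda>j. r j $ i) \<longlonglongrightarrow> 0" .
    then show "(\<lambda>j. r j $ i) \<longlonglongrightarrow> 0 $ i" by simp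
  qed
  then have "(\<lambda>j. r j + c j *\<^sub>R v) \<longlonglongrightarrow> 0 + c' *\<^sub>R v" by (intro tendsto_intros cl)
    then show ?thesis unfolding sr Giter[symmetric] dec by simp
  qed
  moreover have "c' *\<^sub>R v \<in> punctured_orthant"
  proof -
    have nn: "0 \<le> x' $ i" for i using x' by (simp add: nonneg_orthant_def)
    obtain k where "x' $ k \<noteq> 0" using x' by (auto simp: vec_eq_iff)
    then have "0 < x' $ k" using nn[of k] by simp
    then have "0 < u \<bullet> x'" unfolding inner_vec_def using u nn
      by (intro sum_pos2[where i = k]) (auto simp: less_imp_le)
    then have "0 < c'" using uv by (simp add: c'_def)
    moreover have "v \<noteq> 0" using v by (metis less_irrefl zero_index)
    ultimately show ?thesis using v by (auto simp: nonneg_orthant_def less_imp_le)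
  qed
  ultimately show ?thesis by blast
qed

text \<open>All factors get the same exponent, since only the sum of the logarithmic spectral radii matters.\<close>

primrec pow_word :: "(real^'n^'n) list \<Rightarrow> nat \<Rightarrow> real^'n \<Rightarrow> real^'n" where
  "pow_word [] n x = x"
| "pow_word (g # gs) n x = ((*v) g ^^ n) (pow_word gs n x)"

lemma funpow_mult_vec_scaleR: "((*v) (g :: real^'n^'n) ^^ n) (c *\<^sub>R x) = c *\<^sub>R ((*v) g ^^ n) x"
  by (induction n) (simp_all add: matrix_vector_mult_scaleR)

lemma pow_word_scaleR: "pow_word gs n (c *\<^sub>R x) = c *\<^sub>R pow_word gs n x"
  by (induction gs) (auto simp: funpow_mult_vec_scaleR)

lemma pow_word_convergence:
  fixes x' :: "real^'n"
  assumes gs: "set gs \<subseteq> pos_matrices" and x': "x' \<in> punctured_orthant"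
  shows "\<exists>y\<in>punctured_orthant. \<forall>x n. x \<longlonglongrightarrow> x' \<longrightarrow> filterlim n at_top sequentially \<longrightarrow>
    (\<lambda>j. exp (- real (n j) * (\<Sum>g\<leftarrow>gs. ln (spec_radius g))) *\<^sub>R pow_word gs (n j) (x j)) \<longlonglongrightarrow> y"
  using gs
proof (induction gs)
  case (Cons g gs)
  have g: "g \<in> pos_matrices" using Cons.prems by auto
  obtain y where y: "y \<in> punctured_orthant"
    "\<And>x n. x \<longlonglongrightarrow> x' \<Longrightarrow> filterlim n at_top sequentially \<Longrightarrow>
      (\<lambda>j. exp (- real (n j) * (\<Sum>g\<leftarrow>gs. ln (spec_radius g))) *\<^sub>R pow_word gs (n j) (x j)) \<longlonglongrightarrow> y"
    using Cons by auto
  obtain z where z: "z \<in> punctured_orthant"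
    "\<And>x n. x \<longlonglongrightarrow> y \<Longrightarrow> filterlim n at_top sequentially \<Longrightarrow>
      (\<lambda>j. exp (- real (n j) * ln (spec_radius g)) *\<^sub>R (((*v) g ^^ n j) (x j))) \<longlonglongrightarrow> z"
    using perron_convergence[OF g y(1)] by auto
  have eq: "exp (- real k * ln (spec_radius g)) *\<^sub>R ((*v) g ^^ k)
      (exp (- real k * (\<Sum>g\<leftarrow>gs. ln (spec_radius g))) *\<^sub>R pow_word gs k w)
     = exp (- real k * (\<Sum>g\<leftarrow>g # gs. ln (spec_radius g))) *\<^sub>R pow_word (g # gs) k w" for k w
    by (simp add: funpow_mult_vec_scaleR exp_add[symmetric] algebra_simps)
  show ?case
  proof (intro bexI[OF _ z(1)] allI impI)
    fix x and n :: "nat \<Rightarrow> nat" assume xn: "x \<longlonglongrightarrow> x'" "filterlim n at_top sequentially"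
    show "(\<lambda>j. exp (- real (n j) * (\<Sum>g\<leftarrow>g # gs. ln (spec_radius g))) *\<^sub>R pow_word (g # gs) (n j) (x j)) \<longlonglongrightarrow> z"
      using z(2)[OF y(2)[OF xn] xn(2)] unfolding eq .
  qed
qed (use x' in auto)

lemma funpow_mult_vec_in_semigroup:
  fixes T :: "(real^'n^'n) set"
  assumes T: "\<And>g h. g \<in> T \<Longrightarrow> h \<in> T \<Longrightarrow> g ** h \<in> T" and g: "g \<in> T"
  shows "\<exists>W\<in>T. \<forall>x :: real^'n. ((*v) g ^^ Suc n) x = W *v x"
proof (induction n)
  case (Suc n)
  then obtain W where "W \<in> T" "\<forall>x. ((*v) g ^^ Suc n) x = W *v x" by blast
  then show ?case using T[OF g, of W] by (intro bexI[of _ "g ** W"]) (auto simp: matrix_vector_mul_assoc)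
qed (use g in auto)

lemma pow_word_in_semigroup:
  fixes T :: "(real^'n^'n) set"
  assumes T: "\<And>g h. g \<in> T \<Longrightarrow> h \<in> T \<Longrightarrow> g ** h \<in> T"
    and gs: "set gs \<subseteq> T" "gs \<noteq> []" and n: "1 \<le> n"
  shows "\<exists>W\<in>T. \<forall>x :: real^'n. pow_word gs n x = W *v x"
  using gs
proof (induction gs)
  case (Cons g gs)
  obtain m where m: "n = Suc m" using n by (cases n) auto
  have "g \<in> T" using Cons by auto
  then obtain V where V: "V \<in> T" "\<forall>x. ((*v) g ^^ n) x = V *v x"
    using funpow_mult_vec_in_semigroup[OF T, of g m] m by metis
  show ?case
  proof (cases "gs = []")
    case False
    then obtain W where W: "W \<in> T" "\<forall>x. pow_word gs n x = W *v x" using Cons by auto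
    show ?thesis using V W T[of V W]
      by (intro bexI[of _ "V ** W"]) (auto simp: matrix_vector_mul_assoc)
  qed (use V in auto)
qed simp

text \<open>A high power of a contracting \<open>q\<close> is followed by high powers of matrices whose logarithmic spectral
radii have a small positive sum \<open>s\<close>. By Perron--Frobenius the norm of the resulting vector is a fixed
constant times the product of the spectral radii, up to a factor tending to \<open>1\<close>; choosing the second
exponent steers its logarithm with precision \<open>s\<close>.\<close>

lemma orbit_norms_dense:
  fixes T :: "(real^'n^'n) set"
  assumes T: "\<And>g h. g \<in> T \<Longrightarrow> h \<in> T \<Longrightarrow> g ** h \<in> T" and T_al: "T \<subseteq> allowable"
    and dense: "closure (group_closure ((\<lambda>g. ln (spec_radius g)) ` (T \<inter> pos_matrices))) = UNIV"
    and p: "p \<in> T \<inter> pos_matrices" "1 < spec_radius p"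
    and q: "q \<in> T \<inter> pos_matrices" "0 < spec_radius q" "spec_radius q < 1"
    and x: "x \<in> punctured_orthant" and ab: "0 < a" "a < b"
  obtains W where "W \<in> T" "a < l1norm (W *v x)" "l1norm (W *v x) < b"
proof -
  let ?L = "(\<lambda>g. ln (spec_radius g)) ` (T \<inter> pos_matrices)"
  define \<eta> where "\<eta> = (ln b - ln a) / 4"
  have \<eta>: "0 < \<eta>" using ab by (simp add: \<eta>_def)
  obtain xs where xs: "set xs \<subseteq> ?L" "0 < sum_list xs" "sum_list xs < \<eta>"
  proof (rule small_positive_combination[OF dense _ _ _ _ \<eta>])
    show "ln (spec_radius p) \<in> ?L" "ln (spec_radius q) \<in> ?L" using p q by auto
    show "0 < ln (spec_radius p)" "ln (spec_radius q) < 0" using p q by auto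
  qed
  have "xs \<in> lists ?L" using xs by auto
  then obtain gs where gs: "gs \<in> lists (T \<inter> pos_matrices)" "xs = map (\<lambda>g. ln (spec_radius g)) gs"
    unfolding lists_image by auto
  define s where "s = sum_list xs"
  have s: "0 < s" "s < \<eta>" "s = (\<Sum>g\<leftarrow>gs. ln (spec_radius g))" using xs gs by (auto simp: s_def)
  define \<beta> where "\<beta> = - ln (spec_radius q)"
  have \<beta>: "0 < \<beta>" using q by (simp add: \<beta>_def)
  have "set [q] \<subseteq> pos_matrices" using q by auto
  from pow_word_convergence[OF this x]
  obtain y where y: "y \<in> punctured_orthant"
    "\<And>x' n. x' \<longlonglongrightarrow> x \<Longrightarrow> filterlim n at_top sequentially \<Longrightarrow>
      (\<lambda>j. exp (- real (n j) * (\<Sum>g\<leftarrow>[q]. ln (spec_radius g))) *\<^sub>R pow_word [q] (n j) (x' j)) \<longlonglongrightarrow> y"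
    by auto
  have ylim: "(\<lambda>j. exp (real j * \<beta>) *\<^sub>R pow_word [q] j x) \<longlonglongrightarrow> y"
    using y(2)[OF tendsto_const filterlim_ident] by (simp add: \<beta>_def)
  have "set gs \<subseteq> pos_matrices" using gs by auto
  from pow_word_convergence[OF this y(1)]
  obtain z where z: "z \<in> punctured_orthant"
    "\<And>x n. x \<longlonglongrightarrow> y \<Longrightarrow> filterlim n at_top sequentially \<Longrightarrow>
      (\<lambda>j. exp (- real (n j) * s) *\<^sub>R pow_word gs (n j) (x j)) \<longlonglongrightarrow> z"
    using s(3) by auto
  \<comment> \<open>\<open>\<tau>\<close> is the logarithmic growth to aim at: the limit vector \<open>z\<close> contributes \<open>ln \<bar>z\<bar>\<close>, and one
    unit of precision \<open>\<eta>\<close> is kept as a margin above \<open>ln a\<close>.\<close>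
  define \<tau> where "\<tau> = ln a + \<eta> - ln (l1norm z)"
  define k where "k j = nat \<lceil>(\<tau> + real j * \<beta>) / s\<rceil>" for j :: nat
  have lim: "filterlim (\<lambda>j. (\<tau> + real j * \<beta>) / s) at_top sequentially"
  proof -
    have "filterlim (\<lambda>j. \<tau> / s + real j * (\<beta> / s)) at_top sequentially"
      using \<beta> s by (intro filterlim_tendsto_add_at_top[OF tendsto_const]
        filterlim_at_top_mult_tendsto_pos[OF tendsto_const] filterlim_real_sequentially) auto
    then show ?thesis by (simp add: add_divide_distrib)
  qed
  have k: "filterlim k at_top sequentially"
  proof (rule filterlim_at_top[THEN iffD2], rule allI)
    fix Z :: nat
    have "\<forall>\<^sub>F j in sequentially. real Z \<le> (\<tau> + real j * \<beta>) / s"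
      using lim by (simp add: filterlim_at_top)
    then show "\<forall>\<^sub>F j in sequentially. Z \<le> k j"
      unfolding k_def by eventually_elim linarith
  qed
  define w where "w j = pow_word gs (k j) (pow_word [q] j x)" for j
  define r where "r j = real (k j) * s - real j * \<beta>" for j
  have "(\<lambda>j. exp (- r j) *\<^sub>R w j) \<longlonglongrightarrow> z"
    using z(2)[OF ylim k] by (simp add: pow_word_scaleR w_def r_def exp_add[symmetric] algebra_simps)
  then have "(\<lambda>j. ln (l1norm (exp (- r j) *\<^sub>R w j))) \<longlonglongrightarrow> ln (l1norm z)"
    using z(1) by (intro tendsto_intros) auto
  then have ev1: "\<forall>\<^sub>F j in sequentially. \<bar>ln (l1norm (exp (- r j) *\<^sub>R w j)) - ln (l1norm z)\<bar> < \<eta>"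
    using \<eta> by (auto simp: tendsto_iff dist_real_def)
  have "\<forall>\<^sub>F j in sequentially. 0 \<le> (\<tau> + real j * \<beta>) / s"
    using lim by (simp add: filterlim_at_top)
  then have ev2: "\<forall>\<^sub>F j in sequentially. \<tau> \<le> r j \<and> r j \<le> \<tau> + s"
  proof eventually_elim
    case (elim j)
    define c where "c = (\<tau> + real j * \<beta>) / s"
    have "real (k j) = of_int \<lceil>c\<rceil>" using elim by (simp add: k_def c_def)
    then have "c \<le> real (k j)" "real (k j) \<le> c + 1" by linarith+
    then have "c * s \<le> real (k j) * s" "real (k j) * s \<le> (c + 1) * s"
      using s(1) by (auto intro!: mult_right_mono)
    moreover have "c * s = \<tau> + real j * \<beta>" using s(1) by (simp add: c_def)
    ultimately show ?case by (simp add: r_def distrib_right)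
  qed
  have "\<forall>\<^sub>F j in sequentially. 1 \<le> k j \<and> 1 \<le> j"
    using k by (intro eventually_conj eventually_ge_at_top) (simp add: filterlim_at_top)
  with ev1 ev2 have "\<forall>\<^sub>F j in sequentially. 1 \<le> k j \<and> 1 \<le> j \<and> \<tau> \<le> r j \<and> r j \<le> \<tau> + s \<and>
     \<bar>ln (l1norm (exp (- r j) *\<^sub>R w j)) - ln (l1norm z)\<bar> < \<eta>" by eventually_elim auto
  then obtain j where j: "1 \<le> k j" "1 \<le> j" "\<tau> \<le> r j" "r j \<le> \<tau> + s"
     "\<bar>ln (l1norm (exp (- r j) *\<^sub>R w j)) - ln (l1norm z)\<bar> < \<eta>"
    using eventually_happens' by (metis (no_types, lifting) trivial_limit_sequentially)
  have "gs \<noteq> []" using s by auto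
  then obtain V where V: "V \<in> T" "\<And>x. pow_word gs (k j) x = V *v x"
    using pow_word_in_semigroup[OF T, of gs "k j"] gs j by auto
  obtain U where U: "U \<in> T" "\<And>x. pow_word [q] j x = U *v x"
    using pow_word_in_semigroup[OF T, of "[q]" j] q j by auto
  have wj: "w j = (V ** U) *v x" by (simp add: w_def V U matrix_vector_mul_assoc del: pow_word.simps)
  have "w j \<in> punctured_orthant"
    unfolding wj using x T[OF V(1) U(1)] T_al by (intro allowable_mult_punctured) auto
  then have w0: "0 < l1norm (w j)" by simp
  then have lw: "ln (l1norm (exp (- r j) *\<^sub>R w j)) = - r j + ln (l1norm (w j))"
    by (simp add: ln_mult)
  have up: "- r j + ln (l1norm (w j)) - ln (l1norm z) < \<eta>"
    and lo: "- \<eta> < - r j + ln (l1norm (w j)) - ln (l1norm z)"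
    using j(5) unfolding lw abs_less_iff by linarith+
  have "ln b = ln a + 4 * \<eta>" by (simp add: \<eta>_def field_simps)
  then have "ln a < ln (l1norm (w j)) \<and> ln (l1norm (w j)) < ln b"
    using j(3,4) up lo s(1,2) \<eta> unfolding \<tau>_def by auto
  then show ?thesis using w0 ab T[OF V(1) U(1)] wj by (intro that[of "V ** U"]) auto
qed

section \<open>Log-like functions and the harmonic logarithm\<close>

text \<open>The features of \<open>ln \<bar>x\<bar>\<close> that survive averaging over \<open>A\<close>: homogeneity, monotonicity, and bounded
distance to \<open>ln \<bar>x\<bar>\<close>. The value \<open>0\<close> off the punctured orthant makes measurability and pointwise limits
statements about the whole space.\<close>

definition loglike :: "real \<Rightarrow> (real^'n \<Rightarrow> real) \<Rightarrow> bool" where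
  "loglike C f \<longleftrightarrow> f \<in> borel_measurable borel \<and> (\<forall>x. x \<notin> punctured_orthant \<longrightarrow> f x = 0) \<and>
     (\<forall>x\<in>punctured_orthant. \<forall>c>0. f (c *\<^sub>R x) = f x + ln c) \<and>
     (\<forall>x\<in>punctured_orthant. \<forall>y. (\<forall>i. x $ i \<le> y $ i) \<longrightarrow> f x \<le> f y) \<and>
     (\<forall>x\<in>punctured_orthant. \<bar>f x - ln (l1norm x)\<bar> \<le> C)"

definition log_l1 :: "real^'n \<Rightarrow> real" where
  "log_l1 x = (if x \<in> punctured_orthant then ln (l1norm x) else 0)"

lemma loglike_measurable [measurable_dest]: "loglike C f \<Longrightarrow> f \<in> borel_measurable borel"
  and loglike_outside: "loglike C f \<Longrightarrow> x \<notin> punctured_orthant \<Longrightarrow> f x = 0"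
  and loglike_scale: "loglike C f \<Longrightarrow> x \<in> punctured_orthant \<Longrightarrow> 0 < c \<Longrightarrow> f (c *\<^sub>R x) = f x + ln c"
  and loglike_mono: "loglike C f \<Longrightarrow> x \<in> punctured_orthant \<Longrightarrow> (\<And>i. x $ i \<le> y $ i) \<Longrightarrow> f x \<le> f y"
  and loglike_bound: "loglike C f \<Longrightarrow> x \<in> punctured_orthant \<Longrightarrow> \<bar>f x - ln (l1norm x)\<bar> \<le> C"
  unfolding loglike_def by simp_all

lemma punctured_orthant_scaleR:
  "x \<in> punctured_orthant \<Longrightarrow> 0 < c \<Longrightarrow> c *\<^sub>R x \<in> punctured_orthant"
  by (auto simp: nonneg_orthant_def)

lemma punctured_orthant_upward:
  "x \<in> punctured_orthant \<Longrightarrow> (\<And>i. x $ i \<le> y $ i) \<Longrightarrow> y \<in> punctured_orthant"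
proof -
  assume x: "x \<in> punctured_orthant" and le: "\<And>i. x $ i \<le> y $ i"
  have o: "y \<in> nonneg_orthant" using x le unfolding nonneg_orthant_def
    by simp (meson order_trans)
  have "0 < l1norm x" using x by simp
  also have "\<dots> \<le> l1norm y" using x le by (intro l1norm_mono) auto
  finally show ?thesis using o by simp
qed

text \<open>Both bounds come from \<open>\<bar>x\<bar> / N(g) \<le> \<bar>g x\<bar> \<le> N(g) \<bar>x\<bar>\<close>.\<close>

lemma log_mult_bound:
  assumes g: "g \<in> allowable" and x: "x \<in> punctured_orthant"
  shows "\<bar>ln (l1norm (g *v x)) - ln (l1norm x)\<bar> \<le> ln (Nmax g)"
proof -
  have p: "0 < l1norm x" "0 < l1norm (g *v x)" "0 < Nmax g"
    using x allowable_mult_punctured[OF g x] Nmax_ge_1[OF g] by auto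
  have "ln (l1norm (g *v x)) \<le> ln (Nmax g * l1norm x)"
    using l1norm_mult_le_Nmax[OF g, of x] x p by (subst ln_le_cancel_iff) auto
  moreover have "ln (l1norm x) \<le> ln (Nmax g * l1norm (g *v x))"
    using l1norm_le_Nmax_mult[OF g, of x] x p by (subst ln_le_cancel_iff) auto
  ultimately show ?thesis using p by (simp add: ln_mult abs_le_iff)
qed

lemma loglike_log_l1: "loglike 0 log_l1"
  unfolding loglike_def
proof (intro conjI ballI allI impI)
  show "log_l1 \<in> borel_measurable borel" unfolding log_l1_def by measurable
  fix x :: "real^'n" assume x: "x \<in> punctured_orthant"
  then have xp: "0 < l1norm x" by simp
  { fix c :: real assume c: "0 < c"
    then show "log_l1 (c *\<^sub>R x) = log_l1 x + ln c"
      using punctured_orthant_scaleR[OF x c] x xp by (simp add: log_l1_def ln_mult) }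
  { fix y assume y: "\<forall>i. x $ i \<le> y $ i"
    have "l1norm x \<le> l1norm y" using x y by (intro l1norm_mono) auto
    then show "log_l1 x \<le> log_l1 y"
      using punctured_orthant_upward[OF x] x xp y by (simp add: log_l1_def) }
qed (auto simp: log_l1_def)

lemma loglike_limit:
  fixes f :: "nat \<Rightarrow> real^'n \<Rightarrow> real"
  assumes f: "\<And>n. loglike C (f n)" and lim: "\<And>x. (\<lambda>n. f n x) \<longlonglongrightarrow> g x"
  shows "loglike C g"
  unfolding loglike_def
proof (intro conjI ballI allI impI)
  show "g \<in> borel_measurable borel"
    by (rule borel_measurable_LIMSEQ_real[OF lim]) (use f in \<open>auto simp: loglike_def\<close>)
  show "g x = 0" if "x \<notin> punctured_orthant" for x
    using lim[of x] loglike_outside[OF f that] LIMSEQ_unique[OF _ tendsto_const] by auto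
  fix x :: "real^'n" assume x: "x \<in> punctured_orthant"
  { fix c :: real assume c: "0 < c"
    have "(\<lambda>n. f n (c *\<^sub>R x)) \<longlonglongrightarrow> g x + ln c"
      unfolding loglike_scale[OF f x c] by (intro tendsto_intros lim)
    then show "g (c *\<^sub>R x) = g x + ln c" using lim LIMSEQ_unique by blast }
  { fix y assume "\<forall>i. x $ i \<le> y $ i"
    then show "g x \<le> g y" using loglike_mono[OF f x] by (intro LIMSEQ_le[OF lim lim]) auto }
  have "(\<lambda>n. \<bar>f n x - ln (l1norm x)\<bar>) \<longlonglongrightarrow> \<bar>g x - ln (l1norm x)\<bar>"
    by (intro tendsto_intros lim)
  then show "\<bar>g x - ln (l1norm x)\<bar> \<le> C"
    using loglike_bound[OF f x] by (intro LIMSEQ_le_const2) auto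
qed

lemma loglike_bdd:
  fixes f :: "nat \<Rightarrow> real^'n \<Rightarrow> real"
  assumes f: "\<And>n. loglike C (f n)"
  shows "bdd_above (range (\<lambda>n. f n x))" "bdd_below (range (\<lambda>n. f n x))"
proof -
  have "\<bar>f n x\<bar> \<le> \<bar>C\<bar> + \<bar>ln (l1norm x)\<bar>" for n
    using loglike_bound[OF f[of n], of x] loglike_outside[OF f[of n], of x]
    by (cases "x \<in> punctured_orthant") auto
  then have b: "f n x \<le> \<bar>C\<bar> + \<bar>ln (l1norm x)\<bar>" "- (\<bar>C\<bar> + \<bar>ln (l1norm x)\<bar>) \<le> f n x" for n
    by (metis abs_le_D1) (metis \<open>\<And>n. \<bar>f n x\<bar> \<le> \<bar>C\<bar> + \<bar>ln (l1norm x)\<bar>\<close> abs_le_D2 minus_le_iff)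
  show "bdd_above (range (\<lambda>n. f n x))" by (rule bdd_aboveI2[OF b(1)])
  show "bdd_below (range (\<lambda>n. f n x))" by (rule bdd_belowI2[OF b(2)])
qed

lemma loglike_SUP:
  fixes f :: "nat \<Rightarrow> real^'n \<Rightarrow> real"
  assumes f: "\<And>n. loglike C (f n)"
  shows "loglike C (\<lambda>x. SUP n. f n x)"
  unfolding loglike_def
proof (intro conjI ballI allI impI)
  note bdd = loglike_bdd(1)[where f = f, OF f]
  show "(\<lambda>x. SUP n. f n x) \<in> borel_measurable borel"
    by (rule borel_measurable_cSUP) (use f bdd in \<open>auto simp: loglike_def\<close>)
  show "(SUP n. f n x) = 0" if "x \<notin> punctured_orthant" for x
    using loglike_outside[OF f that] by simp
  fix x :: "real^'n" assume x: "x \<in> punctured_orthant"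
  { fix c :: real assume c: "0 < c"
    show "(SUP n. f n (c *\<^sub>R x)) = (SUP n. f n x) + ln c"
    proof (rule antisym)
      show "(SUP n. f n (c *\<^sub>R x)) \<le> (SUP n. f n x) + ln c"
        using cSUP_upper[OF _ bdd[of x]] by (intro cSUP_least) (auto simp: loglike_scale[OF f x c])
      have "f n x \<le> (SUP n. f n (c *\<^sub>R x)) - ln c" for n
        using cSUP_upper[OF _ bdd[of "c *\<^sub>R x"], of n] by (simp add: loglike_scale[OF f x c])
      then have "(SUP n. f n x) \<le> (SUP n. f n (c *\<^sub>R x)) - ln c" by (intro cSUP_least) auto
      then show "(SUP n. f n x) + ln c \<le> (SUP n. f n (c *\<^sub>R x))" by simp
    qed }
  { fix y assume "\<forall>i. x $ i \<le> y $ i"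
    then show "(SUP n. f n x) \<le> (SUP n. f n y)"
      using loglike_mono[OF f x] by (intro cSUP_mono bdd) auto }
  have b: "f n x \<le> ln (l1norm x) + C" "ln (l1norm x) - C \<le> f n x" for n
    using loglike_bound[OF f x, of n] by auto
  have "(SUP n. f n x) \<le> ln (l1norm x) + C" by (rule cSUP_least) (use b in auto)
  moreover have "ln (l1norm x) - C \<le> (SUP n. f n x)"
    by (rule order_trans[OF b(2)[of 0] cSUP_upper[OF _ bdd]]) simp
  ultimately show "\<bar>(SUP n. f n x) - ln (l1norm x)\<bar> \<le> C" by (simp add: abs_le_iff)
qed

text \<open>The exponent \<open>\<gamma>\<close> is half of an exponent with finite moments, so that the product
\<open>N(A)\<^sup>\<gamma> \<bar>B\<bar>\<^sup>\<gamma>\<close> of dependent variables is integrable.\<close>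

locale affine_pair = prob_space M for M :: "'w measure" +
  fixes A :: "'w \<Rightarrow> real^'n^'n" and B :: "'w \<Rightarrow> real^'n" and \<kappa> \<gamma> :: real
  assumes A_meas [measurable]: "A \<in> borel_measurable M"
    and B_meas [measurable]: "B \<in> borel_measurable M"
    and A_allowable: "\<And>\<omega>. \<omega> \<in> space M \<Longrightarrow> A \<omega> \<in> allowable"
    and B_orthant: "\<And>\<omega>. \<omega> \<in> space M \<Longrightarrow> B \<omega> \<in> nonneg_orthant"
    and \<kappa>_gt_1: "1 < \<kappa>"
    and balanced: "AE \<omega> in M. \<forall>i j k. A \<omega> $ i $ j \<le> \<kappa> * A \<omega> $ i $ k"
    and \<gamma>_pos: "0 < \<gamma>" and \<gamma>_le_1: "\<gamma> \<le> 1"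
    and N_integrable2: "integrable M (\<lambda>\<omega>. Nmax (A \<omega>) powr (2 * \<gamma>))"
    and B_integrable2: "integrable M (\<lambda>\<omega>. l1norm (B \<omega>) powr (2 * \<gamma>))"
begin

lemma N_meas [measurable]: "(\<lambda>\<omega>. Nmax (A \<omega>)) \<in> borel_measurable M"
  by (rule Nmax_measurable[OF A_meas A_allowable])

lemma N_ge_1: "\<omega> \<in> space M \<Longrightarrow> 1 \<le> Nmax (A \<omega>)"
  by (rule Nmax_ge_1[OF A_allowable])

lemma A_punctured: "\<omega> \<in> space M \<Longrightarrow> x \<in> punctured_orthant \<Longrightarrow> A \<omega> *v x \<in> punctured_orthant"
  by (rule allowable_mult_punctured[OF A_allowable])

lemma ln_le_powr: "1 \<le> x \<Longrightarrow> ln x \<le> x powr \<gamma> / \<gamma>" for x :: real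
proof -
  assume "1 \<le> x"
  then have "\<gamma> * ln x \<le> x powr \<gamma>" using ln_le_minus_one[of "x powr \<gamma>"] by (simp add: ln_powr)
  then show ?thesis using \<gamma>_pos by (simp add: field_simps)
qed

lemma N_integrable: "integrable M (\<lambda>\<omega>. Nmax (A \<omega>) powr \<gamma>)"
proof (rule Bochner_Integration.integrable_bound[OF N_integrable2])
  show "AE \<omega> in M. norm (Nmax (A \<omega>) powr \<gamma>) \<le> norm (Nmax (A \<omega>) powr (2 * \<gamma>))"
    using N_ge_1 \<gamma>_pos by (intro AE_I2) (auto intro!: powr_mono)
qed simp

lemma lnN_sq_integrable: "integrable M (\<lambda>\<omega>. (ln (Nmax (A \<omega>)))\<^sup>2)"
proof (rule Bochner_Integration.integrable_bound[OF integrable_mult_right[OF N_integrable2, of "1 / \<gamma>\<^sup>2"]])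
  show "AE \<omega> in M. norm ((ln (Nmax (A \<omega>)))\<^sup>2) \<le> norm (1 / \<gamma>\<^sup>2 * Nmax (A \<omega>) powr (2 * \<gamma>))"
  proof (rule AE_I2)
    fix \<omega> assume \<omega>: "\<omega> \<in> space M"
    have "(ln (Nmax (A \<omega>)))\<^sup>2 \<le> (Nmax (A \<omega>) powr \<gamma> / \<gamma>)\<^sup>2"
      using N_ge_1[OF \<omega>] ln_le_powr[of "Nmax (A \<omega>)"] by (intro power_mono) auto
    also have "\<dots> = 1 / \<gamma>\<^sup>2 * Nmax (A \<omega>) powr (2 * \<gamma>)"
      by (simp add: power_divide power2_eq_square powr_add[symmetric])
    finally show "norm ((ln (Nmax (A \<omega>)))\<^sup>2) \<le> norm (1 / \<gamma>\<^sup>2 * Nmax (A \<omega>) powr (2 * \<gamma>))" by simp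
  qed
qed simp

lemma lnN_integrable: "integrable M (\<lambda>\<omega>. ln (Nmax (A \<omega>)))"
proof (rule Bochner_Integration.integrable_bound[OF integrable_divide[OF N_integrable, of \<gamma>]])
  show "AE \<omega> in M. norm (ln (Nmax (A \<omega>))) \<le> norm (Nmax (A \<omega>) powr \<gamma> / \<gamma>)"
    using N_ge_1 ln_le_powr \<gamma>_pos by (intro AE_I2) auto
qed simp

definition avg :: "(real^'n \<Rightarrow> real) \<Rightarrow> real^'n \<Rightarrow> real" where
  "avg f x = (if x \<in> punctured_orthant then \<integral>\<omega>. f (A \<omega> *v x) \<partial>M else 0)"

lemma loglike_A_bound:
  assumes f: "loglike C f" and x: "x \<in> punctured_orthant" and \<omega>: "\<omega> \<in> space M"
  shows "\<bar>f (A \<omega> *v x) - ln (l1norm x)\<bar> \<le> C + ln (Nmax (A \<omega>))"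
  using loglike_bound[OF f A_punctured[OF \<omega> x]] log_mult_bound[OF A_allowable[OF \<omega>] x] by linarith

lemma avg_integrable:
  assumes f: "loglike C f" and x: "x \<in> punctured_orthant"
  shows "integrable M (\<lambda>\<omega>. f (A \<omega> *v x))"
proof (rule Bochner_Integration.integrable_bound)
  show "integrable M (\<lambda>\<omega>. C + \<bar>ln (l1norm x)\<bar> + ln (Nmax (A \<omega>)))"
    using lnN_integrable by simp
  show "(\<lambda>\<omega>. f (A \<omega> *v x)) \<in> borel_measurable M"
    using loglike_measurable[OF f] by measurable
  show "AE \<omega> in M. norm (f (A \<omega> *v x)) \<le> norm (C + \<bar>ln (l1norm x)\<bar> + ln (Nmax (A \<omega>)))"
    using loglike_A_bound[OF f x] by (intro AE_I2) force
qed

lemma avg_le: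
  assumes f: "loglike C f" and g: "loglike D g" and x: "x \<in> punctured_orthant"
    and y: "y \<in> punctured_orthant"
    and le: "AE \<omega> in M. f (A \<omega> *v x) \<le> g (A \<omega> *v y) + c"
  shows "avg f x \<le> avg g y + c"
proof -
  have "(\<integral>\<omega>. f (A \<omega> *v x) \<partial>M) \<le> (\<integral>\<omega>. g (A \<omega> *v y) + c \<partial>M)"
    using avg_integrable[OF f x] avg_integrable[OF g y] le by (intro integral_mono_AE) auto
  also have "\<dots> = (\<integral>\<omega>. g (A \<omega> *v y) \<partial>M) + c"
    using avg_integrable[OF g y] by (simp add: prob_space)
  finally show ?thesis using x y by (simp add: avg_def)
qed

lemma avg_mono:
  assumes f: "loglike C f" and g: "loglike D g" and x: "x \<in> punctured_orthant"
    and le: "\<And>y. y \<in> punctured_orthant \<Longrightarrow> f y \<le> g y + c"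
  shows "avg f x \<le> avg g x + c"
  using A_punctured x le by (intro avg_le[OF f g x x] AE_I2) auto

lemma loglike_avg:
  assumes f: "loglike C f"
  shows "loglike (C + (\<integral>\<omega>. ln (Nmax (A \<omega>)) \<partial>M)) (avg f)"
  unfolding loglike_def
proof (intro conjI ballI allI impI)
  note [measurable] = loglike_measurable[OF f]
  have "(\<lambda>x. \<integral>\<omega>. f (A \<omega> *v x) \<partial>M) \<in> borel_measurable borel"
    by (rule borel_measurable_lebesgue_integral) measurable
  then show "avg f \<in> borel_measurable borel" unfolding avg_def[abs_def] by measurable
  show "avg f x = 0" if "x \<notin> punctured_orthant" for x
    unfolding avg_def using that by (rule if_not_P)
  fix x :: "real^'n" assume x: "x \<in> punctured_orthant"
  { fix c :: real assume c: "0 < c"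
    have cx: "c *\<^sub>R x \<in> punctured_orthant" by (rule punctured_orthant_scaleR[OF x c])
    have "(\<integral>\<omega>. f (A \<omega> *v (c *\<^sub>R x)) \<partial>M) = (\<integral>\<omega>. f (A \<omega> *v x) + ln c \<partial>M)"
      using loglike_scale[OF f A_punctured[OF _ x] c]
      by (intro Bochner_Integration.integral_cong) (auto simp: matrix_vector_mult_scaleR)
    also have "\<dots> = (\<integral>\<omega>. f (A \<omega> *v x) \<partial>M) + ln c"
      using avg_integrable[OF f x] by (simp add: prob_space)
    finally show "avg f (c *\<^sub>R x) = avg f x + ln c" using x cx unfolding avg_def by simp }
  { fix y assume y: "\<forall>i. x $ i \<le> y $ i"
    have yp: "y \<in> punctured_orthant" using punctured_orthant_upward[OF x] y by blast
    have "avg f x \<le> avg f y + 0"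
      using y loglike_mono[OF f A_punctured[OF _ x]] allowable_mult_mono[OF A_allowable]
      by (intro avg_le[OF f f x yp] AE_I2) simp
    then show "avg f x \<le> avg f y" by simp }
  have "\<bar>(\<integral>\<omega>. f (A \<omega> *v x) \<partial>M) - ln (l1norm x)\<bar> = \<bar>\<integral>\<omega>. f (A \<omega> *v x) - ln (l1norm x) \<partial>M\<bar>"
    using avg_integrable[OF f x] by (simp add: prob_space)
  also have "\<dots> \<le> (\<integral>\<omega>. \<bar>f (A \<omega> *v x) - ln (l1norm x)\<bar> \<partial>M)" by (rule integral_abs_bound)
  also have "\<dots> \<le> (\<integral>\<omega>. C + ln (Nmax (A \<omega>)) \<partial>M)"
    using avg_integrable[OF f x] lnN_integrable loglike_A_bound[OF f x]
    by (intro integral_mono) auto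
  also have "\<dots> = C + (\<integral>\<omega>. ln (Nmax (A \<omega>)) \<partial>M)" using lnN_integrable by (simp add: prob_space)
  finally show "\<bar>avg f x - ln (l1norm x)\<bar> \<le> C + (\<integral>\<omega>. ln (Nmax (A \<omega>)) \<partial>M)"
    using x by (simp add: avg_def)
qed

text \<open>Matrices with comparable entries in each row send any two vectors of equal norm to coordinatewise
comparable vectors.\<close>

lemma balanced_image:
  assumes bal: "\<forall>i j k. g $ i $ j \<le> \<kappa> * g $ i $ k"
    and x: "x \<in> nonneg_orthant" and y: "y \<in> nonneg_orthant"
  shows "l1norm y * (g *v x) $ i \<le> \<kappa> * l1norm x * (g *v y) $ i"
proof -
  have nn: "0 \<le> x $ j" "0 \<le> y $ j" for j using x y by (auto simp: nonneg_orthant_def)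
  have "l1norm y * (g *v x) $ i = (\<Sum>k\<in>UNIV. \<Sum>j\<in>UNIV. (y $ k * x $ j) * g $ i $ j)"
    unfolding l1norm_orthant[OF y] matrix_vector_mult_def
    by (simp add: sum_product algebra_simps)
  also have "\<dots> \<le> (\<Sum>k\<in>UNIV. \<Sum>j\<in>UNIV. (y $ k * x $ j) * (\<kappa> * g $ i $ k))"
    using bal nn by (intro sum_mono mult_left_mono) auto
  also have "\<dots> = \<kappa> * l1norm x * (g *v y) $ i"
    unfolding l1norm_orthant[OF x] matrix_vector_mult_def
    by (simp add: sum_product sum_distrib_left sum_distrib_right algebra_simps)
  finally show ?thesis .
qed

text \<open>By \<open>balanced_image\<close> one image is at most a multiple of the other; monotonicity and homogeneity of \<open>f\<close>
then bound the difference. The constant \<open>ln \<kappa>\<close> is independent of \<open>f\<close>, which is what makes iteration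
possible.\<close>

lemma avg_compare:
  assumes f: "loglike C f" and x: "x \<in> punctured_orthant" and y: "y \<in> punctured_orthant"
  shows "avg f x - ln (l1norm x) \<le> avg f y - ln (l1norm y) + ln \<kappa>"
proof -
  have p: "0 < l1norm x" "0 < l1norm y" using x y by auto
  let ?c = "\<kappa> * l1norm x / l1norm y"
  have c: "0 < ?c" using p \<kappa>_gt_1 by auto
  have "AE \<omega> in M. f (A \<omega> *v x) \<le> f (A \<omega> *v y) + ln ?c"
    using balanced AE_space
  proof eventually_elim
    case (elim \<omega>)
    have "(A \<omega> *v x) $ i \<le> (?c *\<^sub>R (A \<omega> *v y)) $ i" for i
      using balanced_image[OF elim(1), of x y i] x y p by (auto simp: field_simps)
    then have "f (A \<omega> *v x) \<le> f (?c *\<^sub>R (A \<omega> *v y))"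
      by (intro loglike_mono[OF f A_punctured[OF elim(2) x]])
    then show ?case using loglike_scale[OF f A_punctured[OF elim(2) y] c] by simp
  qed
  then have "avg f x \<le> avg f y + ln ?c" by (rule avg_le[OF f f x y])
  then show ?thesis using p \<kappa>_gt_1 by (simp add: ln_div ln_mult)
qed

text \<open>Adding \<open>b\<close> before applying \<open>A\<close> costs at most the factor \<open>1 + \<kappa> \<bar>b\<bar> / \<bar>x\<bar>\<close> coordinatewise. A harmonic
function is its own average and inherits this estimate.\<close>

lemma avg_perturb:
  assumes f: "loglike C f" and x: "x \<in> punctured_orthant" and b: "b \<in> nonneg_orthant"
  shows "avg f (x + b) \<le> avg f x + ln (1 + \<kappa> * l1norm b / l1norm x)"
proof -
  have p: "0 < l1norm x" using x by auto
  let ?c = "1 + \<kappa> * l1norm b / l1norm x"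
  have c: "0 < ?c" using p \<kappa>_gt_1 by (intro add_pos_nonneg) auto
  have xb: "x + b \<in> punctured_orthant" by (rule punctured_orthant_add[OF x b])
  have "AE \<omega> in M. f (A \<omega> *v (x + b)) \<le> f (A \<omega> *v x) + ln ?c"
    using balanced AE_space
  proof eventually_elim
    case (elim \<omega>)
    have "(A \<omega> *v (x + b)) $ i \<le> (?c *\<^sub>R (A \<omega> *v x)) $ i" for i
      using balanced_image[OF elim(1) b, of x i] x p
      by (auto simp: field_simps matrix_vector_right_distrib)
    then have "f (A \<omega> *v (x + b)) \<le> f (?c *\<^sub>R (A \<omega> *v x))"
      by (intro loglike_mono[OF f A_punctured[OF elim(2) xb]])
    then show ?case using loglike_scale[OF f A_punctured[OF elim(2) x] c] by simp
  qed
  then show ?thesis by (rule avg_le[OF f f xb x])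
qed

definition mean_log :: "nat \<Rightarrow> real^'n \<Rightarrow> real" where
  "mean_log n = (avg ^^ n) log_l1"

lemma loglike_avg_iterate: "loglike C f \<Longrightarrow> \<exists>D. loglike D ((avg ^^ n) f)"
  by (induction n) (auto intro: loglike_avg)

lemma avg_iterate_mono:
  assumes f: "loglike C f" and g: "loglike D g"
    and le: "\<And>y. y \<in> punctured_orthant \<Longrightarrow> f y \<le> g y + c" and x: "x \<in> punctured_orthant"
  shows "(avg ^^ n) f x \<le> (avg ^^ n) g x + c"
  using x
proof (induction n arbitrary: x)
  case (Suc n)
  obtain C' D' where "loglike C' ((avg ^^ n) f)" "loglike D' ((avg ^^ n) g)"
    using loglike_avg_iterate[OF f] loglike_avg_iterate[OF g] by meson
  then show ?case using avg_mono Suc by simp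
qed (use le in simp)

text \<open>The starting vector is arbitrary: by \<open>mean_log_near_growth\<close> any other one changes the mean by at most
\<open>ln \<kappa>\<close> after normalisation.\<close>

definition growth :: "nat \<Rightarrow> real" where
  "growth n = mean_log n unif_vec"

lemma mean_log_near_growth:
  assumes x: "x \<in> punctured_orthant"
  shows "\<bar>mean_log n x - ln (l1norm x) - growth n\<bar> \<le> ln \<kappa>"
proof (cases n)
  case 0
  then show ?thesis using x \<kappa>_gt_1 by (simp add: mean_log_def growth_def log_l1_def)
next
  case (Suc m)
  obtain C where C: "loglike C ((avg ^^ m) log_l1)"
    using loglike_avg_iterate[OF loglike_log_l1] by blast
  have u: "unif_vec \<in> punctured_orthant" by simp
  show ?thesis
    using avg_compare[OF C x u] avg_compare[OF C u x] Suc by (simp add: mean_log_def growth_def)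
qed

text \<open>Inserting the bound \<open>mean_log_near_growth\<close> for \<open>m\<close> steps into \<open>n\<close> further averages.\<close>

lemma growth_almost_additive: "\<bar>growth (n + m) - growth n - growth m\<bar> \<le> ln \<kappa>"
proof -
  obtain C where C: "loglike C (mean_log m)"
    using loglike_avg_iterate[OF loglike_log_l1] unfolding mean_log_def by blast
  have u: "unif_vec \<in> punctured_orthant" by simp
  have eq: "(avg ^^ n) (mean_log m) = mean_log (n + m)" by (simp add: mean_log_def funpow_add)
  have 1: "mean_log m y \<le> log_l1 y + (growth m + ln \<kappa>)" if "y \<in> punctured_orthant" for y
    using mean_log_near_growth[OF that, of m] that by (simp add: log_l1_def)
  have 2: "log_l1 y \<le> mean_log m y + (ln \<kappa> - growth m)" if "y \<in> punctured_orthant" for y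
    using mean_log_near_growth[OF that, of m] that by (simp add: log_l1_def)
  from avg_iterate_mono[OF C loglike_log_l1 1 u, of n] avg_iterate_mono[OF loglike_log_l1 C 2 u, of n]
  show ?thesis unfolding eq by (simp add: mean_log_def growth_def)
qed

text \<open>An almost additive sequence satisfies \<open>\<bar>a_(k n) - k a_n\<bar> \<le> k ln \<kappa>\<close>; dividing by \<open>k\<close> and using
\<open>a_n / n \<rightarrow> 0\<close> leaves \<open>\<bar>a_n\<bar> \<le> ln \<kappa>\<close>.\<close>

lemma growth_bounded:
  assumes lim: "(\<lambda>n. growth n / real n) \<longlonglongrightarrow> 0"
  shows "\<bar>growth n\<bar> \<le> ln \<kappa>"
proof (cases "n = 0")
  case True
  then show ?thesis using \<kappa>_gt_1 by (simp add: growth_def mean_log_def log_l1_def)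
next
  case False
  have k: "\<bar>growth (Suc k * n) - real (Suc k) * growth n\<bar> \<le> real (Suc k) * ln \<kappa>" for k
  proof (induction k)
    case (Suc k)
    then show ?case using growth_almost_additive[of n "Suc k * n"]
      by (simp add: algebra_simps abs_le_iff)
  qed (use \<kappa>_gt_1 in simp)
  have b: "\<bar>growth n\<bar> \<le> ln \<kappa> + real n * \<bar>growth (Suc k * n) / real (Suc k * n)\<bar>" for k
  proof -
    have "real (Suc k) * \<bar>growth n\<bar> \<le> real (Suc k) * ln \<kappa> + \<bar>growth (Suc k * n)\<bar>"
    proof -
      have "real (Suc k) * \<bar>growth n\<bar> = \<bar>real (Suc k) * growth n\<bar>" by (simp add: abs_mult)
      then show ?thesis using k[of k] by linarith
    qed
    then have "\<bar>growth n\<bar> \<le> ln \<kappa> + \<bar>growth (Suc k * n)\<bar> / real (Suc k)"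
      by (simp add: field_simps)
    moreover have "real n * \<bar>growth (Suc k * n) / real (Suc k * n)\<bar> = \<bar>growth (Suc k * n)\<bar> / real (Suc k)"
      using False by (simp add: abs_mult del: mult_Suc of_nat_Suc)
    ultimately show ?thesis by simp
  qed
  have "filterlim (\<lambda>k. Suc k * n) at_top sequentially"
  proof (rule filterlim_at_top_mono[OF filterlim_Suc])
    show "\<forall>\<^sub>F k in sequentially. Suc k \<le> Suc k * n"
      using False by (intro always_eventually allI) (cases n; simp)
  qed
  from filterlim_compose[OF lim this]
  have "(\<lambda>k. ln \<kappa> + real n * \<bar>growth (Suc k * n) / real (Suc k * n)\<bar>) \<longlonglongrightarrow> ln \<kappa> + real n * \<bar>0\<bar>"
    by (intro tendsto_intros)
  then show ?thesis using b by (intro LIMSEQ_le_const[where X = "\<lambda>k. ln \<kappa> + real n * \<bar>growth (Suc k * n) / real (Suc k * n)\<bar>"]) auto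
qed

lemma avg_limit:
  assumes f: "\<And>n :: nat. loglike C (f n)" and lim: "\<And>x. (\<lambda>n. f n x) \<longlonglongrightarrow> g x"
  shows "(\<lambda>n. avg (f n) x) \<longlonglongrightarrow> avg g x"
proof (cases "x \<in> punctured_orthant")
  case x: True
  have g: "loglike C g" by (rule loglike_limit[OF f lim])
  have "(\<lambda>n. \<integral>\<omega>. f n (A \<omega> *v x) \<partial>M) \<longlonglongrightarrow> (\<integral>\<omega>. g (A \<omega> *v x) \<partial>M)"
  proof (rule integral_dominated_convergence)
    show "integrable M (\<lambda>\<omega>. C + \<bar>ln (l1norm x)\<bar> + ln (Nmax (A \<omega>)))"
      using lnN_integrable by simp
    show "AE \<omega> in M. norm (f n (A \<omega> *v x)) \<le> C + \<bar>ln (l1norm x)\<bar> + ln (Nmax (A \<omega>))" for n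
    proof (rule AE_I2)
      fix \<omega> assume "\<omega> \<in> space M"
      from loglike_A_bound[OF f x this, of n]
      show "norm (f n (A \<omega> *v x)) \<le> C + \<bar>ln (l1norm x)\<bar> + ln (Nmax (A \<omega>))"
        unfolding real_norm_def by linarith
    qed
  qed (use avg_integrable[OF f x] avg_integrable[OF g x] lim in auto)
  then show ?thesis using x by (simp add: avg_def)
next
  case False
  then have "avg f x = 0" for f unfolding avg_def by (rule if_not_P)
  then show ?thesis by simp
qed

text \<open>The decreasing limit of \<open>sup_(n \<ge> N) E ln \<bar>A_n ... A_1 x\<bar>\<close> is subharmonic. Averaging it repeatedly
produces an increasing sequence, bounded because the growth is, whose limit is harmonic.\<close>

lemma harmonic_exists:
  assumes bdd: "\<And>n. \<bar>growth n\<bar> \<le> ln \<kappa>"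
  obtains h C where "loglike C h" "avg h = h"
proof -
  define c where "c = 2 * ln \<kappa>"
  have l: "loglike c (mean_log n)" for n
  proof -
    obtain D where "loglike D (mean_log n)"
      using loglike_avg_iterate[OF loglike_log_l1] unfolding mean_log_def by blast
    moreover have "\<bar>mean_log n x - ln (l1norm x)\<bar> \<le> c" if "x \<in> punctured_orthant" for x
      using mean_log_near_growth[OF that, of n] bdd[of n] by (simp add: c_def abs_le_iff)
    ultimately show ?thesis by (simp add: loglike_def)
  qed
  have avg_l: "avg (mean_log n) = mean_log (Suc n)" for n by (simp add: mean_log_def)
  define s where "s N x = (SUP n. mean_log (N + n) x)" for N x
  have s: "loglike c (s N)" for N unfolding s_def by (rule loglike_SUP[OF l])
  have upper: "mean_log (N + n) x \<le> s N x" for N n x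
    unfolding s_def by (rule cSUP_upper[OF _ loglike_bdd(1)[OF l]]) simp
  have s_mono: "s (Suc N) x \<le> s N x" for N x
    unfolding s_def[of "Suc N"] using upper[of N "Suc _" x] by (intro cSUP_least) auto
  have "convergent (\<lambda>N. s N x)" for x
  proof -
    have "decseq (\<lambda>N. s N x)" using s_mono by (simp add: decseq_Suc_iff)
    moreover obtain L where "\<And>N. L \<le> s N x"
      using loglike_bdd(2)[where f = s, OF s, of x] by (auto simp: bdd_below_def)
    ultimately show ?thesis using decseq_convergent by (metis convergentI)
  qed
  then obtain h1 where h1: "\<And>x. (\<lambda>N. s N x) \<longlonglongrightarrow> h1 x" unfolding convergent_def by metis
  have h1l: "loglike c h1" by (rule loglike_limit[OF s h1])
  have s_avg: "s (Suc N) x \<le> avg (s N) x" for N x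
  proof (cases "x \<in> punctured_orthant")
    case x: True
    show ?thesis unfolding s_def[of "Suc N"]
    proof (rule cSUP_least)
      fix n
      have "avg (mean_log (N + n)) x \<le> avg (s N) x + 0"
        using upper by (intro avg_mono[OF l s x]) auto
      then show "mean_log (Suc N + n) x \<le> avg (s N) x" by (simp add: avg_l)
    qed simp
  next
    case False
    then have "avg (s N) x = 0" unfolding avg_def by (rule if_not_P)
    then show ?thesis using loglike_outside[OF s False] by simp
  qed
  have h1_sub: "h1 x \<le> avg h1 x" for x
    using s_avg by (intro LIMSEQ_le[OF LIMSEQ_Suc[OF h1] avg_limit[OF s h1]]) auto
  \<comment> \<open>The averages of a subharmonic function increase, here to a harmonic one.\<close>
  define g where "g k = (avg ^^ k) h1" for k
  have g: "loglike (2 * c) (g k)" for k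
  proof -
    obtain D where "loglike D (g k)" using loglike_avg_iterate[OF h1l] unfolding g_def by blast
    moreover have "\<bar>g k x - ln (l1norm x)\<bar> \<le> 2 * c" if x: "x \<in> punctured_orthant" for x
    proof -
      have b: "h1 y \<le> log_l1 y + c" "log_l1 y \<le> h1 y + c" if "y \<in> punctured_orthant" for y
        using loglike_bound[OF h1l that] that by (auto simp: log_l1_def abs_le_iff)
      have "g k x \<le> mean_log k x + c" "mean_log k x \<le> g k x + c"
        unfolding g_def mean_log_def using b x
        by (auto intro!: avg_iterate_mono[OF h1l loglike_log_l1] avg_iterate_mono[OF loglike_log_l1 h1l])
      then show ?thesis using loglike_bound[OF l x, of k] by (simp add: abs_le_iff)
    qed
    ultimately show ?thesis by (simp add: loglike_def)
  qed
  have g_mono: "g k x \<le> g (Suc k) x" for k x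
  proof (cases "x \<in> punctured_orthant")
    case x: True
    have "(avg ^^ k) h1 x \<le> (avg ^^ k) (avg h1) x + 0"
      using h1_sub by (intro avg_iterate_mono[OF h1l loglike_avg[OF h1l] _ x]) auto
    then show ?thesis by (simp add: g_def funpow_swap1)
  qed (simp add: loglike_outside[OF g])
  have "convergent (\<lambda>k. g k x)" for x
  proof -
    have "incseq (\<lambda>k. g k x)" using g_mono by (simp add: incseq_Suc_iff)
    moreover obtain L where "\<And>k. g k x \<le> L"
      using loglike_bdd(1)[where f = g, OF g, of x] by (auto simp: bdd_above_def)
    ultimately show ?thesis using incseq_convergent by (metis convergentI)
  qed
  then obtain h where h: "\<And>x. (\<lambda>k. g k x) \<longlonglongrightarrow> h x" unfolding convergent_def by metis
  have "avg h x = h x" for x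
  proof (rule LIMSEQ_unique[OF avg_limit[OF g h]])
    show "(\<lambda>k. avg (g k) x) \<longlonglongrightarrow> h x" using LIMSEQ_Suc[OF h, of x] by (simp add: g_def)
  qed
  then show ?thesis using that[OF loglike_limit[OF g h]] by blast
qed

end

section \<open>The Lyapunov exponent controls the averaged growth\<close>

lemma mat_1_allowable: "mat 1 \<in> (allowable :: (real^'n^'n) set)"
  by (auto simp: allowable_def mat_def)

lemma left_prod_cong:
  "(\<And>k. 1 \<le> k \<Longrightarrow> k \<le> n \<Longrightarrow> X k = Y k) \<Longrightarrow> left_prod X n = left_prod Y n"
  by (induction n) auto

lemma left_prod_allowable:
  "(\<And>k. 1 \<le> k \<Longrightarrow> X k \<in> allowable) \<Longrightarrow> left_prod X n \<in> allowable"
  by (induction n) (auto intro: allowable_mult mat_1_allowable)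

lemma log_left_prod_bound:
  assumes X: "\<And>k. 1 \<le> k \<Longrightarrow> X k \<in> allowable" and x: "x \<in> punctured_orthant"
  shows "\<bar>ln (l1norm (left_prod X n *v x)) - ln (l1norm x)\<bar> \<le> (\<Sum>k=1..n. ln (Nmax (X k)))"
proof (induction n)
  case (Suc n)
  have "left_prod X n *v x \<in> punctured_orthant"
    by (rule allowable_mult_punctured[OF left_prod_allowable[OF X] x])
  from log_mult_bound[OF X this, of "Suc n"] Suc show ?case
    by (simp add: matrix_vector_mul_assoc[symmetric] abs_le_iff)
qed simp

lemma measurable_matrix_mult [measurable]:
  assumes "f \<in> borel_measurable N" "g \<in> borel_measurable N"
  shows "(\<lambda>x. (f x :: real^'n^'n) ** (g x :: real^'n^'n)) \<in> borel_measurable N"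
  using assms
proof (rule borel_measurable_continuous_Pair)
  show "continuous_on UNIV (\<lambda>p. (fst p :: real^'n^'n) ** (snd p :: real^'n^'n))"
    unfolding matrix_matrix_mult_def by (intro continuous_intros)
qed

text \<open>The given copies of \<open>A\<close> are allowable only almost surely; this replacement is allowable everywhere and
changes them on a null set.\<close>

definition allowable_part :: "real^'n^'n \<Rightarrow> real^'n^'n" where
  "allowable_part g = (if g \<in> allowable then g else mat 1)"

lemma allowable_part_measurable [measurable]: "allowable_part \<in> borel_measurable borel"
  unfolding allowable_part_def by measurable

lemma allowable_part_allowable: "allowable_part g \<in> allowable"
  by (simp add: allowable_part_def mat_1_allowable)

lemma Nmax_allowable_part_measurable [measurable]:
  "(\<lambda>g. Nmax (allowable_part g)) \<in> borel_measurable borel"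
  by (rule Nmax_measurable(1)[OF allowable_part_measurable allowable_part_allowable])

context affine_pair
begin

context
  fixes As :: "nat \<Rightarrow> 'w \<Rightarrow> real^'n^'n"
  assumes indep: "indep_vars (\<lambda>_. borel) As {1..}"
    and distr: "\<And>k. 1 \<le> k \<Longrightarrow> distr M borel (As k) = distr M borel A"
begin

abbreviation (input) Pi_n :: "nat \<Rightarrow> 'w \<Rightarrow> real^'n^'n" where
  "Pi_n n \<omega> \<equiv> left_prod (\<lambda>k. As k \<omega>) n"

lemma As_measurable: "1 \<le> k \<Longrightarrow> As k \<in> borel_measurable M"
  using indep by (auto simp: indep_vars_def)

lemma left_prod_measurable: "Pi_n n \<in> borel_measurable M"
  by (induction n) (auto intro!: measurable_matrix_mult As_measurable)

lemma AE_As_allowable: "AE \<omega> in M. \<forall>k\<ge>1. As k \<omega> \<in> allowable"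
proof -
  have "AE \<omega> in M. As k \<omega> \<in> allowable" if k: "1 \<le> k" for k
  proof -
    have "AE g in distr M borel A. g \<in> allowable"
      using A_allowable by (subst AE_distr_iff) (auto simp: pred_sets2[OF allowable_borel])
    then have "AE g in distr M borel (As k). g \<in> allowable" unfolding distr[OF k] .
    then show ?thesis using As_measurable[OF k]
      by (subst (asm) AE_distr_iff) (auto simp: pred_sets2[OF allowable_borel])
  qed
  then have "AE \<omega> in M. \<forall>k. 1 \<le> k \<longrightarrow> As k \<omega> \<in> allowable"
    unfolding AE_all_countable by simp
  then show ?thesis by simp
qed

definition logN :: "nat \<Rightarrow> 'w \<Rightarrow> real" where
  "logN k \<omega> = ln (Nmax (allowable_part (As k \<omega>)))"

lemma logN_measurable: "1 \<le> k \<Longrightarrow> logN k \<in> borel_measurable M"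
  using As_measurable[of k] unfolding logN_def by measurable

lemma logN_square:
  assumes k: "1 \<le> k"
  shows "integrable M (\<lambda>\<omega>. (logN k \<omega>)\<^sup>2)"
    and "(\<integral>\<omega>. (logN k \<omega>)\<^sup>2 \<partial>M) = (\<integral>\<omega>. (ln (Nmax (A \<omega>)))\<^sup>2 \<partial>M)"
proof -
  let ?f = "\<lambda>g :: real^'n^'n. (ln (Nmax (allowable_part g)))\<^sup>2"
  have [measurable]: "?f \<in> borel_measurable borel" by measurable
  have A: "?f (A \<omega>) = (ln (Nmax (A \<omega>)))\<^sup>2" if "\<omega> \<in> space M" for \<omega>
    using A_allowable[OF that] by (simp add: allowable_part_def)
  have "integrable M (\<lambda>\<omega>. ?f (A \<omega>))"
    using lnN_sq_integrable A by (subst Bochner_Integration.integrable_cong[OF refl A]) auto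
  then have "integrable (distr M borel (As k)) ?f"
    unfolding distr[OF k] by (subst integrable_distr_eq) auto
  then show "integrable M (\<lambda>\<omega>. (logN k \<omega>)\<^sup>2)"
    using As_measurable[OF k] unfolding logN_def by (subst (asm) integrable_distr_eq) auto
  have "(\<integral>\<omega>. (logN k \<omega>)\<^sup>2 \<partial>M) = (\<integral>g. ?f g \<partial>distr M borel (As k))"
    using As_measurable[OF k] unfolding logN_def by (subst integral_distr) auto
  also have "\<dots> = (\<integral>\<omega>. ?f (A \<omega>) \<partial>M)" unfolding distr[OF k] by (subst integral_distr) auto
  also have "\<dots> = (\<integral>\<omega>. (ln (Nmax (A \<omega>)))\<^sup>2 \<partial>M)"
    by (rule Bochner_Integration.integral_cong[OF refl A])
  finally show "(\<integral>\<omega>. (logN k \<omega>)\<^sup>2 \<partial>M) = (\<integral>\<omega>. (ln (Nmax (A \<omega>)))\<^sup>2 \<partial>M)" .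
qed

lemma logN_integrable: "1 \<le> k \<Longrightarrow> integrable M (logN k)"
  using square_integrable_imp_integrable[OF logN_measurable logN_square(1)] by simp

lemma AE_log_left_prod_bound:
  assumes x: "x \<in> punctured_orthant"
  shows "AE \<omega> in M. \<forall>n. Pi_n n \<omega> \<in> allowable \<and>
    \<bar>ln (l1norm (Pi_n n \<omega> *v x)) - ln (l1norm x)\<bar> \<le> (\<Sum>k=1..n. logN k \<omega>)"
  using AE_As_allowable
proof eventually_elim
  case (elim \<omega>)
  then have X: "\<And>k. 1 \<le> k \<Longrightarrow> As k \<omega> \<in> allowable" by simp
  have "(\<Sum>k=1..n. ln (Nmax (As k \<omega>))) = (\<Sum>k=1..n. logN k \<omega>)" for n
    using X by (intro sum.cong) (auto simp: logN_def allowable_part_def)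
  then show ?case
    using log_left_prod_bound[of "\<lambda>k. As k \<omega>", OF X x] left_prod_allowable[of "\<lambda>k. As k \<omega>", OF X] by metis
qed

lemma integrable_loglike_left_prod:
  assumes f: "loglike C f" and x: "x \<in> punctured_orthant"
  shows "integrable M (\<lambda>\<omega>. f (Pi_n n \<omega> *v x))"
proof (rule Bochner_Integration.integrable_bound)
  show "integrable M (\<lambda>\<omega>. C + \<bar>ln (l1norm x)\<bar> + (\<Sum>k=1..n. logN k \<omega>))"
    by (intro Bochner_Integration.integrable_add Bochner_Integration.integrable_sum
        integrable_const logN_integrable) auto
  show "(\<lambda>\<omega>. f (Pi_n n \<omega> *v x)) \<in> borel_measurable M"
    using loglike_measurable[OF f] left_prod_measurable[of n] by measurable
  show "AE \<omega> in M. norm (f (Pi_n n \<omega> *v x)) \<le> norm (C + \<bar>ln (l1norm x)\<bar> + (\<Sum>k=1..n. logN k \<omega>))"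
    using AE_log_left_prod_bound[OF x]
  proof eventually_elim
    case (elim \<omega>)
    then have "Pi_n n \<omega> *v x \<in> punctured_orthant" using allowable_mult_punctured x by blast
    from loglike_bound[OF f this] elim[rule_format, of n] show ?case unfolding real_norm_def by linarith
  qed
qed

text \<open>The product of the first \<open>n\<close> copies is a function of the coordinates \<open>1..n\<close>, hence independent of the
next factor.\<close>

lemma indep_next_factor:
  "distr M (borel \<Otimes>\<^sub>M borel) (\<lambda>\<omega>. (As (Suc n) \<omega>, Pi_n n \<omega>))
    = distr M borel A \<Otimes>\<^sub>M distr M borel (Pi_n n)"
proof -
  let ?lp = "\<lambda>f :: nat \<Rightarrow> real^'n^'n. left_prod f n"
  have "(\<lambda>f. left_prod f m) \<in> borel_measurable (PiM {1..n} (\<lambda>_. borel :: (real^'n^'n) measure))"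
    if "m \<le> n" for m
    using that
  proof (induction m)
    case (Suc m)
    have "(\<lambda>f. f (Suc m)) \<in> borel_measurable (PiM {1..n} (\<lambda>_. borel :: (real^'n^'n) measure))"
      using Suc.prems by (intro measurable_component_singleton) auto
    then show ?case using Suc by (auto intro!: measurable_matrix_mult)
  qed simp
  from this[OF order_refl] have lp: "?lp \<in> borel_measurable (PiM {1..n} (\<lambda>_. borel))" .
  have "indep_var (PiM {Suc n} (\<lambda>_. borel)) (\<lambda>\<omega>. restrict (\<lambda>i. As i \<omega>) {Suc n})
      (PiM {1..n} (\<lambda>_. borel)) (\<lambda>\<omega>. restrict (\<lambda>i. As i \<omega>) {1..n})"
    by (rule indep_var_restrict[OF indep]) auto
  then have "indep_var borel ((\<lambda>f. f (Suc n)) \<circ> (\<lambda>\<omega>. restrict (\<lambda>i. As i \<omega>) {Suc n}))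
      borel (?lp \<circ> (\<lambda>\<omega>. restrict (\<lambda>i. As i \<omega>) {1..n}))"
    by (rule indep_var_compose[OF _ _ lp]) (rule measurable_component_singleton, simp)
  moreover have "?lp \<circ> (\<lambda>\<omega>. restrict (\<lambda>i. As i \<omega>) {1..n}) = Pi_n n"
    by (auto simp: fun_eq_iff intro!: left_prod_cong)
  ultimately have "indep_var borel (As (Suc n)) borel (Pi_n n)" by (simp add: comp_def)
  then show ?thesis by (simp add: indep_var_distribution_eq distr)
qed

text \<open>The next factor acts last, so conditioning on the first \<open>n\<close> factors replaces \<open>f\<close> by its average.\<close>

lemma expectation_left_prod:
  assumes f: "loglike C f" and x: "x \<in> punctured_orthant"
  shows "(\<integral>\<omega>. f (Pi_n n \<omega> *v x) \<partial>M) = (avg ^^ n) f x"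
  using f
proof (induction n arbitrary: f C)
  case 0
  then show ?case by (simp add: prob_space)
next
  case (Suc n)
  note f = Suc.prems
  have [measurable]: "f \<in> borel_measurable borel" by (rule loglike_measurable[OF f])
  have [measurable]: "avg f \<in> borel_measurable borel" by (rule loglike_measurable[OF loglike_avg[OF f]])
  have [measurable]: "As (Suc n) \<in> borel_measurable M" by (rule As_measurable) simp
  have [measurable]: "Pi_n n \<in> borel_measurable M" by (rule left_prod_measurable)
  interpret PA: prob_space "distr M borel A" by (rule prob_space_distr) simp
  interpret PY: prob_space "distr M borel (Pi_n n)" by (rule prob_space_distr) simp
  interpret P: pair_prob_space "distr M borel A" "distr M borel (Pi_n n)" ..
  have inner: "(\<lambda>h. \<integral>\<omega>. f (A \<omega> *v (h *v x)) \<partial>M) \<in> borel_measurable borel"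
    by (rule borel_measurable_lebesgue_integral) measurable
  have outer: "(\<lambda>h. avg f (h *v x)) \<in> borel_measurable borel" by measurable
  let ?F = "\<lambda>(g :: real^'n^'n, h :: real^'n^'n). f (g *v (h *v x))"
  have F [measurable]: "?F \<in> borel_measurable (borel \<Otimes>\<^sub>M borel)" by measurable
  have eq: "?F (As (Suc n) \<omega>, Pi_n n \<omega>) = f (Pi_n (Suc n) \<omega> *v x)" for \<omega>
    by (simp add: matrix_vector_mul_assoc)
  have "integrable M (\<lambda>\<omega>. ?F (As (Suc n) \<omega>, Pi_n n \<omega>))"
    unfolding eq by (rule integrable_loglike_left_prod[OF f x])
  then have "integrable (distr M (borel \<Otimes>\<^sub>M borel) (\<lambda>\<omega>. (As (Suc n) \<omega>, Pi_n n \<omega>))) ?F"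
    by (subst integrable_distr_eq) auto
  then have int: "integrable (distr M borel A \<Otimes>\<^sub>M distr M borel (Pi_n n)) ?F"
    unfolding indep_next_factor .
  have "(\<integral>\<omega>. f (Pi_n (Suc n) \<omega> *v x) \<partial>M) = (\<integral>\<omega>. ?F (As (Suc n) \<omega>, Pi_n n \<omega>) \<partial>M)"
    unfolding eq ..
  also have "\<dots> = (\<integral>p. ?F p \<partial>distr M (borel \<Otimes>\<^sub>M borel) (\<lambda>\<omega>. (As (Suc n) \<omega>, Pi_n n \<omega>)))"
    by (subst integral_distr) auto
  also have "\<dots> = (\<integral>h. (\<integral>g. f (g *v (h *v x)) \<partial>distr M borel A) \<partial>distr M borel (Pi_n n))"
    unfolding indep_next_factor using P.integral_snd[OF int] by simp
  also have "\<dots> = (\<integral>h. (\<integral>\<omega>. f (A \<omega> *v (h *v x)) \<partial>M) \<partial>distr M borel (Pi_n n))"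
    by (subst integral_distr) auto
  also have "\<dots> = (\<integral>\<omega>'. (\<integral>\<omega>. f (A \<omega> *v (Pi_n n \<omega>' *v x)) \<partial>M) \<partial>M)"
    by (rule integral_distr[OF left_prod_measurable inner])
  also have "\<dots> = (\<integral>\<omega>'. avg f (Pi_n n \<omega>' *v x) \<partial>M)"
  proof (rule integral_cong_AE)
    show "AE \<omega>' in M. (\<integral>\<omega>. f (A \<omega> *v (Pi_n n \<omega>' *v x)) \<partial>M) = avg f (Pi_n n \<omega>' *v x)"
      using AE_log_left_prod_bound[OF x]
    proof eventually_elim
      case (elim \<omega>')
      then have "Pi_n n \<omega>' *v x \<in> punctured_orthant" using allowable_mult_punctured x by blast
      then show ?case by (simp only: avg_def if_True)
    qed
  qed (rule measurable_compose[OF left_prod_measurable inner] measurable_compose[OF left_prod_measurable outer])+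
  also have "\<dots> = (avg ^^ n) (avg f) x" by (rule Suc.IH[OF loglike_avg[OF f]])
  finally show ?case by (simp add: funpow_swap1)
qed

text \<open>Cauchy--Schwarz for summands of equal second moment.\<close>

lemma second_moment_sum:
  "integrable M (\<lambda>\<omega>. (\<Sum>k=1..n. logN k \<omega>)\<^sup>2)"
  "(\<integral>\<omega>. (\<Sum>k=1..n. logN k \<omega>)\<^sup>2 \<partial>M) \<le> (real n)\<^sup>2 * (\<integral>\<omega>. (ln (Nmax (A \<omega>)))\<^sup>2 \<partial>M)"
proof -
  have cs: "(\<Sum>k=1..n. logN k \<omega>)\<^sup>2 \<le> real n * (\<Sum>k=1..n. (logN k \<omega>)\<^sup>2)" for \<omega>
    using sum_squared_le_sum_of_squares[of "\<lambda>k. logN k \<omega>" "{1..n}"] by (simp add: mult.commute)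
  have int: "integrable M (\<lambda>\<omega>. real n * (\<Sum>k=1..n. (logN k \<omega>)\<^sup>2))" using logN_square(1) by auto
  show i: "integrable M (\<lambda>\<omega>. (\<Sum>k=1..n. logN k \<omega>)\<^sup>2)"
  proof (rule Bochner_Integration.integrable_bound[OF int])
    have "(\<lambda>\<omega>. \<Sum>k=1..n. logN k \<omega>) \<in> borel_measurable M"
      using logN_measurable by (intro borel_measurable_sum) auto
    then show "(\<lambda>\<omega>. (\<Sum>k=1..n. logN k \<omega>)\<^sup>2) \<in> borel_measurable M" by measurable
    show "AE \<omega> in M. norm ((\<Sum>k=1..n. logN k \<omega>)\<^sup>2) \<le> norm (real n * (\<Sum>k=1..n. (logN k \<omega>)\<^sup>2))"
    proof (rule AE_I2)
      fix \<omega>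
      from cs[of \<omega>] show "norm ((\<Sum>k=1..n. logN k \<omega>)\<^sup>2) \<le> norm (real n * (\<Sum>k=1..n. (logN k \<omega>)\<^sup>2))"
        unfolding real_norm_def abs_power2 by (rule order_trans[OF _ abs_ge_self])
    qed
  qed
  have "(\<integral>\<omega>. (\<Sum>k=1..n. logN k \<omega>)\<^sup>2 \<partial>M) \<le> (\<integral>\<omega>. real n * (\<Sum>k=1..n. (logN k \<omega>)\<^sup>2) \<partial>M)"
    using cs by (intro integral_mono i int) auto
  also have "\<dots> = real n * (\<Sum>k=1..n. (\<integral>\<omega>. (logN k \<omega>)\<^sup>2 \<partial>M))"
    using logN_square(1) by (simp add: Bochner_Integration.integral_sum)
  also have "\<dots> = (real n)\<^sup>2 * (\<integral>\<omega>. (ln (Nmax (A \<omega>)))\<^sup>2 \<partial>M)"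
    using logN_square(2) by (simp add: power2_eq_square)
  finally show "(\<integral>\<omega>. (\<Sum>k=1..n. logN k \<omega>)\<^sup>2 \<partial>M) \<le> (real n)\<^sup>2 * (\<integral>\<omega>. (ln (Nmax (A \<omega>)))\<^sup>2 \<partial>M)" .
qed

lemma AE_log_unif_rate:
  assumes lim: "AE \<omega> in M. (\<lambda>n. ln (matnorm (Pi_n n \<omega>)) / real n) \<longlonglongrightarrow> 0"
  shows "AE \<omega> in M. (\<lambda>n. \<bar>log_l1 (Pi_n n \<omega> *v unif_vec)\<bar> / real n) \<longlonglongrightarrow> 0"
proof -
  have u: "unif_vec \<in> punctured_orthant" by simp
  show ?thesis using lim AE_log_left_prod_bound[OF u]
  proof eventually_elim
    case (elim \<omega>)
    let ?d = "real CARD('n)"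
    have b: "\<bar>log_l1 (Pi_n n \<omega> *v unif_vec)\<bar> \<le> \<bar>ln (matnorm (Pi_n n \<omega>))\<bar> + ln ?d" for n
    proof -
      have al: "Pi_n n \<omega> \<in> allowable" using elim(2) by blast
      have p: "Pi_n n \<omega> *v unif_vec \<in> punctured_orthant" by (rule allowable_mult_punctured[OF al u])
      let ?z = "l1norm (Pi_n n \<omega> *v unif_vec)"
      have z: "0 < ?z" using p by simp
      have 1: "?z \<le> matnorm (Pi_n n \<omega>)" using l1norm_mult_le[OF al, of unif_vec] by simp
      have 2: "matnorm (Pi_n n \<omega>) \<le> ?d * ?z" by (rule matnorm_le_unif[OF al])
      have m: "0 < matnorm (Pi_n n \<omega>)" using 1 z by linarith
      have "ln ?z \<le> ln (matnorm (Pi_n n \<omega>))" using 1 z m by (subst ln_le_cancel_iff)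
      moreover have "ln (matnorm (Pi_n n \<omega>)) \<le> ln (?d * ?z)"
        using 2 z m by (subst ln_le_cancel_iff) auto
      moreover have "ln (?d * ?z) = ln ?d + ln ?z" using z by (intro ln_mult_pos) auto
      moreover have "0 \<le> ln ?d" by simp
      ultimately have "\<bar>ln ?z\<bar> \<le> \<bar>ln (matnorm (Pi_n n \<omega>))\<bar> + ln ?d" by linarith
      then show ?thesis using p by (simp only: log_l1_def if_True)
    qed
    have "(\<lambda>n. \<bar>ln (matnorm (Pi_n n \<omega>)) / real n\<bar> + ln ?d / real n) \<longlonglongrightarrow> \<bar>0\<bar> + 0"
      by (intro tendsto_add tendsto_rabs elim(1)) (rule lim_const_over_n)
    then have l0: "(\<lambda>n. \<bar>ln (matnorm (Pi_n n \<omega>)) / real n\<bar> + ln ?d / real n) \<longlonglongrightarrow> 0" by simp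
    show ?case
    proof (rule tendsto_sandwich[OF _ _ tendsto_const l0])
      show "\<forall>\<^sub>F n in sequentially. \<bar>log_l1 (Pi_n n \<omega> *v unif_vec)\<bar> / real n
          \<le> \<bar>ln (matnorm (Pi_n n \<omega>)) / real n\<bar> + ln ?d / real n"
      proof (rule always_eventually, rule allI)
        fix n
        show "\<bar>log_l1 (Pi_n n \<omega> *v unif_vec)\<bar> / real n
          \<le> \<bar>ln (matnorm (Pi_n n \<omega>)) / real n\<bar> + ln ?d / real n"
          using divide_right_mono[OF b[of n], of "real n"] by (simp add: add_divide_distrib)
      qed
    qed simp
  qed
qed

text \<open>Almost sure convergence of \<open>(1/n) ln \<bar>A_n ... A_1 e\<bar>\<close> to \<open>0\<close> passes to means because the second moments
stay bounded.\<close>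

lemma growth_rate_zero:
  assumes lim: "AE \<omega> in M. (\<lambda>n. ln (matnorm (Pi_n n \<omega>)) / real n) \<longlonglongrightarrow> 0"
  shows "(\<lambda>n. growth n / real n) \<longlonglongrightarrow> 0"
proof (rule LIMSEQ_I)
  fix \<epsilon> :: real assume \<epsilon>: "0 < \<epsilon>"
  define W where "W n \<omega> = \<bar>log_l1 (Pi_n n \<omega> *v unif_vec)\<bar> / real n" for n \<omega>
  define D where "D = (\<integral>\<omega>. (ln (Nmax (A \<omega>)))\<^sup>2 \<partial>M)"
  define R where "R = 2 * D / \<epsilon> + 1"
  have u: "unif_vec \<in> punctured_orthant" by simp
  have D: "0 \<le> D" unfolding D_def by (intro integral_nonneg_AE) simp
  have R: "0 < R" "D / R < \<epsilon> / 2"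
  proof -
    show "0 < R" unfolding R_def using D \<epsilon> by (intro add_nonneg_pos) auto
    then show "D / R < \<epsilon> / 2" using \<epsilon> by (simp add: field_simps) (simp add: R_def field_simps)
  qed
  have Wint: "integrable M (W n)" for n
    unfolding W_def using integrable_loglike_left_prod[OF loglike_log_l1 u, of n] by auto
  have [measurable]: "W n \<in> borel_measurable M" for n using Wint[of n] by simp
  have W0: "0 \<le> W n \<omega>" for n \<omega> by (simp add: W_def)
  have gW: "\<bar>growth n / real n\<bar> \<le> (\<integral>\<omega>. W n \<omega> \<partial>M)" for n
  proof -
    have "growth n = (\<integral>\<omega>. log_l1 (Pi_n n \<omega> *v unif_vec) \<partial>M)"
      unfolding growth_def mean_log_def by (rule expectation_left_prod[OF loglike_log_l1 u, symmetric])
    then have "\<bar>growth n\<bar> \<le> (\<integral>\<omega>. \<bar>log_l1 (Pi_n n \<omega> *v unif_vec)\<bar> \<partial>M)"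
      by (simp only: integral_abs_bound)
    from divide_right_mono[OF this, of "real n"] show ?thesis by (simp add: W_def)
  qed
  have W2: "AE \<omega> in M. (W n \<omega>)\<^sup>2 \<le> ((\<Sum>k=1..n. logN k \<omega>)\<^sup>2) / (real n)\<^sup>2" for n
    using AE_log_left_prod_bound[OF u]
  proof eventually_elim
    case (elim \<omega>)
    have al: "Pi_n n \<omega> \<in> allowable" using elim by blast
    have "Pi_n n \<omega> *v unif_vec \<in> punctured_orthant" by (rule allowable_mult_punctured[OF al u])
    then have "log_l1 (Pi_n n \<omega> *v unif_vec) = ln (l1norm (Pi_n n \<omega> *v unif_vec))"
      by (simp only: log_l1_def if_True)
    moreover have "\<bar>ln (l1norm (Pi_n n \<omega> *v unif_vec))\<bar> \<le> (\<Sum>k=1..n. logN k \<omega>)"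
      using elim[rule_format, of n] by simp
    ultimately have "\<bar>log_l1 (Pi_n n \<omega> *v unif_vec)\<bar>\<^sup>2 \<le> (\<Sum>k=1..n. logN k \<omega>)\<^sup>2"
      by (intro power_mono) auto
    from divide_right_mono[OF this, of "(real n)\<^sup>2"] show ?case by (simp add: W_def power_divide)
  qed
  have W2int: "integrable M (\<lambda>\<omega>. (W n \<omega>)\<^sup>2)" for n
  proof (rule Bochner_Integration.integrable_bound[OF integrable_divide[OF second_moment_sum(1)[of n], of "(real n)\<^sup>2"]])
    show "AE \<omega> in M. norm ((W n \<omega>)\<^sup>2) \<le> norm ((\<Sum>k=1..n. logN k \<omega>)\<^sup>2 / (real n)\<^sup>2)"
      using W2[of n] by eventually_elim simp
  qed simp
  have W2b: "(\<integral>\<omega>. (W n \<omega>)\<^sup>2 \<partial>M) \<le> D" for n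
  proof (cases "n = 0")
    case False
    have "(\<integral>\<omega>. (W n \<omega>)\<^sup>2 \<partial>M) \<le> (\<integral>\<omega>. ((\<Sum>k=1..n. logN k \<omega>)\<^sup>2) / (real n)\<^sup>2 \<partial>M)"
      by (intro integral_mono_AE W2int W2 integrable_divide second_moment_sum(1))
    also have "\<dots> \<le> D" using second_moment_sum(2)[of n] False by (simp add: D_def field_simps)
    finally show ?thesis .
  qed (use D in \<open>simp add: W_def\<close>)
  \<comment> \<open>Uniform integrability by hand: the part of \<open>W\<close> above \<open>R\<close> is at most \<open>W\<^sup>2 / R\<close>.\<close>
  have trunc: "(\<integral>\<omega>. W n \<omega> \<partial>M) \<le> (\<integral>\<omega>. min (W n \<omega>) R \<partial>M) + D / R" for n
  proof -
    have pw: "W n \<omega> \<le> min (W n \<omega>) R + (W n \<omega>)\<^sup>2 / R" for \<omega>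
    proof (cases "W n \<omega> \<le> R")
      case False
      then have "R * W n \<omega> \<le> W n \<omega> * W n \<omega>" using W0[of n \<omega>] by (intro mult_right_mono) auto
      then have "W n \<omega> \<le> (W n \<omega>)\<^sup>2 / R" using R by (simp add: field_simps power2_eq_square)
      then show ?thesis using R W0[of n \<omega>] by (simp add: min_def)
    qed (use R in auto)
    have mint: "integrable M (\<lambda>\<omega>. min (W n \<omega>) R)" using Wint by (intro integrable_min) auto
    have "(\<integral>\<omega>. W n \<omega> \<partial>M) \<le> (\<integral>\<omega>. min (W n \<omega>) R + (W n \<omega>)\<^sup>2 / R \<partial>M)"
      using Wint mint W2int pw by (intro integral_mono) auto
    also have "\<dots> = (\<integral>\<omega>. min (W n \<omega>) R \<partial>M) + (\<integral>\<omega>. (W n \<omega>)\<^sup>2 \<partial>M) / R"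
      using mint W2int[of n] by simp
    also have "\<dots> \<le> (\<integral>\<omega>. min (W n \<omega>) R \<partial>M) + D / R"
      using W2b[of n] R by (intro add_left_mono divide_right_mono) auto
    finally show ?thesis .
  qed
  have "(\<lambda>n. \<integral>\<omega>. min (W n \<omega>) R \<partial>M) \<longlonglongrightarrow> (\<integral>\<omega>. 0 \<partial>M)"
  proof (rule integral_dominated_convergence[where w = "\<lambda>_. R"])
    show "AE \<omega> in M. (\<lambda>n. min (W n \<omega>) R) \<longlonglongrightarrow> 0"
      using AE_log_unif_rate[OF lim]
    proof eventually_elim
      case (elim \<omega>)
      have "(\<lambda>n. min (W n \<omega>) R) \<longlonglongrightarrow> min 0 R"
        unfolding W_def by (intro tendsto_min elim tendsto_const)
      then show ?case using R by simp
    qed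
    show "AE \<omega> in M. norm (min (W n \<omega>) R) \<le> R" for n using W0 R by (intro AE_I2) (simp add: min_def)
  qed auto
  then have "(\<lambda>n. \<integral>\<omega>. min (W n \<omega>) R \<partial>M) \<longlonglongrightarrow> 0" by simp
  from LIMSEQ_D[OF this, of "\<epsilon> / 2"] \<epsilon> obtain n0
    where n0: "\<And>n. n0 \<le> n \<Longrightarrow> \<bar>\<integral>\<omega>. min (W n \<omega>) R \<partial>M\<bar> < \<epsilon> / 2" by auto
  have "norm (growth n / real n - 0) < \<epsilon>" if "n0 \<le> n" for n
    using n0[OF that] gW[of n] trunc[of n] R(2) unfolding real_norm_def by linarith
  then show "\<exists>n0. \<forall>n\<ge>n0. norm (growth n / real n - 0) < \<epsilon>" by blast
qed

end

end

section \<open>The support, its semigroup, and reachable sets\<close>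

text \<open>Factors are added on the right, so the new factor is the one that acts first. It decides how the images of
two vectors compare, and it is the first step of the chain.\<close>

inductive_set semigroup_of :: "(real^'n^'n) set \<Rightarrow> (real^'n^'n) set" for S where
  base: "g \<in> S \<Longrightarrow> g \<in> semigroup_of S"
| mult: "h \<in> semigroup_of S \<Longrightarrow> g \<in> S \<Longrightarrow> h ** g \<in> semigroup_of S"

lemma semigroup_of_mult:
  assumes "h \<in> semigroup_of S" "g \<in> semigroup_of S"
  shows "h ** g \<in> semigroup_of S"
  using assms(2,1)
proof (induction)
  case (mult g f)
  then show ?case using semigroup_of.mult[of "h ** g" S f] by (simp add: matrix_mul_assoc)
qed (rule semigroup_of.mult)

lemma semigroup_of_subset:
  assumes "S \<subseteq> T" "\<And>g h. g \<in> T \<Longrightarrow> h \<in> T \<Longrightarrow> g ** h \<in> T"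
  shows "semigroup_of S \<subseteq> T"
proof
  fix g assume "g \<in> semigroup_of S"
  then show "g \<in> T" by induction (use assms in auto)
qed

text \<open>The complement of the support is covered by the null sets of a countable basis.\<close>

lemma AE_msupport:
  fixes A :: "'w \<Rightarrow> real^'n^'n"
  assumes A_meas [measurable]: "A \<in> borel_measurable M"
    and A_allowable: "\<And>\<omega>. \<omega> \<in> space M \<Longrightarrow> A \<omega> \<in> allowable"
  shows "AE \<omega> in M. A \<omega> \<in> msupport (distr M borel A)"
proof -
  obtain \<B> :: "(real^'n^'n) set set" where \<B>: "countable \<B>" "topological_basis \<B>"
    using ex_countable_basis by blast
  have "AE \<omega> in M. \<forall>U\<in>{U \<in> \<B>. emeasure (distr M borel A) U = 0}. A \<omega> \<notin> U"
  proof (rule AE_ball_countable[THEN iffD2], use \<B> in simp, rule ballI)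
    fix U assume U: "U \<in> {U \<in> \<B>. emeasure (distr M borel A) U = 0}"
    then have "U \<in> sets borel" using topological_basis_open[OF \<B>(2)] by auto
    with U have "AE g in distr M borel A. g \<notin> U" by (intro AE_not_in) auto
    then show "AE \<omega> in M. A \<omega> \<notin> U" using \<open>U \<in> sets borel\<close> by (subst (asm) AE_distr_iff) auto
  qed
  then show ?thesis using AE_space
  proof eventually_elim
    case (elim \<omega>)
    have "emeasure (distr M borel A) U \<noteq> 0" if U: "open U" "A \<omega> \<in> U" for U
    proof
      assume null: "emeasure (distr M borel A) U = 0"
      obtain V where V: "V \<in> \<B>" "A \<omega> \<in> V" "V \<subseteq> U"
        using topological_basisE[OF \<B>(2) U] by blast
      then have "emeasure (distr M borel A) V \<le> emeasure (distr M borel A) U"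
        using U by (intro emeasure_mono) auto
      then show False using null V elim(1) by auto
    qed
    then show ?case using A_allowable[OF elim(2)] by (simp add: msupport_def)
  qed
qed

context affine_pair
begin

abbreviation "supp \<equiv> msupport (distr M borel A)"

lemma supp_allowable: "supp \<subseteq> allowable"
  by (auto simp: msupport_def)

lemma semigroup_allowable: "semigroup_of supp \<subseteq> allowable"
  using supp_allowable by (intro semigroup_of_subset allowable_mult) auto

lemma supp_open_pos:
  assumes g: "g \<in> supp" and U: "open U" "g \<in> U"
  shows "0 < measure M {\<omega> \<in> space M. A \<omega> \<in> U}"
proof -
  have "emeasure (distr M borel A) U \<noteq> 0" using g U by (auto simp: msupport_def)
  moreover have "emeasure (distr M borel A) U = emeasure M {\<omega> \<in> space M. A \<omega> \<in> U}"
    using U by (subst emeasure_distr) (auto intro!: arg_cong[where f = "emeasure M"])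
  ultimately show ?thesis by (simp add: emeasure_eq_measure zero_less_measure_iff)
qed

lemma AE_supp: "AE \<omega> in M. A \<omega> \<in> supp"
  by (rule AE_msupport[OF A_meas A_allowable])

lemma supp_nonempty: "supp \<noteq> {}"
proof
  assume "supp = {}"
  then have "AE \<omega> in M. False" using AE_supp by simp
  then show False by simp
qed

text \<open>The failure of an entrywise comparison is an open condition, hence excluded on the support once it has
probability zero.\<close>

lemma supp_balanced:
  assumes g: "g \<in> supp"
  shows "g $ i $ j \<le> \<kappa> * g $ i $ k"
proof (rule ccontr)
  assume "\<not> g $ i $ j \<le> \<kappa> * g $ i $ k"
  then have "g \<in> {g. \<kappa> * g $ i $ k < g $ i $ j}" by simp
  moreover have "open {g :: real^'n^'n. \<kappa> * g $ i $ k < g $ i $ j}"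
    by (intro open_Collect_less continuous_intros)
  ultimately have pos: "0 < measure M {\<omega> \<in> space M. A \<omega> \<in> {g. \<kappa> * g $ i $ k < g $ i $ j}}"
    using supp_open_pos[OF g] by blast
  have "AE \<omega> in M. \<not> A \<omega> \<in> {g. \<kappa> * g $ i $ k < g $ i $ j}"
    using balanced by eventually_elim (auto simp: not_less)
  then have "measure M {\<omega> \<in> space M. A \<omega> \<in> {g. \<kappa> * g $ i $ k < g $ i $ j}} = 0"
    by (rule prob_eq_0_AE)
  with pos show False by simp
qed

text \<open>Comparability within rows only concerns the factor that acts first.\<close>

lemma semigroup_balanced:
  assumes "g \<in> semigroup_of supp"
  shows "g $ i $ j \<le> \<kappa> * g $ i $ k"
  using assms
proof induction
  case (mult h g)
  have nn: "0 \<le> h $ i $ l" for l using mult semigroup_allowable by (auto simp: allowable_def)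
  have "(\<Sum>l\<in>UNIV. h $ i $ l * g $ l $ j) \<le> (\<Sum>l\<in>UNIV. h $ i $ l * (\<kappa> * g $ l $ k))"
    using nn supp_balanced[OF mult(2)] by (intro sum_mono mult_left_mono) auto
  then show ?case by (simp add: matrix_matrix_mult_def sum_distrib_left algebra_simps)
qed (rule supp_balanced)

text \<open>All vectors are expanded by nearly the same factor, so the norm is nearly attained everywhere.\<close>

lemma semigroup_matnorm_le:
  assumes g: "g \<in> semigroup_of supp" and x: "x \<in> nonneg_orthant"
  shows "matnorm g * l1norm x \<le> \<kappa> * l1norm (g *v x)"
proof -
  have al: "g \<in> allowable" using g semigroup_allowable by blast
  have "Max (range (colsum g)) \<in> range (colsum g)" by (intro Max_in) auto
  then obtain j where j: "matnorm g = colsum g j" unfolding matnorm_eq[OF al] by (rule rangeE)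
  have ax: "axis j 1 \<in> (nonneg_orthant :: (real^'n) set)" using axis_in_punctured_orthant by auto
  have "l1norm x * (g *v axis j 1) $ i \<le> \<kappa> * (g *v x) $ i" for i
    using balanced_image[OF _ ax x, of g i] semigroup_balanced[OF g] by simp
  then have "(\<Sum>i\<in>UNIV. l1norm x * (g *v axis j 1) $ i) \<le> (\<Sum>i\<in>UNIV. \<kappa> * (g *v x) $ i)"
    by (intro sum_mono)
  then have "l1norm x * l1norm (g *v axis j 1) \<le> \<kappa> * l1norm (g *v x)"
    by (simp add: l1norm_orthant allowable_mult_orthant[OF al] ax x sum_distrib_left)
  then show ?thesis by (simp add: l1norm_mult_axis[OF al] j mult.commute)
qed

text \<open>Transition operator of the random map \<open>F\<close>. It is used for the affine map and for its linear part.\<close>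

definition kstep :: "('w \<Rightarrow> real^'n \<Rightarrow> real^'n) \<Rightarrow> (real^'n \<Rightarrow> ennreal) \<Rightarrow> real^'n \<Rightarrow> ennreal" where
  "kstep F f x = (\<integral>\<^sup>+\<omega>. f (F \<omega> x) \<partial>M)"

lemma kstep_expanding:
  assumes F: "\<And>\<omega> x. \<omega> \<in> space M \<Longrightarrow> x \<in> punctured_orthant \<Longrightarrow> 1 + \<delta> \<le> iota_min (A \<omega>) \<Longrightarrow>
      F \<omega> x \<in> punctured_orthant \<and> (1 + \<delta>) * l1norm x \<le> l1norm (F \<omega> x)"
    and \<delta>: "0 < \<delta>" and x: "x \<in> punctured_orthant" "r \<le> l1norm x"
  shows "ennreal (measure M {\<omega> \<in> space M. 1 + \<delta> \<le> iota_min (A \<omega>)} ^ m)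
    \<le> (kstep F ^^ m) (indicator {z \<in> punctured_orthant. (1 + \<delta>) ^ m * r \<le> l1norm z}) x"
  using x
proof (induction m arbitrary: x r)
  case (Suc m)
  let ?E = "{\<omega> \<in> space M. 1 + \<delta> \<le> iota_min (A \<omega>)}"
  let ?q = "measure M ?E"
  have [measurable]: "?E \<in> sets M"
    using Nmax_measurable(2)[OF A_meas A_allowable] by measurable
  let ?f = "(kstep F ^^ m) (indicator {z \<in> punctured_orthant. (1 + \<delta>) ^ Suc m * r \<le> l1norm z})"
  have "ennreal (?q ^ m) * indicator ?E \<omega> \<le> ?f (F \<omega> x)" if "\<omega> \<in> space M" for \<omega>
  proof (cases "\<omega> \<in> ?E")
    case True
    then have Fx: "F \<omega> x \<in> punctured_orthant" "(1 + \<delta>) * l1norm x \<le> l1norm (F \<omega> x)"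
      using F[OF that Suc.prems(1)] by auto
    have "(1 + \<delta>) * r \<le> (1 + \<delta>) * l1norm x" using Suc.prems(2) \<delta> by simp
    then have "(1 + \<delta>) * r \<le> l1norm (F \<omega> x)" using Fx(2) by linarith
    from Suc.IH[OF Fx(1) this] show ?thesis using True by (simp add: mult_ac)
  qed simp
  then have "(\<integral>\<^sup>+\<omega>. ennreal (?q ^ m) * indicator ?E \<omega> \<partial>M) \<le> kstep F ?f x"
    unfolding kstep_def[of F ?f] by (intro nn_integral_mono) auto
  moreover have "(\<integral>\<^sup>+\<omega>. ennreal (?q ^ m) * indicator ?E \<omega> \<partial>M) = ennreal (?q ^ Suc m)"
    by (subst nn_integral_cmult_indicator)
      (auto simp: emeasure_eq_measure ennreal_mult[symmetric] mult.commute)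
  ultimately show ?case by simp
qed (simp add: indicator_def)

text \<open>Otherwise every product expands every vector up to a constant, so \<open>h (g x) - h x\<close> is bounded below over all
products \<open>g\<close> and all \<open>x\<close>. At an orbit point \<open>y\<close> where this infimum is almost attained, \<open>h\<close> drops by at
most \<open>\<epsilon>\<close> from then on. The truncation \<open>f = max (h - \<beta>) 0\<close> with \<open>\<beta> = h y - \<epsilon>\<close> is therefore harmonic along
the orbit and \<open>f y = \<epsilon>\<close>. But \<open>m\<close> expanding factors, which have probability \<open>q ^ m\<close>, raise \<open>h\<close> by more
than \<open>1\<close>, so \<open>f y \<ge> q ^ m > \<epsilon>\<close>.\<close>

lemma contracting_element:
  assumes h: "loglike C h" "avg h = h" and \<delta>: "0 < \<delta>"
    and exp: "0 < measure M {\<omega> \<in> space M. 1 + \<delta> \<le> iota_min (A \<omega>)}"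
  shows "\<exists>g\<in>semigroup_of supp. matnorm g < 1"
proof (rule ccontr)
  assume no: "\<not> (\<exists>g\<in>semigroup_of supp. matnorm g < 1)"
  let ?\<Gamma> = "semigroup_of supp"
  define q where "q = measure M {\<omega> \<in> space M. 1 + \<delta> \<le> iota_min (A \<omega>)}"
  have q: "0 < q" using exp by (simp add: q_def)
  have act: "g *v x \<in> punctured_orthant" if "g \<in> ?\<Gamma>" "x \<in> punctured_orthant" for g x
    using that semigroup_allowable by (intro allowable_mult_punctured) auto
  have lower: "h x - (2 * C + ln \<kappa>) \<le> h (g *v x)" if g: "g \<in> ?\<Gamma>" and x: "x \<in> punctured_orthant" for g x
  proof -
    have p: "0 < l1norm x" "0 < l1norm (g *v x)" using x act[OF g x] by auto
    have "1 * l1norm x \<le> matnorm g * l1norm x" using no g by (intro mult_right_mono) auto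
    also have "\<dots> \<le> \<kappa> * l1norm (g *v x)" using semigroup_matnorm_le[OF g] x by blast
    finally have "ln (l1norm x) \<le> ln (\<kappa> * l1norm (g *v x))" using p \<kappa>_gt_1 by (subst ln_le_cancel_iff) auto
    also have "\<dots> = ln \<kappa> + ln (l1norm (g *v x))" using p \<kappa>_gt_1 by (intro ln_mult_pos) auto
    finally show ?thesis using loglike_bound[OF h(1) x] loglike_bound[OF h(1) act[OF g x]] by linarith
  qed
  obtain m :: nat where m: "2 * C + 1 \<le> real m * ln (1 + \<delta>)"
  proof -
    have "0 < ln (1 + \<delta>)" using \<delta> by simp
    moreover obtain m where "(2 * C + 1) / ln (1 + \<delta>) < real m" using reals_Archimedean2 by blast
    ultimately show ?thesis using that[of m] by (simp add: divide_less_eq less_imp_le)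
  qed
  \<comment> \<open>The number \<open>m\<close> of expanding factors is chosen before \<open>\<epsilon>\<close>, so that \<open>\<epsilon>\<close> can be below their probability.\<close>
  define \<epsilon> where "\<epsilon> = q ^ m / 2"
  have \<epsilon>: "0 < \<epsilon>" "\<epsilon> < q ^ m" using q by (auto simp: \<epsilon>_def)
  \<comment> \<open>An orbit point \<open>y\<close> at which \<open>h\<close> is within \<open>\<epsilon>\<close> of the worst possible drop.\<close>
  define D where "D = {h (g *v x) - h x | g x. g \<in> ?\<Gamma> \<and> x \<in> punctured_orthant}"
  have bdd: "bdd_below D" unfolding bdd_below_def
    by (rule exI[of _ "- (2 * C + ln \<kappa>)"]) (use lower in \<open>force simp: D_def\<close>)
  have ne: "D \<noteq> {}"
  proof -
    obtain g where "g \<in> supp" using supp_nonempty by blast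
    then have "g \<in> ?\<Gamma>" by (rule semigroup_of.base)
    moreover have "unif_vec \<in> punctured_orthant" by simp
    ultimately show ?thesis unfolding D_def by blast
  qed
  have "Inf D < Inf D + \<epsilon>" using \<epsilon> by simp
  then obtain d where "d \<in> D" "d < Inf D + \<epsilon>" using cInf_lessD[OF ne] by blast
  then obtain g0 x0 where g0: "g0 \<in> ?\<Gamma>" "x0 \<in> punctured_orthant" "h (g0 *v x0) - h x0 < Inf D + \<epsilon>"
    unfolding D_def by blast
  define y where "y = g0 *v x0"
  define \<beta> where "\<beta> = h y - \<epsilon>"
  have y: "y \<in> punctured_orthant" unfolding y_def by (rule act[OF g0(1,2)])
  define Y where "Y = {z \<in> punctured_orthant. \<beta> \<le> h z \<and> (\<forall>g\<in>?\<Gamma>. \<beta> \<le> h (g *v z))}"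
  have yY: "y \<in> Y"
  proof -
    have "\<beta> \<le> h (g *v y)" if g: "g \<in> ?\<Gamma>" for g
    proof -
      have "h ((g ** g0) *v x0) - h x0 \<in> D"
        unfolding D_def using semigroup_of_mult[OF g g0(1)] g0(2) by blast
      from cInf_lower[OF this bdd] show ?thesis
        using g0(3) by (simp add: \<beta>_def y_def matrix_vector_mul_assoc)
    qed
    then show ?thesis using y \<epsilon> by (simp add: Y_def \<beta>_def)
  qed
  have Y_inv: "g *v z \<in> Y" if "g \<in> supp" "z \<in> Y" for g z
    using that semigroup_of.base[of g supp] semigroup_of.mult[of _ supp g] act[of g z]
    by (auto simp: Y_def matrix_vector_mul_assoc)
  define F where "F \<omega> x = A \<omega> *v x" for \<omega> x
  define f where "f z = ennreal (h z - \<beta>)" for z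
  have harm: "kstep F f z = f z" if z: "z \<in> Y" for z
  proof -
    have zp: "z \<in> punctured_orthant" using z by (simp add: Y_def)
    have int: "integrable M (\<lambda>\<omega>. h (A \<omega> *v z))" by (rule avg_integrable[OF h(1) zp])
    have nn: "AE \<omega> in M. 0 \<le> h (A \<omega> *v z) - \<beta>"
      using AE_supp by eventually_elim (use Y_inv[OF _ z] in \<open>simp add: Y_def\<close>)
    have "kstep F f z = ennreal (\<integral>\<omega>. h (A \<omega> *v z) - \<beta> \<partial>M)"
      unfolding kstep_def F_def f_def using int nn by (intro nn_integral_eq_integral) auto
    also have "(\<integral>\<omega>. h (A \<omega> *v z) - \<beta> \<partial>M) = avg h z - \<beta>"
      using int zp by (simp add: avg_def prob_space)
    finally show ?thesis using h(2) by (simp add: f_def[of z])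
  qed
  have iter: "(kstep F ^^ k) f z = f z" if "z \<in> Y" for k z
    using that
  proof (induction k arbitrary: z)
    case (Suc k)
    have "kstep F ((kstep F ^^ k) f) z = kstep F f z"
      unfolding kstep_def[of F "(kstep F ^^ k) f"] kstep_def[of F f]
    proof (rule nn_integral_cong_AE)
      show "AE \<omega> in M. (kstep F ^^ k) f (F \<omega> z) = f (F \<omega> z)"
        using AE_supp by eventually_elim (use Suc Y_inv in \<open>simp add: F_def[of _ z]\<close>)
    qed
    then show ?case using harm[OF Suc.prems] by simp
  qed simp
  have mono: "(kstep F ^^ k) u z \<le> (kstep F ^^ k) v z" if "\<And>z. u z \<le> v z" for k u v z
  proof (induction k arbitrary: z)
    case (Suc k) then show ?case by (simp add: kstep_def nn_integral_mono)
  qed (use that in simp)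
  let ?I = "{z \<in> punctured_orthant. (1 + \<delta>) ^ m * l1norm y \<le> l1norm z}"
  have If: "indicator ?I z \<le> f z" for z
  proof (cases "z \<in> ?I")
    case True
    then have z: "z \<in> punctured_orthant" by simp
    have yp: "0 < l1norm y" using y by simp
    have "ln ((1 + \<delta>) ^ m * l1norm y) \<le> ln (l1norm z)"
      using True yp \<delta> z by (subst ln_le_cancel_iff) auto
    moreover have "ln ((1 + \<delta>) ^ m * l1norm y) = real m * ln (1 + \<delta>) + ln (l1norm y)"
      using yp \<delta> by (simp add: ln_mult ln_realpow)
    ultimately have "1 \<le> h z - \<beta>"
      using loglike_bound[OF h(1) z] loglike_bound[OF h(1) y] m \<epsilon> unfolding \<beta>_def by linarith
    then show ?thesis using True by (simp add: f_def)
  qed simp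
  have "ennreal (q ^ m) \<le> (kstep F ^^ m) (indicator ?I) y"
    unfolding q_def
  proof (rule kstep_expanding[OF _ \<delta> y order_refl])
    fix \<omega> and x :: "real^'n"
    assume "\<omega> \<in> space M" "x \<in> punctured_orthant" "1 + \<delta> \<le> iota_min (A \<omega>)"
    moreover from this have "(1 + \<delta>) * l1norm x \<le> iota_min (A \<omega>) * l1norm x"
      by (intro mult_right_mono) auto
    ultimately show "F \<omega> x \<in> punctured_orthant \<and> (1 + \<delta>) * l1norm x \<le> l1norm (F \<omega> x)"
      using A_punctured l1norm_mult_ge[OF A_allowable, of \<omega> x] unfolding F_def by (meson Diff_iff order_trans)
  qed
  also have "\<dots> \<le> (kstep F ^^ m) f y" by (rule mono[OF If])
  also have "\<dots> = ennreal \<epsilon>" using iter[OF yY] by (simp add: f_def \<beta>_def)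
  finally show False using \<epsilon> by (simp add: ennreal_le_iff)
qed

definition astep :: "(real^'n \<Rightarrow> ennreal) \<Rightarrow> real^'n \<Rightarrow> ennreal" where
  "astep = kstep (\<lambda>\<omega> x. A \<omega> *v x + B \<omega>)"

lemma astep_eq: "astep f x = (\<integral>\<^sup>+\<omega>. f (A \<omega> *v x + B \<omega>) \<partial>M)"
  by (simp add: astep_def kstep_def)

lemma affine_orthant: "\<omega> \<in> space M \<Longrightarrow> x \<in> nonneg_orthant \<Longrightarrow> A \<omega> *v x + B \<omega> \<in> nonneg_orthant"
  using allowable_mult_orthant[OF A_allowable] B_orthant by blast

lemma astep_mono:
  "(\<And>z. z \<in> nonneg_orthant \<Longrightarrow> f z \<le> g z) \<Longrightarrow> x \<in> nonneg_orthant \<Longrightarrow> astep f x \<le> astep g x"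
  unfolding astep_eq using affine_orthant by (intro nn_integral_mono) auto

lemma astep_iterate_mono:
  "(\<And>z. z \<in> nonneg_orthant \<Longrightarrow> f z \<le> g z) \<Longrightarrow> x \<in> nonneg_orthant \<Longrightarrow> (astep ^^ m) f x \<le> (astep ^^ m) g x"
  by (induction m arbitrary: x) (auto intro: astep_mono)

lemma astep_measurable [measurable]:
  assumes "f \<in> borel_measurable borel"
  shows "astep f \<in> borel_measurable borel"
proof -
  note [measurable] = assms
  show ?thesis unfolding astep_eq[abs_def]
    by (rule borel_measurable_nn_integral) measurable
qed

lemma astep_iterate_measurable:
  "f \<in> borel_measurable borel \<Longrightarrow> (astep ^^ m) f \<in> borel_measurable borel"
  by (induction m) (auto intro: astep_measurable)

text \<open>The first step contributes \<open>B\<close>, which is bounded away from \<open>0\<close> with positive probability; the following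
steps multiply by at least \<open>1 + \<delta>\<close>. The bound is uniform in the starting point, the origin included.\<close>

lemma escape_probability:
  assumes \<delta>: "0 < \<delta>" and exp: "0 < measure M {\<omega> \<in> space M. 1 + \<delta> \<le> iota_min (A \<omega>)}"
    and B0: "0 < measure M {\<omega> \<in> space M. B \<omega> \<noteq> 0}"
  obtains m p where "0 < p"
    "\<And>x. x \<in> nonneg_orthant \<Longrightarrow> ennreal p \<le> (astep ^^ m) (indicator {z \<in> nonneg_orthant. R \<le> l1norm z}) x"
proof -
  let ?E = "\<lambda>k :: nat. {\<omega> \<in> space M. 1 / real (Suc k) \<le> l1norm (B \<omega>)}"
  have "\<exists>k. 0 < measure M (?E k)"
  proof (rule ccontr)
    assume "\<not> (\<exists>k. 0 < measure M (?E k))"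
    then have "measure M (?E k) = 0" for k using measure_nonneg[of M "?E k"] by (simp add: order.strict_iff_order)
    then have "?E k \<in> null_sets M" for k by (simp add: null_sets_def emeasure_eq_measure)
    then have "(\<Union>k. ?E k) \<in> null_sets M" by (intro null_sets_UN) auto
    moreover have "{\<omega> \<in> space M. B \<omega> \<noteq> 0} \<subseteq> (\<Union>k. ?E k)"
    proof
      fix \<omega> assume \<omega>: "\<omega> \<in> {\<omega> \<in> space M. B \<omega> \<noteq> 0}"
      then have "0 < l1norm (B \<omega>)" by simp
      from reals_Archimedean[OF this] obtain k where "inverse (real (Suc k)) < l1norm (B \<omega>)" by blast
      then show "\<omega> \<in> (\<Union>k. ?E k)" using \<omega> by (auto simp: inverse_eq_divide intro!: exI[of _ k])
    qed
    moreover have "{\<omega> \<in> space M. B \<omega> \<noteq> 0} \<in> sets M" by measurable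
    ultimately have "{\<omega> \<in> space M. B \<omega> \<noteq> 0} \<in> null_sets M" by (metis (no_types, lifting) null_sets_subset)
    then show False using B0 by (simp add: null_sets_def measure_def)
  qed
  then obtain k where k: "0 < measure M (?E k)" by blast
  let ?r = "1 / real (Suc k)"
  define q where "q = measure M {\<omega> \<in> space M. 1 + \<delta> \<le> iota_min (A \<omega>)}"
  obtain m where m: "R \<le> (1 + \<delta>) ^ m * ?r"
  proof -
    obtain m where "R / ?r < (1 + \<delta>) ^ m" using real_arch_pow[of "1 + \<delta>" "R / ?r"] \<delta> by auto
    then show ?thesis using that[of m] by (simp add: field_simps)
  qed
  have big: "ennreal (q ^ m) \<le> (astep ^^ m) (indicator {z \<in> nonneg_orthant. R \<le> l1norm z}) x"
    if x: "x \<in> punctured_orthant" "?r \<le> l1norm x" for x :: "real^'n"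
  proof -
    have "ennreal (q ^ m) \<le> (astep ^^ m) (indicator {z \<in> punctured_orthant. (1 + \<delta>) ^ m * ?r \<le> l1norm z}) x"
      unfolding q_def astep_def
    proof (rule kstep_expanding[OF _ \<delta> x])
      fix \<omega> and x :: "real^'n" assume *: "\<omega> \<in> space M" "x \<in> punctured_orthant" "1 + \<delta> \<le> iota_min (A \<omega>)"
      have "(1 + \<delta>) * l1norm x \<le> iota_min (A \<omega>) * l1norm x" using * by (intro mult_right_mono) auto
      also have "\<dots> \<le> l1norm (A \<omega> *v x)" using * l1norm_mult_ge[OF A_allowable] by blast
      also have "\<dots> \<le> l1norm (A \<omega> *v x + B \<omega>)"
        using A_punctured[OF *(1,2)] B_orthant[OF *(1)] by (intro l1norm_le_add) auto
      finally show "A \<omega> *v x + B \<omega> \<in> punctured_orthant \<and> (1 + \<delta>) * l1norm x \<le> l1norm (A \<omega> *v x + B \<omega>)"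
        using punctured_orthant_add[OF A_punctured[OF *(1,2)] B_orthant[OF *(1)]] by blast
    qed
    also have "\<dots> \<le> (astep ^^ m) (indicator {z \<in> nonneg_orthant. R \<le> l1norm z}) x"
      using m x(1) by (intro astep_iterate_mono) (auto simp: indicator_def)
    finally show ?thesis .
  qed
  show ?thesis
  proof (rule that[of "q ^ m * measure M (?E k)" "Suc m"])
    show "0 < q ^ m * measure M (?E k)" using exp k by (simp add: q_def)
    fix x :: "real^'n" assume x: "x \<in> nonneg_orthant"
    let ?f = "(astep ^^ m) (indicator {z \<in> nonneg_orthant. R \<le> l1norm z})"
    have pw: "ennreal (q ^ m) * indicator (?E k) \<omega> \<le> ?f (A \<omega> *v x + B \<omega>)"
      if \<omega>: "\<omega> \<in> space M" for \<omega>
    proof (cases "\<omega> \<in> ?E k")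
        case True
        have "l1norm (B \<omega>) \<le> l1norm (A \<omega> *v x + B \<omega>)"
          using l1norm_le_add[OF B_orthant[OF \<omega>] allowable_mult_orthant[OF A_allowable[OF \<omega>] x]]
          by (simp add: add.commute)
        then have r: "?r \<le> l1norm (A \<omega> *v x + B \<omega>)" using True by simp
        moreover have "0 < ?r" by simp
        ultimately have "0 < l1norm (A \<omega> *v x + B \<omega>)" by linarith
        then have "A \<omega> *v x + B \<omega> \<in> punctured_orthant" using affine_orthant[OF \<omega> x] by simp
        from big[OF this r] show ?thesis using True by simp
    qed simp
    have "ennreal (q ^ m * measure M (?E k)) = (\<integral>\<^sup>+\<omega>. ennreal (q ^ m) * indicator (?E k) \<omega> \<partial>M)"
      by (simp add: nn_integral_cmult emeasure_eq_measure ennreal_mult'' q_def)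
    also have "\<dots> \<le> astep ?f x"
      unfolding astep_eq[of ?f x] using pw by (intro nn_integral_mono) auto
    finally show "ennreal (q ^ m * measure M (?E k)) \<le> (astep ^^ Suc m) (indicator {z \<in> nonneg_orthant. R \<le> l1norm z}) x"
      by simp
  qed
qed

text \<open>Starting near \<open>t x\<close>, the chain enters \<open>t V\<close> after a fixed number of steps with probability bounded below,
uniformly in large \<open>t\<close> and in a neighbourhood of \<open>x\<close>.\<close>

definition reaches :: "(real^'n) set \<Rightarrow> real^'n \<Rightarrow> bool" where
  "reaches V x \<longleftrightarrow> (\<exists>m U p t0. open U \<and> x \<in> U \<and> 0 < p \<and> (\<forall>t\<ge>t0. \<forall>y\<in>U \<inter> nonneg_orthant.
     ennreal p \<le> (astep ^^ m) (indicator {z. (1 / t) *\<^sub>R z \<in> V}) (t *\<^sub>R y)))"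

lemma reaches_base: "open V \<Longrightarrow> x \<in> V \<Longrightarrow> reaches V x"
  unfolding reaches_def
  by (rule exI[of _ 0], rule exI[of _ V], rule exI[of _ 1], rule exI[of _ 1]) (auto simp: indicator_def)

text \<open>After division by \<open>t\<close> one step of the chain is \<open>y \<mapsto> A y + B / t\<close>. With probability bounded below \<open>A\<close> is
close to \<open>g\<close> and \<open>B\<close> is bounded, so the image is close to \<open>g x\<close> once \<open>t\<close> is large.\<close>

lemma reaches_step:
  assumes g: "g \<in> supp" and r: "reaches V (g *v x)"
  shows "reaches V x"
proof -
  obtain m U p t0 where U: "open U" "g *v x \<in> U" "0 < p"
    and reach: "\<And>t y. t0 \<le> t \<Longrightarrow> y \<in> U \<Longrightarrow> y \<in> nonneg_orthant \<Longrightarrow>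
      ennreal p \<le> (astep ^^ m) (indicator {z. (1 / t) *\<^sub>R z \<in> V}) (t *\<^sub>R y)"
    using r unfolding reaches_def by blast
  let ?\<Phi> = "\<lambda>(a :: real^'n^'n, y :: real^'n, b :: real^'n). a *v y + b"
  have "continuous_on UNIV ?\<Phi>" unfolding case_prod_beta by (intro continuous_intros)
  then have "open (?\<Phi> -` U)" using U(1) by (rule open_vimage[rotated])
  moreover have "(g, x, 0) \<in> ?\<Phi> -` U" using U by simp
  ultimately obtain Ug W' where o1: "open Ug" "open W'" "(g, x, 0) \<in> Ug \<times> W'" "Ug \<times> W' \<subseteq> ?\<Phi> -` U"
    by (rule open_prod_elim)
  then have g_Ug: "g \<in> Ug" and x_W': "(x, 0) \<in> W'" by auto
  obtain Ux Ub where o2: "open Ux" "open Ub" "(x, 0) \<in> Ux \<times> Ub" "Ux \<times> Ub \<subseteq> W'"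
    using o1(2) x_W' by (rule open_prod_elim)
  then have x_Ux: "x \<in> Ux" and "0 \<in> Ub" by auto
  obtain \<eta> where \<eta>: "0 < \<eta>" "ball 0 \<eta> \<subseteq> Ub" using o2(2) \<open>0 \<in> Ub\<close> unfolding open_contains_ball by blast
  have in_U: "a *v y + b \<in> U" if "a \<in> Ug" "y \<in> Ux" "norm b < \<eta>" for a y b
  proof -
    have "b \<in> Ub" using that(3) \<eta>(2) by auto
    then have "(a, y, b) \<in> ?\<Phi> -` U" using that o1(4) o2(4) by blast
    then show ?thesis by simp
  qed
  let ?E = "\<lambda>k :: nat. {\<omega> \<in> space M. A \<omega> \<in> Ug \<and> norm (B \<omega>) \<le> real k}"
  have [measurable]: "Ug \<in> sets borel" using o1(1) by (rule borel_open)
  have "\<exists>k. 0 < measure M (?E k)"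
  proof (rule ccontr)
    assume "\<not> (\<exists>k. 0 < measure M (?E k))"
    then have "measure M (?E k) = 0" for k using measure_nonneg[of M "?E k"] by (simp add: order.strict_iff_order)
    then have "?E k \<in> null_sets M" for k by (simp add: null_sets_def emeasure_eq_measure)
    then have "(\<Union>k. ?E k) \<in> null_sets M" by (intro null_sets_UN) auto
    moreover have "(\<Union>k. ?E k) = {\<omega> \<in> space M. A \<omega> \<in> Ug}"
      by (auto simp: real_arch_simple)
    ultimately show False using supp_open_pos[OF g o1(1) g_Ug] by (simp add: null_sets_def measure_def)
  qed
  then obtain k where k: "0 < measure M (?E k)" by blast
  define t1 where "t1 = max t0 (real k / \<eta> + 1)"
  have "ennreal (p * measure M (?E k)) \<le> (astep ^^ Suc m) (indicator {z. (1 / t) *\<^sub>R z \<in> V}) (t *\<^sub>R y)"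
    if t: "t1 \<le> t" and y: "y \<in> Ux" "y \<in> nonneg_orthant" for t y
  proof -
    have t': "t0 \<le> t" "real k / \<eta> < t" using t by (auto simp: t1_def)
    have "0 \<le> real k / \<eta>" using \<eta> by simp
    then have tp: "0 < t" using t' by linarith
    let ?f = "(astep ^^ m) (indicator {z. (1 / t) *\<^sub>R z \<in> V})"
    have pw: "ennreal p * indicator (?E k) \<omega> \<le> ?f (A \<omega> *v (t *\<^sub>R y) + B \<omega>)"
      if \<omega>: "\<omega> \<in> space M" for \<omega>
    proof (cases "\<omega> \<in> ?E k")
        case True
        let ?y = "A \<omega> *v y + (1 / t) *\<^sub>R B \<omega>"
        have "norm ((1 / t) *\<^sub>R B \<omega>) \<le> real k / t" using True tp by (simp add: field_simps)
        also have "\<dots> < \<eta>" using t'(2) tp \<eta> by (simp add: field_simps)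
        finally have "?y \<in> U" using in_U True y by blast
        moreover have "?y \<in> nonneg_orthant"
          using allowable_mult_orthant[OF A_allowable[OF \<omega>] y(2)] B_orthant[OF \<omega>] tp
          by (intro orthant_add orthant_scaleR) auto
        ultimately have "ennreal p \<le> ?f (t *\<^sub>R ?y)" using reach t'(1) by blast
        moreover have "t *\<^sub>R ?y = A \<omega> *v (t *\<^sub>R y) + B \<omega>"
          using tp by (simp add: scaleR_add_right matrix_vector_mult_scaleR)
        ultimately show ?thesis using True by simp
    qed simp
    have "ennreal (p * measure M (?E k)) = (\<integral>\<^sup>+\<omega>. ennreal p * indicator (?E k) \<omega> \<partial>M)"
      using U(3) by (simp add: nn_integral_cmult emeasure_eq_measure ennreal_mult'')
    also have "\<dots> \<le> astep ?f (t *\<^sub>R y)"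
      unfolding astep_eq[of ?f] using pw by (intro nn_integral_mono) auto
    finally show ?thesis by simp
  qed
  then show ?thesis unfolding reaches_def using o2(1) x_Ux U(3) k
    by (intro exI[of _ "Suc m"] exI[of _ Ux] exI[of _ "p * measure M (?E k)"] exI[of _ t1])
      (auto simp del: funpow.simps)
qed

lemma reaches_semigroup:
  assumes g: "g \<in> semigroup_of supp" and V: "open V" "g *v x \<in> V"
  shows "reaches V x"
  using g V(2)
proof (induction arbitrary: x)
  case (base g)
  then show ?case using reaches_step reaches_base[OF V(1)] by blast
next
  case (mult h g)
  then have "reaches V (g *v x)" by (simp add: matrix_vector_mul_assoc)
  then show ?case using reaches_step mult by blast
qed

text \<open>A finite subcover of \<open>K\<close> by the neighbourhoods from \<open>reaches\<close>.\<close>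

lemma reaches_uniformly:
  assumes K: "compact K" and V: "open V"
    and orbit: "\<And>x. x \<in> K \<Longrightarrow> \<exists>g\<in>semigroup_of supp. g *v x \<in> V"
  obtains m p t0 where "0 < p" "0 < t0"
    "\<And>t y. t0 \<le> t \<Longrightarrow> y \<in> K \<Longrightarrow> y \<in> nonneg_orthant \<Longrightarrow>
      \<exists>k\<le>m. ennreal p \<le> (astep ^^ k) (indicator {z. (1 / t) *\<^sub>R z \<in> V}) (t *\<^sub>R y)"
proof -
  define Q where "Q x w \<longleftrightarrow> (case w of (m, U, p, t0) \<Rightarrow> open U \<and> x \<in> U \<and> 0 < p \<and> (\<forall>t\<ge>t0. \<forall>y\<in>U \<inter> nonneg_orthant.
     ennreal p \<le> (astep ^^ m) (indicator {z. (1 / t) *\<^sub>R z \<in> V}) (t *\<^sub>R y)))"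
    for x and w :: "nat \<times> (real^'n) set \<times> real \<times> real"
  have "\<exists>w. Q x w" if xK: "x \<in> K" for x
  proof -
    obtain g where "g \<in> semigroup_of supp" "g *v x \<in> V" using orbit[OF xK] by blast
    then have "reaches V x" by (intro reaches_semigroup V)
    then show ?thesis unfolding reaches_def Q_def by (auto simp: split_paired_Ex)
  qed
  then have "\<forall>x\<in>K. \<exists>w. Q x w" by blast
  from bchoice[OF this] obtain w where w: "\<And>x. x \<in> K \<Longrightarrow> Q x (w x)" by blast
  define m U p t0 where "m x = fst (w x)" and "U x = fst (snd (w x))"
    and "p x = fst (snd (snd (w x)))" and "t0 x = snd (snd (snd (w x)))" for x
  have ch: "\<And>x. x \<in> K \<Longrightarrow> open (U x)" "\<And>x. x \<in> K \<Longrightarrow> x \<in> U x"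
      "\<And>x. x \<in> K \<Longrightarrow> 0 < p x" "\<And>x t y. x \<in> K \<Longrightarrow> t0 x \<le> t \<Longrightarrow> y \<in> U x \<Longrightarrow> y \<in> nonneg_orthant \<Longrightarrow>
     ennreal (p x) \<le> (astep ^^ m x) (indicator {z. (1 / t) *\<^sub>R z \<in> V}) (t *\<^sub>R y)"
    using w by (auto simp: Q_def m_def U_def p_def t0_def case_prod_beta)
  obtain D where D: "D \<subseteq> K" "finite D" "K \<subseteq> (\<Union>x\<in>D. U x)"
    using compactE_image[OF K, of K U] ch(1,2) by blast
  show ?thesis
  proof (rule that[of "Min (insert 1 (p ` D))" "Max (insert 1 (t0 ` D))" "Max (insert 0 (m ` D))"])
    show "0 < Min (insert 1 (p ` D))" using D ch(3) by (subst Min_gr_iff) auto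
    have "1 \<le> Max (insert 1 (t0 ` D))" using D by (intro Max_ge) auto
    then show "0 < Max (insert 1 (t0 ` D))" by linarith
    fix t y assume t: "Max (insert 1 (t0 ` D)) \<le> t" and y: "y \<in> K" "y \<in> nonneg_orthant"
    obtain x where x: "x \<in> D" "y \<in> U x" using D y by blast
    have "t0 x \<le> t" using t D x by auto
    moreover have "ennreal (Min (insert 1 (p ` D))) \<le> ennreal (p x)"
      using D x by (intro ennreal_leI Min_le) auto
    moreover have "m x \<le> Max (insert 0 (m ` D))" using D x by (intro Max_ge) auto
    ultimately show "\<exists>k\<le>Max (insert 0 (m ` D)). ennreal (Min (insert 1 (p ` D)))
        \<le> (astep ^^ k) (indicator {z. (1 / t) *\<^sub>R z \<in> V}) (t *\<^sub>R y)"
      using ch(4)[of x t y] x D y by (meson order_trans subsetD)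
  qed
qed

end

section \<open>Invariance and the drift of the logarithm\<close>

locale affine_invariant = affine_pair M A B \<kappa> \<gamma>
  for M :: "'w measure" and A :: "'w \<Rightarrow> real^'n^'n" and B :: "'w \<Rightarrow> real^'n" and \<kappa> \<gamma> +
  fixes \<nu> :: "(real^'n) measure"
  assumes radon: "radon_on_orthant \<nu>" and inv: "invariant_measure M A B \<nu>"
begin

lemma sets_\<nu>: "sets \<nu> = sets (restrict_space borel nonneg_orthant)"
  using radon by (simp add: radon_on_orthant_def)

lemma space_\<nu>: "space \<nu> = nonneg_orthant"
  using sets_eq_imp_space_eq[OF sets_\<nu>] by (simp add: space_restrict_space)

lemma borel_imp_measurable_\<nu>: "f \<in> borel_measurable borel \<Longrightarrow> f \<in> borel_measurable \<nu>"
  using measurable_restrict_space1[of f borel _ nonneg_orthant] measurable_cong_sets[OF sets_\<nu> refl] by blast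

lemma set_in_\<nu>:
  assumes "{x. P x} \<in> sets borel"
  shows "{x \<in> nonneg_orthant. P x} \<in> sets \<nu>"
proof -
  have "{x \<in> nonneg_orthant. P x} = nonneg_orthant \<inter> {x. P x}" by auto
  then show ?thesis using assms by (auto simp: sets_\<nu> sets_restrict_space)
qed

lemma ball_finite: "emeasure \<nu> {x \<in> nonneg_orthant. l1norm x \<le> r} < \<infinity>"
  using radon compact_orthant_ball[of r] unfolding radon_on_orthant_def by blast

lemma ball_in_\<nu>: "{x \<in> nonneg_orthant. l1norm x \<le> r} \<in> sets \<nu>"
  by (rule set_in_\<nu>) measurable

lemma sigma_finite_\<nu>: "sigma_finite_measure \<nu>"
proof
  let ?A = "range (\<lambda>n :: nat. {x \<in> nonneg_orthant. l1norm (x :: real^'n) \<le> real n})"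
  have "\<Union>?A = space \<nu>" by (auto simp: space_\<nu> real_arch_simple)
  then show "\<exists>A. countable A \<and> A \<subseteq> sets \<nu> \<and> \<Union>A = space \<nu> \<and> (\<forall>a\<in>A. emeasure \<nu> a \<noteq> \<infinity>)"
    using ball_in_\<nu> ball_finite by (intro exI[of _ ?A]) (auto simp: less_top)
qed

lemma invariance_bounded:
  assumes f [measurable]: "f \<in> borel_measurable borel" and b: "\<And>x. 0 \<le> f x" "\<And>x. f x \<le> c"
    and out: "\<And>x. r < l1norm x \<Longrightarrow> f x = 0"
  shows "(\<integral>\<^sup>+x. astep (\<lambda>z. ennreal (f z)) x \<partial>\<nu>) = (\<integral>\<^sup>+x. ennreal (f x) \<partial>\<nu>)"
proof -
  interpret N: sigma_finite_measure \<nu> by (rule sigma_finite_\<nu>)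
  interpret P: pair_sigma_finite M \<nu> ..
  let ?K = "{x \<in> nonneg_orthant. l1norm (x :: real^'n) \<le> r}"
  have fm: "f \<in> borel_measurable \<nu>" by (rule borel_imp_measurable_\<nu>[OF f])
  have "bounded (f ` nonneg_orthant)" unfolding bounded_iff
    using b by (intro exI[of _ c]) auto
  moreover have "\<exists>K. compact K \<and> K \<subseteq> nonneg_orthant \<and> (\<forall>x\<in>nonneg_orthant - K. f x = 0)"
  proof (intro exI[of _ ?K] conjI ballI)
    fix x assume "x \<in> nonneg_orthant - ?K"
    then show "f x = 0" using out[of x] by (cases "l1norm x \<le> r") auto
  qed (use compact_orthant_ball[of r] in auto)
  ultimately have i1: "AE \<omega> in M. integrable \<nu> (\<lambda>x. f (A \<omega> *v x + B \<omega>))"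
    and i2: "integrable M (\<lambda>\<omega>. \<integral>x. f (A \<omega> *v x + B \<omega>) \<partial>\<nu>)"
    and eq: "(\<integral>x. f x \<partial>\<nu>) = (\<integral>\<omega>. (\<integral>x. f (A \<omega> *v x + B \<omega>) \<partial>\<nu>) \<partial>M)"
    using inv fm unfolding invariant_measure_def by blast+
  have int: "integrable \<nu> f"
  proof (rule Bochner_Integration.integrable_bound[where f = "\<lambda>x. c * indicator ?K x"])
    show "integrable \<nu> (\<lambda>x. c * indicator ?K x)"
      using ball_in_\<nu>[of r] ball_finite[of r] by simp
    show "AE x in \<nu>. norm (f x) \<le> norm (c * indicator ?K x)"
    proof (rule AE_I2)
      fix x assume "x \<in> space \<nu>"
      then show "norm (f x) \<le> norm (c * indicator ?K x)"
        using b[of x] out[of x] by (cases "l1norm x \<le> r") (auto simp: space_\<nu> indicator_def)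
    qed
  qed (rule fm)
  have id: "(\<lambda>x. x) \<in> measurable \<nu> borel" by (rule borel_imp_measurable_\<nu>) simp
  have [measurable]: "(\<lambda>p. snd p) \<in> measurable (M \<Otimes>\<^sub>M \<nu>) borel"
    by (rule measurable_compose[OF measurable_snd id])
  have pm: "(\<lambda>(\<omega>, x). ennreal (f (A \<omega> *v x + B \<omega>))) \<in> borel_measurable (M \<Otimes>\<^sub>M \<nu>)"
    unfolding case_prod_beta by measurable
  have "(\<integral>\<^sup>+x. astep (\<lambda>z. ennreal (f z)) x \<partial>\<nu>) = (\<integral>\<^sup>+\<omega>. (\<integral>\<^sup>+x. ennreal (f (A \<omega> *v x + B \<omega>)) \<partial>\<nu>) \<partial>M)"
    unfolding astep_eq using P.Fubini'[OF pm] by simp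
  also have "\<dots> = (\<integral>\<^sup>+\<omega>. ennreal (\<integral>x. f (A \<omega> *v x + B \<omega>) \<partial>\<nu>) \<partial>M)"
    by (rule nn_integral_cong_AE)
      (use i1 b in \<open>auto intro: nn_integral_eq_integral elim!: eventually_mono\<close>)
  also have "\<dots> = ennreal (\<integral>\<omega>. (\<integral>x. f (A \<omega> *v x + B \<omega>) \<partial>\<nu>) \<partial>M)"
    using b by (intro nn_integral_eq_integral i2 AE_I2 integral_nonneg_AE) auto
  also have "\<dots> = (\<integral>\<^sup>+x. ennreal (f x) \<partial>\<nu>)"
    unfolding eq[symmetric] using b by (intro nn_integral_eq_integral[symmetric] int AE_I2)
  finally show ?thesis .
qed

text \<open>Monotone approximation by bounded functions of bounded support, the class for which invariance is
defined.\<close>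

lemma invariance:
  assumes f [measurable]: "f \<in> borel_measurable borel"
  shows "(\<integral>\<^sup>+x. astep f x \<partial>\<nu>) = (\<integral>\<^sup>+x. f x \<partial>\<nu>)"
proof -
  define g where "g n x = enn2real (min (f x) (of_nat n)) * indicator {z. l1norm z \<le> real n} x" for n :: nat and x
  define G where "G n x = ennreal (g n x)" for n x
  have [measurable]: "g n \<in> borel_measurable borel" for n unfolding g_def by measurable
  have [measurable]: "G n \<in> borel_measurable borel" for n unfolding G_def by measurable
  have G: "G n x = min (f x) (of_nat n) * indicator {z. l1norm z \<le> real n} x" for n x
  proof -
    have "min (f x) (of_nat n) < \<top>" by (simp add: min_less_iff_disj of_nat_less_top)
    then show ?thesis by (auto simp: G_def g_def ennreal_mult indicator_def)
  qed
  have inc: "G n x \<le> G (Suc n) x" for n x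
  proof -
    have "min (f x) (of_nat n) \<le> min (f x) (of_nat (Suc n))"
      by (intro min.mono order_refl of_nat_mono) simp
    then show ?thesis unfolding G by (intro mult_mono) (auto simp: indicator_def)
  qed
  then have incs: "incseq G" by (intro incseq_SucI le_funI)
  have sup: "(SUP n. G n x) = f x" for x
  proof (rule antisym)
    show "(SUP n. G n x) \<le> f x" by (intro SUP_least) (auto simp: G indicator_def)
    show "f x \<le> (SUP n. G n x)"
    proof -
      obtain k :: nat where k: "l1norm x \<le> real k" using real_arch_simple by blast
      have "(SUP n. min (f x) (of_nat n)) \<le> (SUP n. G n x)"
      proof (rule SUP_mono)
        fix n
        have "(of_nat n :: ennreal) \<le> of_nat (max n k)" by (rule of_nat_mono) simp
        then have "min (f x) (of_nat n) \<le> G (max n k) x"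
          using k by (auto simp: G intro!: min.coboundedI2)
        then show "\<exists>m\<in>UNIV. min (f x) (of_nat n) \<le> G m x" by blast
      qed
      moreover have "(SUP n. min (f x) (of_nat n)) = f x"
      proof -
        have "(SUP n. inf (f x) (of_nat n)) = inf (f x) (SUP n. of_nat n)" by (rule inf_SUP[symmetric])
        then show ?thesis by (simp add: ennreal_SUP_of_nat_eq_top inf_min)
      qed
      ultimately show ?thesis by simp
    qed
  qed
  have stepsup: "astep f x = (SUP n. astep (G n) x)" for x
  proof -
    have "astep f x = (\<integral>\<^sup>+\<omega>. (SUP n. G n (A \<omega> *v x + B \<omega>)) \<partial>M)"
      unfolding astep_eq sup ..
    also have "\<dots> = (SUP n. \<integral>\<^sup>+\<omega>. G n (A \<omega> *v x + B \<omega>) \<partial>M)"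
      by (rule nn_integral_monotone_convergence_SUP) (auto intro!: incseq_SucI le_funI inc)
    finally show ?thesis by (simp add: astep_eq)
  qed
  have "(\<integral>\<^sup>+x. astep f x \<partial>\<nu>) = (SUP n. \<integral>\<^sup>+x. astep (G n) x \<partial>\<nu>)"
    unfolding stepsup
  proof (rule nn_integral_monotone_convergence_SUP)
    show "incseq (\<lambda>n. astep (G n))"
      unfolding astep_eq[abs_def] by (intro incseq_SucI le_funI nn_integral_mono inc)
  qed (auto intro!: borel_imp_measurable_\<nu> astep_measurable)
  also have "\<dots> = (SUP n. \<integral>\<^sup>+x. G n x \<partial>\<nu>)"
  proof (rule SUP_cong[OF refl])
    fix n :: nat
    show "(\<integral>\<^sup>+x. astep (G n) x \<partial>\<nu>) = (\<integral>\<^sup>+x. G n x \<partial>\<nu>)"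
      unfolding G_def[abs_def]
    proof (rule invariance_bounded[where r = "real n" and c = "real n"])
      show "g n x \<le> real n" for x
      proof -
        have "enn2real (min (f x) (of_nat n)) \<le> enn2real (of_nat n)"
          by (rule enn2real_mono) (auto simp: of_nat_less_top)
        then show ?thesis by (auto simp: g_def indicator_def)
      qed
    qed (auto simp: g_def)
  qed
  also have "\<dots> = (\<integral>\<^sup>+x. (SUP n. G n x) \<partial>\<nu>)"
    by (rule nn_integral_monotone_convergence_SUP[symmetric, OF incs])
      (auto intro!: borel_imp_measurable_\<nu>)
  finally show ?thesis by (simp add: sup)
qed

lemma invariance_iterate:
  "f \<in> borel_measurable borel \<Longrightarrow> (\<integral>\<^sup>+x. (astep ^^ m) f x \<partial>\<nu>) = (\<integral>\<^sup>+x. f x \<partial>\<nu>)"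
  by (induction m) (auto simp: invariance astep_iterate_measurable)

end

lemma ln_one_plus_le_powr:
  fixes u \<gamma> :: real
  assumes u: "0 \<le> u" and \<gamma>: "0 < \<gamma>" "\<gamma> \<le> 1"
  shows "ln (1 + u) \<le> u powr \<gamma> / \<gamma>"
proof (cases "u \<le> 1")
  case True
  have "ln (1 + u) \<le> u" using u by (rule ln_add_one_self_le_self)
  also have "u \<le> u powr \<gamma>" using powr_mono'[of \<gamma> 1 u] u True \<gamma> by (cases "u = 0") auto
  also have "\<dots> \<le> u powr \<gamma> / \<gamma>"
    using \<gamma> mult_right_mono[of \<gamma> 1 "u powr \<gamma>"] by (simp add: field_simps)
  finally show ?thesis .
next
  case False
  have "ln (1 + u) \<le> ln (2 * u)" using False by simp
  also have "\<dots> = ln 2 + ln u" using False by (intro ln_mult_pos) auto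
  finally have 1: "ln (1 + u) \<le> ln 2 + ln u" .
  have 2: "\<gamma> * ln u \<le> u powr \<gamma> - 1" using ln_le_minus_one[of "u powr \<gamma>"] False by (simp add: ln_powr)
  have 3: "\<gamma> * ln 2 \<le> 1"
  proof -
    have "ln 2 \<le> (1::real)" using ln_le_minus_one[of "2::real"] by simp
    then have "\<gamma> * ln 2 \<le> 1 * 1" using \<gamma> by (intro mult_mono) auto
    then show ?thesis by simp
  qed
  have "\<gamma> * ln (1 + u) \<le> \<gamma> * (ln 2 + ln u)" using 1 \<gamma> by simp
  then have "\<gamma> * ln (1 + u) \<le> u powr \<gamma>" using 2 3 by (simp add: algebra_simps)
  then show ?thesis using \<gamma> by (simp add: field_simps)
qed

lemma (in affine_pair) le_exp_div: "x \<le> exp (\<gamma> * x) / \<gamma>"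
proof -
  have "\<gamma> * x \<le> exp (\<gamma> * x)" using exp_ge_add_one_self[of "\<gamma> * x"] by linarith
  then show ?thesis using \<gamma>_pos by (simp add: field_simps)
qed

text \<open>A harmonic function close to \<open>ln \<bar>x\<bar>\<close> is fixed; \<open>H\<close> is its positive part.\<close>

locale log_harmonic = affine_pair M A B \<kappa> \<gamma>
  for M :: "'w measure" and A :: "'w \<Rightarrow> real^'n^'n" and B :: "'w \<Rightarrow> real^'n" and \<kappa> \<gamma> +
  fixes h :: "real^'n \<Rightarrow> real" and C :: real
  assumes h_loglike: "loglike C h" and h_harmonic: "avg h = h"
begin

definition H :: "real^'n \<Rightarrow> real" where "H x = max (h x) 0"

abbreviation X :: "'w \<Rightarrow> real^'n \<Rightarrow> real^'n" where "X \<omega> x \<equiv> A \<omega> *v x + B \<omega>"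

lemma h_measurable [measurable]: "h \<in> borel_measurable borel"
  by (rule loglike_measurable[OF h_loglike])

lemma H_measurable [measurable]: "H \<in> borel_measurable borel"
  unfolding H_def[abs_def] by measurable

lemma H_nonneg [simp]: "0 \<le> H x" by (simp add: H_def)

lemma H_zero [simp]: "H 0 = 0" using loglike_outside[OF h_loglike, of 0] by (simp add: H_def)

lemma C_nonneg: "0 \<le> C"
proof -
  have "unif_vec \<in> (punctured_orthant :: (real^'n) set)" by simp
  from loglike_bound[OF h_loglike this] show ?thesis by linarith
qed

lemma H_ge: "x \<in> punctured_orthant \<Longrightarrow> ln (l1norm x) - C \<le> H x"
  using loglike_bound[OF h_loglike, of x] unfolding H_def by linarith

lemma H_le: "x \<in> punctured_orthant \<Longrightarrow> H x \<le> C + max 0 (ln (l1norm x))"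
  using loglike_bound[OF h_loglike, of x] C_nonneg by (auto simp: H_def abs_le_iff)

lemma H_le_small: "x \<in> nonneg_orthant \<Longrightarrow> l1norm x \<le> 1 \<Longrightarrow> H x \<le> C"
  using H_le[of x] C_nonneg by (cases "x = 0") auto

lemma H_le_big: "x \<in> nonneg_orthant \<Longrightarrow> 1 \<le> l1norm x \<Longrightarrow> H x \<le> C + ln (l1norm x)"
  using H_le[of x] by (cases "x = 0") auto

lemma X_orthant: "\<omega> \<in> space M \<Longrightarrow> x \<in> nonneg_orthant \<Longrightarrow> X \<omega> x \<in> nonneg_orthant"
  by (rule affine_orthant)

lemma X_punctured: "\<omega> \<in> space M \<Longrightarrow> x \<in> punctured_orthant \<Longrightarrow> X \<omega> x \<in> punctured_orthant"
  by (intro punctured_orthant_add A_punctured B_orthant)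

lemma h_le_h_X:
  assumes \<omega>: "\<omega> \<in> space M" and x: "x \<in> punctured_orthant"
  shows "h (A \<omega> *v x) \<le> h (X \<omega> x)"
  using B_orthant[OF \<omega>] by (intro loglike_mono[OF h_loglike A_punctured[OF \<omega> x]]) (simp add: nonneg_orthant_def)

text \<open>As \<open>h\<close> is its own average, \<open>avg_perturb\<close> applies with \<open>b = B\<close>.\<close>

lemma h_X_le:
  assumes \<omega>: "\<omega> \<in> space M" and x: "x \<in> punctured_orthant"
  shows "h (X \<omega> x) \<le> h (A \<omega> *v x) + ln (1 + \<kappa> * l1norm (B \<omega>) / l1norm (A \<omega> *v x))"
  using avg_perturb[OF h_loglike A_punctured[OF \<omega> x] B_orthant[OF \<omega>]] unfolding h_harmonic .

text \<open>If \<open>\<bar>x\<bar> \<le> 1\<close>, then \<open>H x\<close> is bounded. Otherwise adding \<open>B\<close> cannot help, and \<open>A\<close> shrinks at most by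
\<open>N(A)\<close>.\<close>

lemma H_drop:
  assumes \<omega>: "\<omega> \<in> space M" and x: "x \<in> nonneg_orthant"
  shows "H x - H (X \<omega> x) \<le> 2 * C + ln (Nmax (A \<omega>))"
proof (cases "l1norm x \<le> 1")
  case True
  then show ?thesis
    using H_le_small[OF x] H_nonneg[of "X \<omega> x"] C_nonneg ln_ge_zero[OF N_ge_1[OF \<omega>]] by linarith
next
  case False
  then have xp: "x \<in> punctured_orthant" using x by auto
  have "0 < l1norm (A \<omega> *v x)" using A_punctured[OF \<omega> xp] by simp
  moreover have "l1norm (A \<omega> *v x) \<le> l1norm (X \<omega> x)"
    using A_punctured[OF \<omega> xp] B_orthant[OF \<omega>] by (intro l1norm_le_add) auto
  ultimately have "ln (l1norm (A \<omega> *v x)) \<le> ln (l1norm (X \<omega> x))" by (subst ln_le_cancel_iff) linarith+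
  moreover have "H x \<le> C + ln (l1norm x)" using H_le_big[OF x] False by simp
  ultimately show ?thesis
    using log_mult_bound[OF A_allowable[OF \<omega>] xp] H_ge[OF X_punctured[OF \<omega> xp]] by linarith
qed

text \<open>The factor lost when \<open>exp (\<gamma> H x)\<close> is compared with \<open>\<bar>x\<bar>\<^sup>\<gamma>\<close>.\<close>

definition cc :: real where "cc = exp (\<gamma> * C)"

lemma cc_ge_1: "1 \<le> cc"
  unfolding cc_def using C_nonneg \<gamma>_pos by simp

lemma exp_H_le:
  assumes z: "z \<in> nonneg_orthant"
  shows "exp (\<gamma> * H z) \<le> cc * (1 + l1norm z powr \<gamma>)"
proof (cases "l1norm z \<le> 1")
  case True
  then have "exp (\<gamma> * H z) \<le> cc" using H_le_small[OF z] \<gamma>_pos by (simp add: cc_def)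
  also have "\<dots> \<le> cc * (1 + l1norm z powr \<gamma>)" using cc_ge_1 by (simp add: algebra_simps)
  finally show ?thesis .
next
  case False
  then have "exp (\<gamma> * H z) \<le> exp (\<gamma> * (C + ln (l1norm z)))" using H_le_big[OF z] \<gamma>_pos by simp
  also have "\<dots> = cc * l1norm z powr \<gamma>"
    using False by (auto simp: cc_def powr_def exp_add algebra_simps)
  also have "\<dots> \<le> cc * (1 + l1norm z powr \<gamma>)" using cc_ge_1 by simp
  finally show ?thesis .
qed

lemma powr_le_exp_H:
  assumes z: "z \<in> nonneg_orthant"
  shows "l1norm z powr \<gamma> \<le> cc * exp (\<gamma> * H z)"
proof (cases "z = 0")
  case False
  then have zp: "z \<in> punctured_orthant" using z by simp
  have "\<gamma> * ln (l1norm z) \<le> \<gamma> * (C + H z)" using H_ge[OF zp] \<gamma>_pos by (intro mult_left_mono) auto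
  then have "exp (\<gamma> * ln (l1norm z)) \<le> exp (\<gamma> * (C + H z))" by simp
  then show ?thesis using False by (simp add: powr_def cc_def exp_add[symmetric] algebra_simps)
qed (use cc_ge_1 in simp)

definition G1 :: "'w \<Rightarrow> real" where
  "G1 \<omega> = cc * (1 + 2 * cc * Nmax (A \<omega>) powr \<gamma> + 2 * l1norm (B \<omega>) powr \<gamma>)"

lemma B_integrable: "integrable M (\<lambda>\<omega>. l1norm (B \<omega>) powr \<gamma>)"
proof (rule Bochner_Integration.integrable_bound[where f = "\<lambda>\<omega>. 1 + l1norm (B \<omega>) powr (2 * \<gamma>)"])
  show "AE \<omega> in M. norm (l1norm (B \<omega>) powr \<gamma>) \<le> norm (1 + l1norm (B \<omega>) powr (2 * \<gamma>))"
  proof (rule AE_I2)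
    fix \<omega>
    have "t \<le> 1 + t * t" for t :: real using sum_squares_ge_zero[of "t - 1" t] by (simp add: algebra_simps)
    from this[of "l1norm (B \<omega>) powr \<gamma>"]
    show "norm (l1norm (B \<omega>) powr \<gamma>) \<le> norm (1 + l1norm (B \<omega>) powr (2 * \<gamma>))"
      by (simp add: powr_add[symmetric])
  qed
qed (use B_integrable2 in auto)

lemma NB_integrable: "integrable M (\<lambda>\<omega>. l1norm (B \<omega>) powr \<gamma> * Nmax (A \<omega>) powr \<gamma>)"
proof (rule Bochner_Integration.integrable_bound[where
    f = "\<lambda>\<omega>. l1norm (B \<omega>) powr (2 * \<gamma>) + Nmax (A \<omega>) powr (2 * \<gamma>)"])
  show "AE \<omega> in M. norm (l1norm (B \<omega>) powr \<gamma> * Nmax (A \<omega>) powr \<gamma>)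
      \<le> norm (l1norm (B \<omega>) powr (2 * \<gamma>) + Nmax (A \<omega>) powr (2 * \<gamma>))"
  proof (rule AE_I2)
    fix \<omega>
    let ?s = "l1norm (B \<omega>) powr \<gamma>" and ?t = "Nmax (A \<omega>) powr \<gamma>"
    have "2 * (?s * ?t) \<le> ?s * ?s + ?t * ?t"
      using zero_le_square[of "?s - ?t"] by (simp add: algebra_simps)
    moreover have "0 \<le> ?s * ?t" by simp
    ultimately have "?s * ?t \<le> ?s * ?s + ?t * ?t" by linarith
    then show "norm (?s * ?t) \<le> norm (l1norm (B \<omega>) powr (2 * \<gamma>) + Nmax (A \<omega>) powr (2 * \<gamma>))"
      by (simp add: powr_add[symmetric])
  qed
qed (use B_integrable2 N_integrable2 in auto)

lemma G1_integrable: "integrable M G1"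
  unfolding G1_def using N_integrable B_integrable by auto

lemma exp_H_X_le:
  assumes \<omega>: "\<omega> \<in> space M" and x: "x \<in> nonneg_orthant"
  shows "exp (\<gamma> * H (X \<omega> x)) \<le> G1 \<omega> * exp (\<gamma> * H x)"
proof -
  let ?n = "Nmax (A \<omega>) powr \<gamma>" and ?b = "l1norm (B \<omega>) powr \<gamma>" and ?e = "exp (\<gamma> * H x)"
  have e: "1 \<le> ?e" using \<gamma>_pos by simp
  let ?m = "max (Nmax (A \<omega>) * l1norm x) (l1norm (B \<omega>))"
  have "l1norm (X \<omega> x) \<le> Nmax (A \<omega>) * l1norm x + l1norm (B \<omega>)"
    using l1norm_triangle[of "A \<omega> *v x" "B \<omega>"] l1norm_mult_le_Nmax[OF A_allowable[OF \<omega>] x] by linarith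
  also have "\<dots> \<le> 2 * ?m" by simp
  finally have "l1norm (X \<omega> x) powr \<gamma> \<le> (2 * ?m) powr \<gamma>" using \<gamma>_pos by (intro powr_mono2) auto
  also have "\<dots> = 2 powr \<gamma> * ?m powr \<gamma>" by (rule powr_mult)
  also have "\<dots> \<le> 2 * (?n * l1norm x powr \<gamma> + ?b)"
  proof (rule mult_mono)
    show "2 powr \<gamma> \<le> 2" using powr_mono[of \<gamma> 1 2] \<gamma>_le_1 by simp
    have "(Nmax (A \<omega>) * l1norm x) powr \<gamma> = ?n * l1norm x powr \<gamma>"
      by (rule powr_mult)
    then show "?m powr \<gamma> \<le> ?n * l1norm x powr \<gamma> + ?b" by (auto simp: max_def)
  qed auto
  finally have X: "l1norm (X \<omega> x) powr \<gamma> \<le> 2 * (?n * l1norm x powr \<gamma> + ?b)" .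
  have "exp (\<gamma> * H (X \<omega> x)) \<le> cc * (1 + l1norm (X \<omega> x) powr \<gamma>)" by (rule exp_H_le[OF X_orthant[OF \<omega> x]])
  also have "\<dots> \<le> cc * (1 + 2 * (?n * l1norm x powr \<gamma> + ?b))"
    using X cc_ge_1 by (intro mult_left_mono) auto
  also have "\<dots> \<le> cc * (1 * ?e + 2 * (?n * (cc * ?e) + ?b * ?e))"
  proof (intro mult_left_mono add_mono)
    show "1 \<le> 1 * ?e" "?b \<le> ?b * ?e" using e by (auto simp: mult_le_cancel_left1)
    show "l1norm x powr \<gamma> \<le> cc * ?e" by (rule powr_le_exp_H[OF x])
  qed (use cc_ge_1 in auto)
  also have "\<dots> = G1 \<omega> * ?e" by (simp add: G1_def algebra_simps)
  finally show ?thesis .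
qed

lemma exp_H_X_integrable:
  assumes x: "x \<in> nonneg_orthant"
  shows "integrable M (\<lambda>\<omega>. exp (\<gamma> * H (X \<omega> x)))"
    and "(\<integral>\<omega>. exp (\<gamma> * H (X \<omega> x)) \<partial>M) \<le> (\<integral>\<omega>. G1 \<omega> \<partial>M) * exp (\<gamma> * H x)"
proof -
  have i: "integrable M (\<lambda>\<omega>. G1 \<omega> * exp (\<gamma> * H x))" using G1_integrable by simp
  show 1: "integrable M (\<lambda>\<omega>. exp (\<gamma> * H (X \<omega> x)))"
  proof (rule Bochner_Integration.integrable_bound[OF i])
    show "AE \<omega> in M. norm (exp (\<gamma> * H (X \<omega> x))) \<le> norm (G1 \<omega> * exp (\<gamma> * H x))"
      using exp_H_X_le[OF _ x] by (intro AE_I2) (auto intro: order_trans[OF _ abs_ge_self])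
  qed measurable
  have "(\<integral>\<omega>. exp (\<gamma> * H (X \<omega> x)) \<partial>M) \<le> (\<integral>\<omega>. G1 \<omega> * exp (\<gamma> * H x) \<partial>M)"
    by (rule integral_mono[OF 1 i]) (rule exp_H_X_le[OF _ x])
  then show "(\<integral>\<omega>. exp (\<gamma> * H (X \<omega> x)) \<partial>M) \<le> (\<integral>\<omega>. G1 \<omega> \<partial>M) * exp (\<gamma> * H x)" by simp
qed

lemma H_X_integrable:
  assumes x: "x \<in> nonneg_orthant"
  shows "integrable M (\<lambda>\<omega>. H (X \<omega> x))"
proof (rule Bochner_Integration.integrable_bound[OF integrable_divide[OF exp_H_X_integrable(1)[OF x], of \<gamma>]])
  show "AE \<omega> in M. norm (H (X \<omega> x)) \<le> norm (exp (\<gamma> * H (X \<omega> x)) / \<gamma>)"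
    using le_exp_div \<gamma>_pos by (intro AE_I2) simp
qed measurable

text \<open>Adding \<open>B\<close> increases \<open>h\<close>, and \<open>H\<close> is a maximum of \<open>h\<close> and a constant.\<close>

lemma H_subharmonic:
  assumes x: "x \<in> nonneg_orthant"
  shows "H x \<le> (\<integral>\<omega>. H (X \<omega> x) \<partial>M)"
proof (cases "x = 0")
  case False
  then have xp: "x \<in> punctured_orthant" using x by simp
  have "h x = avg h x" by (simp add: h_harmonic)
  also have "\<dots> = (\<integral>\<omega>. h (A \<omega> *v x) \<partial>M)" using xp by (simp add: avg_def)
  also have "\<dots> \<le> (\<integral>\<omega>. H (X \<omega> x) \<partial>M)"
  proof (rule integral_mono[OF avg_integrable[OF h_loglike xp] H_X_integrable[OF x]])
    fix \<omega> assume "\<omega> \<in> space M"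
    from h_le_h_X[OF this xp] show "h (A \<omega> *v x) \<le> H (X \<omega> x)" by (simp add: H_def)
  qed
  finally have "h x \<le> (\<integral>\<omega>. H (X \<omega> x) \<partial>M)" .
  moreover have "0 \<le> (\<integral>\<omega>. H (X \<omega> x) \<partial>M)" by (intro integral_nonneg_AE) simp
  ultimately show ?thesis by (simp add: H_def[of x])
qed (simp add: integral_nonneg_AE)

definition G3 :: "'w \<Rightarrow> real" where
  "G3 \<omega> = (\<kappa> * l1norm (B \<omega>) powr \<gamma> + cc) * Nmax (A \<omega>) powr \<gamma> / \<gamma>"

lemma G3_integrable: "integrable M G3"
proof -
  have "integrable M (\<lambda>\<omega>. (\<kappa> * (l1norm (B \<omega>) powr \<gamma> * Nmax (A \<omega>) powr \<gamma>) + cc * Nmax (A \<omega>) powr \<gamma>) / \<gamma>)"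
    using N_integrable NB_integrable by auto
  then show ?thesis unfolding G3_def[abs_def] by (simp add: algebra_simps)
qed

text \<open>Two errors arise: the perturbation by \<open>B\<close>, and the truncation of \<open>h\<close> at \<open>0\<close>. Both are at most a constant
times \<open>\<bar>A x\<bar>\<^sup>-\<^sup>\<gamma>\<close>, by \<open>ln (1 + u) \<le> u\<^sup>\<gamma> / \<gamma>\<close> and \<open>- t \<le> exp (- \<gamma> t) / \<gamma>\<close>.\<close>

lemma H_X_le_far:
  assumes \<omega>: "\<omega> \<in> space M" and x: "x \<in> nonneg_orthant" "1 \<le> l1norm x"
  shows "H (X \<omega> x) \<le> h (A \<omega> *v x) + G3 \<omega> * (cc * exp (- \<gamma> * H x))"
proof -
  have xp: "x \<in> punctured_orthant" using x by auto
  let ?y = "A \<omega> *v x"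
  have yp: "?y \<in> punctured_orthant" by (rule A_punctured[OF \<omega> xp])
  have p: "0 < l1norm ?y" "0 < l1norm x" "0 < Nmax (A \<omega>)" using yp xp N_ge_1[OF \<omega>] by auto
  define s where "s = l1norm ?y powr - \<gamma>"
  have s0: "0 < s" using p by (simp add: s_def)
  have "l1norm x powr \<gamma> \<le> (Nmax (A \<omega>) * l1norm ?y) powr \<gamma>"
    using l1norm_le_Nmax_mult[OF A_allowable[OF \<omega>] x(1)] \<gamma>_pos p by (intro powr_mono2) auto
  also have "\<dots> = Nmax (A \<omega>) powr \<gamma> * l1norm ?y powr \<gamma>" by (rule powr_mult)
  finally have "s * l1norm x powr \<gamma> \<le> Nmax (A \<omega>) powr \<gamma>"
    using p by (simp add: s_def powr_minus field_simps)
  then have s1: "s \<le> Nmax (A \<omega>) powr \<gamma> * l1norm x powr - \<gamma>"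
    using p by (simp add: powr_minus field_simps)
  have "l1norm x powr - \<gamma> = exp (- \<gamma> * ln (l1norm x))" using p by (auto simp: powr_def)
  also have "\<dots> \<le> exp (\<gamma> * C + - \<gamma> * H x)"
  proof -
    have "\<gamma> * H x \<le> \<gamma> * (C + ln (l1norm x))" using H_le_big[OF x] \<gamma>_pos by simp
    then show ?thesis by (simp add: algebra_simps)
  qed
  also have "\<dots> = cc * exp (- \<gamma> * H x)" by (simp only: cc_def exp_add)
  finally have x1: "l1norm x powr - \<gamma> \<le> cc * exp (- \<gamma> * H x)" .
  have "s \<le> Nmax (A \<omega>) powr \<gamma> * (cc * exp (- \<gamma> * H x))"
    by (rule order_trans[OF s1 mult_left_mono[OF x1]]) simp
  then have main: "(\<kappa> * l1norm (B \<omega>) powr \<gamma> + cc) / \<gamma> * s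
      \<le> (\<kappa> * l1norm (B \<omega>) powr \<gamma> + cc) / \<gamma> * (Nmax (A \<omega>) powr \<gamma> * (cc * exp (- \<gamma> * H x)))"
    using \<kappa>_gt_1 cc_ge_1 \<gamma>_pos by (intro mult_left_mono) (auto intro!: divide_nonneg_pos add_nonneg_nonneg)
  have "H (X \<omega> x) \<le> h ?y + (\<kappa> * l1norm (B \<omega>) powr \<gamma> + cc) / \<gamma> * s"
  proof (cases "0 \<le> h (X \<omega> x)")
    case True
    let ?u = "\<kappa> * l1norm (B \<omega>) / l1norm ?y"
    have "ln (1 + ?u) \<le> ?u powr \<gamma> / \<gamma>"
      using \<kappa>_gt_1 \<gamma>_pos \<gamma>_le_1 by (intro ln_one_plus_le_powr) auto
    also have "?u powr \<gamma> = \<kappa> powr \<gamma> * l1norm (B \<omega>) powr \<gamma> * s"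
      using \<kappa>_gt_1 by (simp add: powr_divide powr_mult s_def powr_minus field_simps)
    also have "\<kappa> powr \<gamma> * l1norm (B \<omega>) powr \<gamma> * s \<le> (\<kappa> * l1norm (B \<omega>) powr \<gamma> + cc) * s"
    proof (rule mult_right_mono)
      have "\<kappa> powr \<gamma> \<le> \<kappa>" using powr_mono[of \<gamma> 1 \<kappa>] \<kappa>_gt_1 \<gamma>_le_1 by simp
      then have "\<kappa> powr \<gamma> * l1norm (B \<omega>) powr \<gamma> \<le> \<kappa> * l1norm (B \<omega>) powr \<gamma>"
        by (intro mult_right_mono) auto
      then show "\<kappa> powr \<gamma> * l1norm (B \<omega>) powr \<gamma> \<le> \<kappa> * l1norm (B \<omega>) powr \<gamma> + cc"
        using cc_ge_1 by linarith
    qed (use s0 in simp)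
    finally have "ln (1 + ?u) \<le> (\<kappa> * l1norm (B \<omega>) powr \<gamma> + cc) / \<gamma> * s"
      using \<gamma>_pos by (simp add: divide_right_mono)
    then show ?thesis using h_X_le[OF \<omega> xp] True by (simp add: H_def)
  next
    case False
    have "- h ?y \<le> exp (\<gamma> * (- h ?y)) / \<gamma>" by (rule le_exp_div)
    also have "\<dots> \<le> cc * s / \<gamma>"
    proof (rule divide_right_mono)
      have "\<gamma> * (- h ?y) \<le> \<gamma> * (C - ln (l1norm ?y))"
        using loglike_bound[OF h_loglike yp] \<gamma>_pos by (intro mult_left_mono) auto
      then have "exp (\<gamma> * (- h ?y)) \<le> exp (\<gamma> * (C - ln (l1norm ?y)))" by simp
      also have "\<dots> = cc * s" using p by (auto simp: cc_def s_def powr_def exp_add[symmetric] algebra_simps)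
      finally show "exp (\<gamma> * (- h ?y)) \<le> cc * s" .
    qed (use \<gamma>_pos in simp)
    also have "\<dots> \<le> (\<kappa> * l1norm (B \<omega>) powr \<gamma> + cc) / \<gamma> * s"
      using \<kappa>_gt_1 \<gamma>_pos s0 by (simp add: divide_right_mono field_simps)
    finally show ?thesis using False by (simp add: H_def)
  qed
  then show ?thesis using main by (simp add: G3_def)
qed

text \<open>For \<open>\<bar>x\<bar> \<ge> 1\<close> the average of the bound in \<open>H_X_le_far\<close>; for \<open>\<bar>x\<bar> < 1\<close> both sides are of order one.\<close>

lemma H_drift_le:
  obtains D where "0 \<le> D"
    "\<And>x. x \<in> nonneg_orthant \<Longrightarrow> (\<integral>\<omega>. H (X \<omega> x) \<partial>M) \<le> H x + D * exp (- \<gamma> * H x)"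
proof -
  let ?g1 = "\<integral>\<omega>. G1 \<omega> \<partial>M" and ?g3 = "\<integral>\<omega>. G3 \<omega> \<partial>M"
  have g1: "0 \<le> ?g1" using cc_ge_1 by (intro integral_nonneg_AE) (auto simp: G1_def)
  have g3: "0 \<le> ?g3" using cc_ge_1 \<kappa>_gt_1 \<gamma>_pos by (intro integral_nonneg_AE) (auto simp: G3_def)
  let ?D = "?g3 * cc + ?g1 * cc * cc / \<gamma>"
  have D: "0 \<le> ?g3 * cc" "0 \<le> ?g1 * cc * cc / \<gamma>" using g1 g3 cc_ge_1 \<gamma>_pos by auto
  have "(\<integral>\<omega>. H (X \<omega> x) \<partial>M) \<le> H x + ?D * exp (- \<gamma> * H x)" if x: "x \<in> nonneg_orthant" for x
  proof (cases "1 \<le> l1norm x")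
    case True
    then have xp: "x \<in> punctured_orthant" using x by auto
    have i: "integrable M (\<lambda>\<omega>. h (A \<omega> *v x))" by (rule avg_integrable[OF h_loglike xp])
    have "(\<integral>\<omega>. H (X \<omega> x) \<partial>M) \<le> (\<integral>\<omega>. h (A \<omega> *v x) + G3 \<omega> * (cc * exp (- \<gamma> * H x)) \<partial>M)"
      using i G3_integrable H_X_le_far[OF _ x True] by (intro integral_mono H_X_integrable[OF x]) auto
    also have "\<dots> = avg h x + ?g3 * (cc * exp (- \<gamma> * H x))"
      using i G3_integrable xp by (simp add: avg_def)
    also have "avg h x \<le> H x" by (simp add: h_harmonic H_def)
    also have "?g3 * (cc * exp (- \<gamma> * H x)) = ?g3 * cc * exp (- \<gamma> * H x)" by simp
    also have "\<dots> \<le> ?D * exp (- \<gamma> * H x)" using D(2) by (intro mult_right_mono) auto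
    finally show ?thesis by simp
  next
    case False
    then have Hx: "H x \<le> C" using H_le_small[OF x] by simp
    have "(\<integral>\<omega>. H (X \<omega> x) \<partial>M) \<le> (\<integral>\<omega>. exp (\<gamma> * H (X \<omega> x)) / \<gamma> \<partial>M)"
      using exp_H_X_integrable(1)[OF x] le_exp_div by (intro integral_mono H_X_integrable[OF x]) auto
    also have "\<dots> \<le> ?g1 * exp (\<gamma> * H x) / \<gamma>"
      using exp_H_X_integrable(2)[OF x] \<gamma>_pos by (simp add: divide_right_mono)
    also have "\<dots> \<le> ?g1 * (cc * cc * exp (- \<gamma> * H x)) / \<gamma>"
    proof (intro divide_right_mono mult_left_mono)
      have "\<gamma> * H x \<le> \<gamma> * C + \<gamma> * C + - \<gamma> * H x"
        using mult_left_mono[OF Hx, of \<gamma>] \<gamma>_pos by simp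
      then have "exp (\<gamma> * H x) \<le> exp (\<gamma> * C + \<gamma> * C + - \<gamma> * H x)" by simp
      then show "exp (\<gamma> * H x) \<le> cc * cc * exp (- \<gamma> * H x)" by (simp only: cc_def exp_add)
    qed (use g1 \<gamma>_pos in auto)
    also have "\<dots> = ?g1 * cc * cc / \<gamma> * exp (- \<gamma> * H x)" by simp
    also have "\<dots> \<le> ?D * exp (- \<gamma> * H x)" using D(1) by (intro mult_right_mono) auto
    finally show ?thesis using H_nonneg[of x] by linarith
  qed
  then show ?thesis using D by (intro that[of ?D]) auto
qed

text \<open>A tent of height \<open>T\<close> at the origin; coercion to extended nonnegative reals truncates the negative
values.\<close>

definition w :: "real \<Rightarrow> real^'n \<Rightarrow> ennreal" where "w T x = ennreal (T - H x)"

lemma w_measurable [measurable]: "w T \<in> borel_measurable borel"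
  unfolding w_def[abs_def] by measurable

lemma astep_w:
  assumes x: "x \<in> nonneg_orthant"
  shows "integrable M (\<lambda>\<omega>. max (T - H (X \<omega> x)) 0)"
    and "astep (w T) x = ennreal (\<integral>\<omega>. max (T - H (X \<omega> x)) 0 \<partial>M)"
proof -
  show i: "integrable M (\<lambda>\<omega>. max (T - H (X \<omega> x)) 0)" using H_X_integrable[OF x] by auto
  have "astep (w T) x = (\<integral>\<^sup>+\<omega>. ennreal (max (T - H (X \<omega> x)) 0) \<partial>M)"
    unfolding astep_eq w_def by (intro nn_integral_cong) (simp add: max_def ennreal_neg)
  also have "\<dots> = ennreal (\<integral>\<omega>. max (T - H (X \<omega> x)) 0 \<partial>M)"
    by (intro nn_integral_eq_integral i) auto
  finally show "astep (w T) x = ennreal (\<integral>\<omega>. max (T - H (X \<omega> x)) 0 \<partial>M)" .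
qed

text \<open>Jensen's inequality for \<open>s \<mapsto> max (T - s) 0\<close>, together with the upper drift of \<open>H\<close>. Where \<open>H x \<ge> T\<close> the left
side vanishes.\<close>

lemma w_superstep:
  obtains D where "0 \<le> D" "\<And>T x. x \<in> nonneg_orthant \<Longrightarrow>
    w T x \<le> astep (w T) x + ennreal (D * exp (- \<gamma> * H x)) * indicator {z. H z < T} x"
proof -
  obtain D where D: "0 \<le> D" "\<And>x. x \<in> nonneg_orthant \<Longrightarrow>
      (\<integral>\<omega>. H (X \<omega> x) \<partial>M) \<le> H x + D * exp (- \<gamma> * H x)"
    using H_drift_le by blast
  have "w T x \<le> astep (w T) x + ennreal (D * exp (- \<gamma> * H x)) * indicator {z. H z < T} x"
    if x: "x \<in> nonneg_orthant" for T x
  proof (cases "H x < T")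
    case True
    have "T - (\<integral>\<omega>. H (X \<omega> x) \<partial>M) = (\<integral>\<omega>. T - H (X \<omega> x) \<partial>M)"
      using H_X_integrable[OF x] by (simp add: prob_space)
    also have "\<dots> \<le> (\<integral>\<omega>. max (T - H (X \<omega> x)) 0 \<partial>M)"
      using H_X_integrable[OF x] astep_w(1)[OF x] by (intro integral_mono) auto
    finally have "T - H x \<le> (\<integral>\<omega>. max (T - H (X \<omega> x)) 0 \<partial>M) + D * exp (- \<gamma> * H x)"
      using D(2)[OF x] by linarith
    then have "w T x \<le> ennreal ((\<integral>\<omega>. max (T - H (X \<omega> x)) 0 \<partial>M) + D * exp (- \<gamma> * H x))"
      unfolding w_def by (rule ennreal_leI)
    also have "\<dots> = astep (w T) x + ennreal (D * exp (- \<gamma> * H x))"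
      unfolding astep_w(2)[OF x] using D(1) by (intro ennreal_plus integral_nonneg_AE) auto
    finally show ?thesis using True by simp
  qed (simp add: w_def ennreal_neg)
  then show ?thesis using D that by blast
qed

text \<open>Below level \<open>T\<close> the tent is affine in \<open>H\<close>, so by subharmonicity its average can exceed it only through
jumps across \<open>T\<close>; above level \<open>T\<close> it vanishes, and its average is again due to such jumps. Both have
exponentially small probability in the distance to \<open>T\<close>.\<close>

lemma w_substep:
  obtains D where "0 < D" "\<And>T x. x \<in> nonneg_orthant \<Longrightarrow>
    astep (w T) x \<le> w T x + ennreal (D * exp (- \<gamma> * \<bar>H x - T\<bar>))"
proof -
  let ?g1 = "\<integral>\<omega>. G1 \<omega> \<partial>M" and ?n = "\<integral>\<omega>. Nmax (A \<omega>) powr \<gamma> \<partial>M"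
  have g1: "0 \<le> ?g1" using cc_ge_1 by (intro integral_nonneg_AE) (auto simp: G1_def)
  have n: "0 \<le> ?n" by (intro integral_nonneg_AE) auto
  let ?D = "(?g1 + cc * cc * ?n) / \<gamma> + 1"
  have D0: "0 \<le> cc * cc * ?n" using n cc_ge_1 by auto
  have D: "0 < ?D" using g1 D0 \<gamma>_pos by (intro add_nonneg_pos divide_nonneg_pos add_nonneg_nonneg) auto
  have "astep (w T) x \<le> w T x + ennreal (?D * exp (- \<gamma> * \<bar>H x - T\<bar>))"
    if x: "x \<in> nonneg_orthant" for T x
  proof (cases "H x < T")
    case True
    let ?f = "\<lambda>\<omega>. (T - H (X \<omega> x)) + exp (- \<gamma> * T) * exp (\<gamma> * H (X \<omega> x)) / \<gamma>"
    have fi: "integrable M ?f" using H_X_integrable[OF x] exp_H_X_integrable(1)[OF x] by auto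
    have "(\<integral>\<omega>. max (T - H (X \<omega> x)) 0 \<partial>M) \<le> (\<integral>\<omega>. ?f \<omega> \<partial>M)"
    proof (rule integral_mono[OF astep_w(1)[OF x] fi])
      fix \<omega>
      have "H (X \<omega> x) - T \<le> exp (\<gamma> * (H (X \<omega> x) - T)) / \<gamma>" by (rule le_exp_div)
      also have "exp (\<gamma> * (H (X \<omega> x) - T)) = exp (- \<gamma> * T) * exp (\<gamma> * H (X \<omega> x))"
        by (simp add: exp_add[symmetric] algebra_simps)
      finally have 1: "0 \<le> ?f \<omega>" by simp
      have "0 \<le> exp (- \<gamma> * T) * exp (\<gamma> * H (X \<omega> x)) / \<gamma>" using \<gamma>_pos by simp
      with 1 show "max (T - H (X \<omega> x)) 0 \<le> ?f \<omega>" by simp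
    qed
    also have "\<dots> = T - (\<integral>\<omega>. H (X \<omega> x) \<partial>M) + exp (- \<gamma> * T) * (\<integral>\<omega>. exp (\<gamma> * H (X \<omega> x)) \<partial>M) / \<gamma>"
      using H_X_integrable[OF x] exp_H_X_integrable(1)[OF x] by (simp add: prob_space)
    also have "\<dots> \<le> (T - H x) + exp (- \<gamma> * T) * (?g1 * exp (\<gamma> * H x)) / \<gamma>"
      using H_subharmonic[OF x] exp_H_X_integrable(2)[OF x] \<gamma>_pos
      by (intro add_mono divide_right_mono mult_left_mono diff_left_mono) auto
    also have "exp (- \<gamma> * T) * (?g1 * exp (\<gamma> * H x)) / \<gamma> = ?g1 / \<gamma> * exp (- \<gamma> * \<bar>H x - T\<bar>)"
      using True by (simp add: exp_add[symmetric] algebra_simps)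
    also have "\<dots> \<le> ?D * exp (- \<gamma> * \<bar>H x - T\<bar>)"
      using D0 \<gamma>_pos by (intro mult_right_mono) (auto simp: add_divide_distrib)
    finally have "astep (w T) x \<le> ennreal ((T - H x) + ?D * exp (- \<gamma> * \<bar>H x - T\<bar>))"
      unfolding astep_w(2)[OF x] by (intro ennreal_leI) simp
    also have "\<dots> = w T x + ennreal (?D * exp (- \<gamma> * \<bar>H x - T\<bar>))"
      unfolding w_def using True D by (intro ennreal_plus) auto
    finally show ?thesis .
  next
    case False
    let ?f = "\<lambda>\<omega>. cc * cc * Nmax (A \<omega>) powr \<gamma> * exp (- \<gamma> * (H x - T)) / \<gamma>"
    have fi: "integrable M ?f" using N_integrable by auto
    have "(\<integral>\<omega>. max (T - H (X \<omega> x)) 0 \<partial>M) \<le> (\<integral>\<omega>. ?f \<omega> \<partial>M)"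
    proof (rule integral_mono[OF astep_w(1)[OF x] fi])
      fix \<omega> assume \<omega>: "\<omega> \<in> space M"
      have nn: "0 < Nmax (A \<omega>)" using N_ge_1[OF \<omega>] by linarith
      have "T - H (X \<omega> x) \<le> exp (\<gamma> * (T - H (X \<omega> x))) / \<gamma>" by (rule le_exp_div)
      also have "\<dots> \<le> exp (\<gamma> * C + \<gamma> * C + \<gamma> * ln (Nmax (A \<omega>)) + - \<gamma> * (H x - T)) / \<gamma>"
      proof (rule divide_right_mono)
        have "\<gamma> * (H x - H (X \<omega> x)) \<le> \<gamma> * (2 * C + ln (Nmax (A \<omega>)))"
          using H_drop[OF \<omega> x] \<gamma>_pos by (intro mult_left_mono) auto
        then show "exp (\<gamma> * (T - H (X \<omega> x))) \<le> exp (\<gamma> * C + \<gamma> * C + \<gamma> * ln (Nmax (A \<omega>)) + - \<gamma> * (H x - T))"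
          by (simp add: algebra_simps)
      qed (use \<gamma>_pos in simp)
      also have "\<dots> = ?f \<omega>"
        using nn by (simp only: exp_add cc_def powr_def) simp
      finally have 1: "T - H (X \<omega> x) \<le> ?f \<omega>" .
      have "0 \<le> ?f \<omega>" using cc_ge_1 \<gamma>_pos by simp
      with 1 show "max (T - H (X \<omega> x)) 0 \<le> ?f \<omega>" by simp
    qed
    also have "\<dots> = cc * cc * ?n / \<gamma> * exp (- \<gamma> * \<bar>H x - T\<bar>)" using False by simp
    also have "\<dots> \<le> ?D * exp (- \<gamma> * \<bar>H x - T\<bar>)"
      using g1 \<gamma>_pos by (intro mult_right_mono) (auto simp: add_divide_distrib)
    finally have "astep (w T) x \<le> ennreal (?D * exp (- \<gamma> * \<bar>H x - T\<bar>))"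
      unfolding astep_w(2)[OF x] by (rule ennreal_leI)
    then show ?thesis by (simp add: add_increasing)
  qed
  then show ?thesis using D that by blast
qed

end

section \<open>The mass of logarithmic shells\<close>

lemma discrete_gronwall:
  fixes s :: "nat \<Rightarrow> ennreal"
  assumes s0: "s k0 < \<top>" and r: "0 \<le> r" "r < 1" and Q: "0 \<le> Q"
    and step: "\<And>k. k0 \<le> k \<Longrightarrow> s (Suc k) \<le> s k + ennreal (Q * r ^ k) * s k"
  obtains S where "0 \<le> S" "\<And>k. k0 \<le> k \<Longrightarrow> s k \<le> ennreal S"
proof -
  have geo: "(\<Sum>i<n. r ^ (k0 + i)) \<le> 1 / (1 - r)" for n
  proof -
    have "(\<Sum>i<n. r ^ (k0 + i)) \<le> (\<Sum>i<n. r ^ i)"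
      using r by (intro sum_mono power_decreasing) auto
    also have "\<dots> \<le> (\<Sum>i. r ^ i)" using r by (intro sum_le_suminf summable_geometric) auto
    also have "\<dots> = 1 / (1 - r)" using r by (intro suminf_geometric) auto
    finally show ?thesis .
  qed
  have it: "s (k0 + n) \<le> ennreal (exp (Q * (\<Sum>i<n. r ^ (k0 + i)))) * s k0" for n
  proof (induction n)
    case (Suc n)
    let ?q = "Q * r ^ (k0 + n)" and ?e = "exp (Q * (\<Sum>i<n. r ^ (k0 + i)))"
    have q: "0 \<le> ?q" using Q r by simp
    have "s (k0 + Suc n) \<le> s (k0 + n) + ennreal ?q * s (k0 + n)" using step[of "k0 + n"] by simp
    also have "\<dots> = ennreal (1 + ?q) * s (k0 + n)"
      using q by (simp add: ennreal_plus distrib_right)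
    also have "\<dots> \<le> ennreal (exp ?q) * (ennreal ?e * s k0)"
      using Suc.IH exp_ge_add_one_self[of ?q] by (intro mult_mono ennreal_leI) auto
    also have "\<dots> = ennreal (exp (?q + Q * (\<Sum>i<n. r ^ (k0 + i)))) * s k0"
      by (simp add: mult.assoc[symmetric] ennreal_mult[symmetric] exp_add)
    also have "?q + Q * (\<Sum>i<n. r ^ (k0 + i)) = Q * (\<Sum>i<Suc n. r ^ (k0 + i))"
      by (simp add: algebra_simps)
    finally show ?case .
  qed simp
  define S where "S = exp (Q * (1 / (1 - r))) * enn2real (s k0)"
  have "s k \<le> ennreal S" if k: "k0 \<le> k" for k
  proof -
    obtain n where n: "k = k0 + n" using le_Suc_ex[OF k] by blast
    have "s k \<le> ennreal (exp (Q * (\<Sum>i<n. r ^ (k0 + i)))) * s k0" using it n by simp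
    also have "\<dots> \<le> ennreal (exp (Q * (1 / (1 - r)))) * s k0"
      using Q geo[of n] by (intro mult_right_mono ennreal_leI) (auto intro!: mult_left_mono simp del: times_divide_eq_right)
    also have "\<dots> = ennreal S" using s0 by (simp add: S_def ennreal_mult)
    finally show ?thesis .
  qed
  then show ?thesis using that[of S] by (simp add: S_def)
qed

text \<open>The sum over the distances to \<open>n\<close> splits into two geometric series.\<close>

lemma two_sided_geometric_sum:
  fixes c :: real
  assumes c: "0 < c"
  shows "(\<Sum>k<N. exp (- c * \<bar>real k - real n\<bar>)) \<le> 2 / (1 - exp (- c))"
proof -
  let ?r = "exp (- c)"
  have r: "0 \<le> ?r" "?r < 1" using c by auto
  have geo: "(\<Sum>j\<in>F. ?r ^ j) \<le> 1 / (1 - ?r)" if "finite F" for F :: "nat set"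
  proof -
    have "(\<Sum>j\<in>F. ?r ^ j) \<le> (\<Sum>i. ?r ^ i)" using r that by (intro sum_le_suminf summable_geometric) auto
    also have "\<dots> = 1 / (1 - ?r)" using r by (intro suminf_geometric) auto
    finally show ?thesis .
  qed
  let ?A = "{k. k < N \<and> k < n}" and ?B = "{k. k < N \<and> n \<le> k}"
  have pw: "exp (- c * real j) = ?r ^ j" for j by (simp add: exp_of_nat_mult[symmetric] mult.commute)
  have split: "{..<N} = ?A \<union> ?B" by auto
  have "(\<Sum>k<N. exp (- c * \<bar>real k - real n\<bar>)) = (\<Sum>k\<in>?A \<union> ?B. exp (- c * \<bar>real k - real n\<bar>))"
    by (rule arg_cong[OF split])
  also have "\<dots> = (\<Sum>k\<in>?A. exp (- c * \<bar>real k - real n\<bar>)) + (\<Sum>k\<in>?B. exp (- c * \<bar>real k - real n\<bar>))"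
    by (rule sum.union_disjoint) auto
  also have "(\<Sum>k\<in>?A. exp (- c * \<bar>real k - real n\<bar>)) = (\<Sum>j\<in>(\<lambda>k. n - k) ` ?A. ?r ^ j)"
  proof (subst sum.reindex)
    show "inj_on (\<lambda>k. n - k) ?A" by (auto simp: inj_on_def)
    show "(\<Sum>k\<in>?A. exp (- c * \<bar>real k - real n\<bar>)) = sum (((^) ?r) \<circ> (\<lambda>k. n - k)) ?A"
      by (intro sum.cong) (auto simp: pw[symmetric] of_nat_diff)
  qed
  also have "(\<Sum>k\<in>?B. exp (- c * \<bar>real k - real n\<bar>)) = (\<Sum>j\<in>(\<lambda>k. k - n) ` ?B. ?r ^ j)"
  proof (subst sum.reindex)
    show "inj_on (\<lambda>k. k - n) ?B" by (auto simp: inj_on_def)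
    show "(\<Sum>k\<in>?B. exp (- c * \<bar>real k - real n\<bar>)) = sum (((^) ?r) \<circ> (\<lambda>k. k - n)) ?B"
      by (intro sum.cong) (auto simp: pw[symmetric] of_nat_diff)
  qed
  also have "(\<Sum>j\<in>(\<lambda>k. n - k) ` ?A. ?r ^ j) + (\<Sum>j\<in>(\<lambda>k. k - n) ` ?B. ?r ^ j) \<le> 1 / (1 - ?r) + 1 / (1 - ?r)"
    by (intro add_mono geo) auto
  finally show ?thesis by simp
qed

context affine_pair
begin

lemma astep_add:
  assumes "f \<in> borel_measurable borel" "g \<in> borel_measurable borel"
  shows "astep (\<lambda>x. f x + g x) x = astep f x + astep g x"
proof -
  note [measurable] = assms
  show ?thesis unfolding astep_eq by (rule nn_integral_add) measurable
qed

lemma astep_iterate_add: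
  assumes f: "f \<in> borel_measurable borel" and g: "g \<in> borel_measurable borel"
  shows "(astep ^^ m) (\<lambda>x. f x + g x) x = (astep ^^ m) f x + (astep ^^ m) g x"
proof (induction m arbitrary: x)
  case (Suc m)
  then have "(astep ^^ m) (\<lambda>x. f x + g x) = (\<lambda>x. (astep ^^ m) f x + (astep ^^ m) g x)" by auto
  then show ?case
    using astep_add[OF astep_iterate_measurable[OF f, of m] astep_iterate_measurable[OF g, of m]] by simp
qed simp

lemma astep_iterate_const: "(astep ^^ m) (\<lambda>_. c) x = c"
proof (induction m arbitrary: x)
  case (Suc m)
  then have "(astep ^^ m) (\<lambda>_. c) = (\<lambda>_. c)" by auto
  then show ?case by (simp add: astep_eq[of "\<lambda>_. c" x] emeasure_space_1)
qed simp

lemma astep_iterate_super: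
  assumes f: "f \<in> borel_measurable borel" and g: "g \<in> borel_measurable borel"
    and le: "\<And>x. x \<in> nonneg_orthant \<Longrightarrow> f x \<le> astep f x + g x" and x: "x \<in> nonneg_orthant"
  shows "f x \<le> (astep ^^ m) f x + (\<Sum>i<m. (astep ^^ i) g x)"
proof (induction m)
  case (Suc m)
  have "(astep ^^ m) f x \<le> (astep ^^ m) (\<lambda>x. astep f x + g x) x"
    by (rule astep_iterate_mono[OF le x])
  also have "\<dots> = (astep ^^ Suc m) f x + (astep ^^ m) g x"
    using astep_iterate_add[OF astep_measurable[OF f] g] by (simp add: funpow_swap1)
  finally have "f x \<le> ((astep ^^ Suc m) f x + (astep ^^ m) g x) + (\<Sum>i<m. (astep ^^ i) g x)"
    using Suc.IH by (meson add_right_mono order_trans)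
  then show ?case by (simp add: ac_simps)
qed simp

lemma astep_iterate_sub:
  assumes f: "f \<in> borel_measurable borel" and g: "g \<in> borel_measurable borel"
    and le: "\<And>x. x \<in> nonneg_orthant \<Longrightarrow> astep f x \<le> f x + g x" and x: "x \<in> nonneg_orthant"
  shows "(astep ^^ m) f x \<le> f x + (\<Sum>i<m. (astep ^^ i) g x)"
proof (induction m)
  case (Suc m)
  have "(astep ^^ Suc m) f x = (astep ^^ m) (astep f) x" by (simp add: funpow_swap1)
  also have "\<dots> \<le> (astep ^^ m) (\<lambda>x. f x + g x) x" by (rule astep_iterate_mono[OF le x])
  also have "\<dots> = (astep ^^ m) f x + (astep ^^ m) g x" by (rule astep_iterate_add[OF f g])
  also have "\<dots> \<le> (f x + (\<Sum>i<m. (astep ^^ i) g x)) + (astep ^^ m) g x"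
    using Suc.IH by (rule add_right_mono)
  finally show ?case by (simp add: ac_simps)
qed simp

lemma contraction_orbit:
  assumes g: "g \<in> semigroup_of supp" "matnorm g < 1" and r: "0 < r"
    and x: "x \<in> nonneg_orthant"
  shows "\<exists>g\<in>semigroup_of supp. l1norm (g *v x) < r"
proof -
  have al: "g \<in> allowable" using g semigroup_allowable by blast
  have nn: "0 \<le> matnorm g" using iota_min_pos[OF al] iota_le_matnorm[OF al] by linarith
  have it: "((*v) g ^^ n) x \<in> nonneg_orthant \<and> l1norm (((*v) g ^^ n) x) \<le> matnorm g ^ n * l1norm x" for n
  proof (induction n)
    case (Suc n)
    then have "l1norm (g *v ((*v) g ^^ n) x) \<le> matnorm g * l1norm (((*v) g ^^ n) x)"
      using l1norm_mult_le[OF al] by blast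
    also have "\<dots> \<le> matnorm g * (matnorm g ^ n * l1norm x)" using Suc nn by (intro mult_left_mono) auto
    finally show ?case using Suc allowable_mult_orthant[OF al] by simp
  qed (use x in simp)
  have "(\<lambda>n. matnorm g ^ n * l1norm x) \<longlonglongrightarrow> 0 * l1norm x"
    using nn g by (intro tendsto_intros LIMSEQ_realpow_zero) auto
  then have "\<forall>\<^sub>F n in sequentially. matnorm g ^ n * l1norm x < r"
    using r by (intro order_tendstoD(2)[where y = "0 * l1norm x"]) auto
  then obtain n0 where n0: "\<And>n. n0 \<le> n \<Longrightarrow> matnorm g ^ n * l1norm x < r"
    unfolding eventually_sequentially by blast
  obtain W where "W \<in> semigroup_of supp" "\<forall>x. ((*v) g ^^ Suc n0) x = W *v x"
    using funpow_mult_vec_in_semigroup[OF semigroup_of_mult g(1), of n0] by auto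
  moreover have "l1norm (((*v) g ^^ Suc n0) x) < r"
    using it[of "Suc n0"] n0[of "Suc n0"] by linarith
  ultimately show ?thesis by metis
qed

end

locale log_harmonic_invariant = log_harmonic M A B \<kappa> \<gamma> h C + affine_invariant M A B \<kappa> \<gamma> \<nu>
  for M :: "'w measure" and A :: "'w \<Rightarrow> real^'n^'n" and B :: "'w \<Rightarrow> real^'n" and \<kappa> \<gamma> h C \<nu>
begin

lemma H_less_ball: "{x \<in> nonneg_orthant. H x < T} \<subseteq> {x \<in> nonneg_orthant. l1norm x \<le> exp (T + C)}"
proof clarsimp
  fix x :: "real^'n" assume x: "x \<in> nonneg_orthant" "H x < T"
  show "l1norm x \<le> exp (T + C)"
  proof (cases "x = 0")
    case False
    then have "ln (l1norm x) \<le> T + C" using H_ge[of x] x by simp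
    then have "exp (ln (l1norm x)) \<le> exp (T + C)" by simp
    then show ?thesis using False by simp
  qed simp
qed

lemma H_less_finite: "emeasure \<nu> {x \<in> nonneg_orthant. H x < T} < \<infinity>"
  using emeasure_mono[OF H_less_ball ball_in_\<nu>] ball_finite by (rule order.strict_trans1)

lemma H_sets [measurable]:
  "{x \<in> nonneg_orthant. H x < T} \<in> sets \<nu>"
  "{x \<in> nonneg_orthant. T \<le> H x} \<in> sets \<nu>"
  "{x \<in> nonneg_orthant. T \<le> H x \<and> H x \<le> T'} \<in> sets \<nu>"
  "{x \<in> nonneg_orthant. T \<le> H x \<and> H x < T'} \<in> sets \<nu>"
  "{x \<in> nonneg_orthant. \<bar>H x - T\<bar> \<le> T'} \<in> sets \<nu>"
  "{x \<in> nonneg_orthant. H x = T} \<in> sets \<nu>"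
  by (intro set_in_\<nu>; measurable)+

lemma borel_\<nu>: "f \<in> borel_measurable borel \<Longrightarrow> f \<in> borel_measurable \<nu>"
  by (rule borel_imp_measurable_\<nu>)

lemma w_integral_finite: "(\<integral>\<^sup>+x. w T x \<partial>\<nu>) < \<infinity>"
proof -
  have "(\<integral>\<^sup>+x. w T x \<partial>\<nu>) \<le> (\<integral>\<^sup>+x. ennreal T * indicator {x \<in> nonneg_orthant. H x < T} x \<partial>\<nu>)"
  proof (rule nn_integral_mono)
    fix x assume "x \<in> space \<nu>"
    then show "w T x \<le> ennreal T * indicator {x \<in> nonneg_orthant. H x < T} x"
      by (cases "H x < T") (auto simp: space_\<nu> w_def ennreal_neg intro!: ennreal_leI)
  qed
  also have "\<dots> = ennreal T * emeasure \<nu> {x \<in> nonneg_orthant. H x < T}"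
    by (rule nn_integral_cmult_indicator) (rule H_sets)
  also have "\<dots> < \<infinity>" using H_less_finite[of T] by (simp add: ennreal_mult_less_top)
  finally show ?thesis .
qed

lemma integral_astep_sum:
  assumes g: "g \<in> borel_measurable borel"
  shows "(\<integral>\<^sup>+x. (\<Sum>i<m. (astep ^^ i) g x) \<partial>\<nu>) = of_nat m * (\<integral>\<^sup>+x. g x \<partial>\<nu>)"
proof -
  have "(\<integral>\<^sup>+x. (\<Sum>i<m. (astep ^^ i) g x) \<partial>\<nu>) = (\<Sum>i<m. \<integral>\<^sup>+x. (astep ^^ i) g x \<partial>\<nu>)"
    by (rule nn_integral_sum) (rule borel_\<nu>[OF astep_iterate_measurable[OF g]])
  then show ?thesis by (simp add: invariance_iterate[OF g])
qed

text \<open>Integrating \<open>m\<close> steps of the inequality against the invariant measure: the tent has the same finite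
integral before and after, so what it gains where it vanished is bounded by the accumulated errors.\<close>

lemma mass_transfer:
  assumes g: "g \<in> borel_measurable borel"
    and le: "\<And>x. x \<in> nonneg_orthant \<Longrightarrow> w T x \<le> astep (w T) x + g x"
  shows "(\<integral>\<^sup>+x. (astep ^^ m) (w T) x * indicator {x \<in> nonneg_orthant. T \<le> H x} x \<partial>\<nu>)
    \<le> of_nat m * (\<integral>\<^sup>+x. g x \<partial>\<nu>)"
proof -
  let ?V = "{x \<in> nonneg_orthant. T \<le> H x}"
  let ?I = "\<integral>\<^sup>+x. w T x \<partial>\<nu>"
  have m1: "w T \<in> borel_measurable \<nu>" "(astep ^^ i) (w T) \<in> borel_measurable \<nu>"
    "(astep ^^ i) g \<in> borel_measurable \<nu>" for i
    using w_measurable g by (auto intro!: borel_\<nu> astep_iterate_measurable)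
  have ms: "(\<lambda>x. \<Sum>i<m. (astep ^^ i) g x) \<in> borel_measurable \<nu>"
    by (intro borel_measurable_sum m1)
  have mV: "(\<lambda>x. (astep ^^ m) (w T) x * indicator ?V x) \<in> borel_measurable \<nu>"
    by (intro borel_measurable_times_ennreal m1 borel_measurable_indicator H_sets)
  have "?I + (\<integral>\<^sup>+x. (astep ^^ m) (w T) x * indicator ?V x \<partial>\<nu>)
      = (\<integral>\<^sup>+x. w T x + (astep ^^ m) (w T) x * indicator ?V x \<partial>\<nu>)"
    by (rule nn_integral_add[OF m1(1) mV, symmetric])
  also have "\<dots> \<le> (\<integral>\<^sup>+x. (astep ^^ m) (w T) x + (\<Sum>i<m. (astep ^^ i) g x) \<partial>\<nu>)"
  proof (rule nn_integral_mono)
    fix x assume "x \<in> space \<nu>"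
    then have x: "x \<in> nonneg_orthant" by (simp add: space_\<nu>)
    show "w T x + (astep ^^ m) (w T) x * indicator ?V x \<le> (astep ^^ m) (w T) x + (\<Sum>i<m. (astep ^^ i) g x)"
    proof (cases "x \<in> ?V")
      case True
      then have "w T x = 0" by (simp add: w_def ennreal_neg)
      then show ?thesis using True by (simp add: add_increasing2)
    qed (use astep_iterate_super[OF w_measurable g le x] in simp)
  qed
  also have "\<dots> = ?I + of_nat m * (\<integral>\<^sup>+x. g x \<partial>\<nu>)"
    by (simp add: nn_integral_add[OF m1(2) ms] integral_astep_sum[OF g] invariance_iterate[OF w_measurable])
  finally show ?thesis using w_integral_finite[of T] by (auto simp: ennreal_add_left_cancel_le)
qed

text \<open>A contracting product brings any vector of norm of order \<open>exp T\<close> down to a small multiple of that scale.\<close>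

lemma descend_from_shell:
  assumes g: "g \<in> semigroup_of supp" "matnorm g < 1"
  obtains m p T0 where "0 < p"
    "\<And>T x. T0 \<le> T \<Longrightarrow> x \<in> nonneg_orthant \<Longrightarrow> T \<le> H x \<Longrightarrow> H x \<le> T + 1 \<Longrightarrow>
      \<exists>k\<le>m. ennreal p \<le> (astep ^^ k) (indicator {z. H z \<le> T - 1}) x"
proof -
  define K where "K = {y \<in> nonneg_orthant. l1norm (y :: real^'n) \<le> exp (1 + C)}"
  define V where "V = {z :: real^'n. l1norm z < exp (- 1 - C)}"
  have V: "open V" unfolding V_def by (intro open_Collect_less continuous_intros)
  have orb: "\<exists>g\<in>semigroup_of supp. g *v x \<in> V" if "x \<in> K" for x
    using contraction_orbit[OF g, of "exp (- 1 - C)" x] that by (auto simp: K_def V_def)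
  have K: "compact K" unfolding K_def by (rule compact_orthant_ball)
  obtain m p t0 where r: "0 < p" "0 < t0"
    "\<And>t y. t0 \<le> t \<Longrightarrow> y \<in> K \<Longrightarrow> y \<in> nonneg_orthant \<Longrightarrow>
      \<exists>k\<le>m. ennreal p \<le> (astep ^^ k) (indicator {z. (1 / t) *\<^sub>R z \<in> V}) (t *\<^sub>R y)"
  proof (rule reaches_uniformly[OF K V orb])
    fix m p t0 assume a: "0 < p" "0 < t0"
      and b: "\<And>t y. t0 \<le> t \<Longrightarrow> y \<in> K \<Longrightarrow> y \<in> nonneg_orthant \<Longrightarrow>
        \<exists>k\<le>m. ennreal p \<le> (astep ^^ k) (indicator {z. (1 / t) *\<^sub>R z \<in> V}) (t *\<^sub>R y)"
    show thesis by (rule that[OF a b])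
  qed
  have "\<exists>k\<le>m. ennreal p \<le> (astep ^^ k) (indicator {z. H z \<le> T - 1}) x"
    if T: "max (ln t0) (C + 1) \<le> T" and x: "x \<in> nonneg_orthant" "T \<le> H x" "H x \<le> T + 1" for T x
  proof -
    let ?y = "(1 / exp T) *\<^sub>R x"
    have "exp (ln t0) \<le> exp T" using T by simp
    then have t: "t0 \<le> exp T" using r(2) by simp
    have "x \<noteq> 0" using x T C_nonneg by auto
    then have "ln (l1norm x) \<le> T + (1 + C)" using H_ge[of x] x by simp
    then have "exp (ln (l1norm x)) \<le> exp (T + (1 + C))" by simp
    then have "l1norm x \<le> exp T * exp (1 + C)" using \<open>x \<noteq> 0\<close> by (simp add: exp_add)
    then have y: "?y \<in> K" using x by (auto simp: K_def field_simps)
    obtain k where k: "k \<le> m" "ennreal p \<le> (astep ^^ k) (indicator {z. (1 / exp T) *\<^sub>R z \<in> V}) x"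
      using r(3)[OF t y] y by (auto simp: K_def)
    have "(astep ^^ k) (indicator {z. (1 / exp T) *\<^sub>R z \<in> V}) x
        \<le> (astep ^^ k) (indicator {z. H z \<le> T - 1}) x"
    proof (rule astep_iterate_mono[OF _ x(1)])
      fix z :: "real^'n" assume z: "z \<in> nonneg_orthant"
      have "H z \<le> T - 1" if "l1norm z / exp T < exp (- 1 - C)"
      proof (cases "1 \<le> l1norm z")
        case True
        have "l1norm z < exp (- 1 - C) * exp T" using that by (simp add: field_simps)
        then have "l1norm z < exp (T - 1 - C)" by (simp add: exp_add[symmetric] algebra_simps)
        then have "ln (l1norm z) < ln (exp (T - 1 - C))" using True by (subst ln_less_cancel_iff) auto
        then show ?thesis using H_le_big[OF z True] by simp
      next
        case False
        then show ?thesis using H_le_small[OF z] T by simp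
      qed
      then show "indicator {z. (1 / exp T) *\<^sub>R z \<in> V} z \<le> (indicator {z. H z \<le> T - 1} z :: ennreal)"
        by (auto simp: indicator_def V_def)
    qed
    then show ?thesis using k by (meson order_trans)
  qed
  then show ?thesis using r(1) by (intro that[of p "max (ln t0) (C + 1)" m]) auto
qed

text \<open>On the shell the tent vanishes but is at least \<open>1\<close> one unit below, so \<open>descend_from_shell\<close> bounds the gain
in \<open>mass_transfer\<close> from below.\<close>

lemma shell_le_sublevel:
  assumes g: "g \<in> semigroup_of supp" "matnorm g < 1"
  obtains Q T0 where "0 \<le> Q" "\<And>T. T0 \<le> T \<Longrightarrow>
    emeasure \<nu> {x \<in> nonneg_orthant. T \<le> H x \<and> H x \<le> T + 1}
      \<le> ennreal Q * (\<integral>\<^sup>+x. ennreal (exp (- \<gamma> * H x)) * indicator {z. H z < T} x \<partial>\<nu>)"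
proof -
  obtain D where D: "0 \<le> D" "\<And>T x. x \<in> nonneg_orthant \<Longrightarrow>
    w T x \<le> astep (w T) x + ennreal (D * exp (- \<gamma> * H x)) * indicator {z. H z < T} x"
    using w_superstep by blast
  obtain m p T0 where r: "0 < p"
    "\<And>T x. T0 \<le> T \<Longrightarrow> x \<in> nonneg_orthant \<Longrightarrow> T \<le> H x \<Longrightarrow> H x \<le> T + 1 \<Longrightarrow>
      \<exists>k\<le>m. ennreal p \<le> (astep ^^ k) (indicator {z. H z \<le> T - 1}) x"
  proof (rule descend_from_shell[OF g])
    fix m p T0 assume a: "0 < p"
      and b: "\<And>T x. T0 \<le> T \<Longrightarrow> x \<in> nonneg_orthant \<Longrightarrow> T \<le> H x \<Longrightarrow> H x \<le> T + 1 \<Longrightarrow>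
        \<exists>k\<le>m. ennreal p \<le> (astep ^^ k) (indicator {z. H z \<le> T - 1}) x"
    show thesis by (rule that[OF a b])
  qed
  let ?Q = "real (Suc m * m) * D / p"
  have "emeasure \<nu> {x \<in> nonneg_orthant. T \<le> H x \<and> H x \<le> T + 1}
      \<le> ennreal ?Q * (\<integral>\<^sup>+x. ennreal (exp (- \<gamma> * H x)) * indicator {z. H z < T} x \<partial>\<nu>)" if T: "T0 \<le> T" for T
  proof -
    let ?S = "{x \<in> nonneg_orthant. T \<le> H x \<and> H x \<le> T + 1}" and ?V = "{x \<in> nonneg_orthant. T \<le> H x}"
    let ?\<psi> = "\<lambda>x. ennreal (D * exp (- \<gamma> * H x)) * indicator {z. H z < T} x"
    have \<psi>m: "?\<psi> \<in> borel_measurable borel" by measurable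
    have "ennreal p * emeasure \<nu> ?S = (\<integral>\<^sup>+x. ennreal p * indicator ?S x \<partial>\<nu>)"
      by (rule nn_integral_cmult_indicator[symmetric]) (rule H_sets)
    also have "\<dots> \<le> (\<integral>\<^sup>+x. (\<Sum>k\<le>m. (astep ^^ k) (w T) x * indicator ?V x) \<partial>\<nu>)"
    proof (rule nn_integral_mono)
      fix x assume "x \<in> space \<nu>"
      show "ennreal p * indicator ?S x \<le> (\<Sum>k\<le>m. (astep ^^ k) (w T) x * indicator ?V x)"
      proof (cases "x \<in> ?S")
        case True
        then have x: "x \<in> nonneg_orthant" "T \<le> H x" "H x \<le> T + 1" by auto
        then obtain k where k: "k \<le> m" "ennreal p \<le> (astep ^^ k) (indicator {z. H z \<le> T - 1}) x"
          using r(2)[OF T] by blast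
        note k(2)
        also have "(astep ^^ k) (indicator {z. H z \<le> T - 1}) x \<le> (astep ^^ k) (w T) x"
        proof (rule astep_iterate_mono[OF _ x(1)])
          fix z show "indicator {z. H z \<le> T - 1} z \<le> w T z"
            by (cases "H z \<le> T - 1") (auto simp: w_def)
        qed
        also have "\<dots> \<le> (\<Sum>k\<le>m. (astep ^^ k) (w T) x)" using k(1) by (intro member_le_sum) auto
        finally show ?thesis using x by simp
      qed simp
    qed
    also have "\<dots> = (\<Sum>k\<le>m. \<integral>\<^sup>+x. (astep ^^ k) (w T) x * indicator ?V x \<partial>\<nu>)"
      by (intro nn_integral_sum borel_measurable_times_ennreal borel_measurable_indicator H_sets
          borel_\<nu> astep_iterate_measurable w_measurable)
    also have "\<dots> \<le> (\<Sum>k\<le>m. of_nat m * (\<integral>\<^sup>+x. ?\<psi> x \<partial>\<nu>))"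
    proof (rule sum_mono)
      fix k assume "k \<in> {..m}"
      have "(\<integral>\<^sup>+x. (astep ^^ k) (w T) x * indicator ?V x \<partial>\<nu>) \<le> of_nat k * (\<integral>\<^sup>+x. ?\<psi> x \<partial>\<nu>)"
        by (rule mass_transfer[OF \<psi>m D(2)])
      also have "\<dots> \<le> of_nat m * (\<integral>\<^sup>+x. ?\<psi> x \<partial>\<nu>)"
        using \<open>k \<in> {..m}\<close> by (intro mult_right_mono of_nat_mono) auto
      finally show "(\<integral>\<^sup>+x. (astep ^^ k) (w T) x * indicator ?V x \<partial>\<nu>) \<le> of_nat m * (\<integral>\<^sup>+x. ?\<psi> x \<partial>\<nu>)" .
    qed
    also have "\<dots> = of_nat (Suc m) * (of_nat m * (\<integral>\<^sup>+x. ?\<psi> x \<partial>\<nu>))"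
      by (simp only: sum_constant card_atMost)
    also have "\<dots> = ennreal (real (Suc m * m)) * (\<integral>\<^sup>+x. ?\<psi> x \<partial>\<nu>)"
      by (simp only: ennreal_of_nat_eq_real_of_nat of_nat_mult mult.assoc[symmetric]
          ennreal_mult[symmetric, OF of_nat_0_le_iff of_nat_0_le_iff])
    also have "(\<integral>\<^sup>+x. ?\<psi> x \<partial>\<nu>) = ennreal D * (\<integral>\<^sup>+x. ennreal (exp (- \<gamma> * H x)) * indicator {z. H z < T} x \<partial>\<nu>)"
      using D(1) by (subst nn_integral_cmult[symmetric])
        (auto simp: ennreal_mult mult.assoc intro!: borel_\<nu>)
    finally have "ennreal (1 / p) * (ennreal p * emeasure \<nu> ?S) \<le> ennreal (1 / p) * (ennreal (real (Suc m * m)) *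
        (ennreal D * (\<integral>\<^sup>+x. ennreal (exp (- \<gamma> * H x)) * indicator {z. H z < T} x \<partial>\<nu>)))"
      by (rule mult_left_mono) simp
    moreover have "ennreal (1 / p) * (ennreal p * emeasure \<nu> ?S) = emeasure \<nu> ?S"
      using r(1) by (simp add: mult.assoc[symmetric] ennreal_mult[symmetric])
    moreover have "ennreal (1 / p) * (ennreal (real (Suc m * m)) * (ennreal D * I)) = ennreal ?Q * I" for I
    proof -
      have "ennreal a * (ennreal b * (ennreal c * I)) = ennreal (b * c * a) * I"
        if "0 \<le> a" "0 \<le> b" "0 \<le> c" for a b c
        using that by (simp add: ennreal_mult ac_simps)
      from this[of "1 / p" "real (Suc m * m)" D] show ?thesis
        using r(1) D(1) by (simp del: of_nat_Suc of_nat_mult)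
    qed
    ultimately show ?thesis by simp
  qed
  then show ?thesis using that[of ?Q T0] D(1) r(1) by simp
qed

text \<open>With \<open>s k = \<integral> exp (- \<gamma> H) d\<nu>\<close> over \<open>H < k\<close>, the previous estimate reads
\<open>s (k + 1) \<le> (1 + Q exp (- \<gamma> k)) s k\<close>, and the product of these factors converges.\<close>

lemma shell_mass_bounded:
  assumes g: "g \<in> semigroup_of supp" "matnorm g < 1"
  obtains Cu where "0 \<le> Cu" "\<And>k :: nat. emeasure \<nu> {x \<in> nonneg_orthant. real k \<le> H x \<and> H x < real k + 1} \<le> ennreal Cu"
proof -
  obtain Q T0 where Q: "0 \<le> Q" "\<And>T. T0 \<le> T \<Longrightarrow>
    emeasure \<nu> {x \<in> nonneg_orthant. T \<le> H x \<and> H x \<le> T + 1}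
      \<le> ennreal Q * (\<integral>\<^sup>+x. ennreal (exp (- \<gamma> * H x)) * indicator {z. H z < T} x \<partial>\<nu>)"
    using shell_le_sublevel[OF g] by blast
  define s where "s k = (\<integral>\<^sup>+x. ennreal (exp (- \<gamma> * H x)) * indicator {z. H z < real k} x \<partial>\<nu>)" for k
  let ?r = "exp (- \<gamma>)"
  obtain k0 :: nat where k0: "T0 \<le> real k0" using real_arch_simple by blast
  have Hm: "(\<lambda>x. ennreal (exp (- \<gamma> * H x)) * indicator {z. H z < T} x) \<in> borel_measurable \<nu>" for T
    by (rule borel_\<nu>) measurable
  have sfin: "s k < \<top>" for k
  proof -
    have "s k \<le> (\<integral>\<^sup>+x. indicator {x \<in> nonneg_orthant. H x < real k} x \<partial>\<nu>)"
      unfolding s_def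
    proof (rule nn_integral_mono)
      fix x assume "x \<in> space \<nu>"
      then show "ennreal (exp (- \<gamma> * H x)) * indicator {z. H z < real k} x
          \<le> indicator {x \<in> nonneg_orthant. H x < real k} x"
        using \<gamma>_pos by (cases "H x < real k") (auto simp: space_\<nu> intro!: mult_nonneg_nonneg)
    qed
    also have "\<dots> = emeasure \<nu> {x \<in> nonneg_orthant. H x < real k}" by (rule nn_integral_indicator) (rule H_sets)
    also have "\<dots> < \<top>" using H_less_finite by simp
    finally show ?thesis .
  qed
  have u: "emeasure \<nu> {x \<in> nonneg_orthant. real k \<le> H x \<and> H x \<le> real k + 1} \<le> ennreal Q * s k" if "k0 \<le> k" for k
    unfolding s_def using that k0 by (intro Q(2)) linarith
  have step: "s (Suc k) \<le> s k + ennreal (Q * ?r ^ k) * s k" if k: "k0 \<le> k" for k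
  proof -
    let ?S = "{x \<in> nonneg_orthant. real k \<le> H x \<and> H x \<le> real k + 1}"
    have pw: "exp (- \<gamma> * real k) = ?r ^ k" by (simp add: exp_of_nat_mult[symmetric] mult.commute)
    have "s (Suc k) \<le> (\<integral>\<^sup>+x. ennreal (exp (- \<gamma> * H x)) * indicator {z. H z < real k} x + ennreal (?r ^ k) * indicator ?S x \<partial>\<nu>)"
      unfolding s_def
    proof (rule nn_integral_mono)
      fix x assume "x \<in> space \<nu>"
      then have x: "x \<in> nonneg_orthant" by (simp add: space_\<nu>)
      show "ennreal (exp (- \<gamma> * H x)) * indicator {z. H z < real (Suc k)} x
          \<le> ennreal (exp (- \<gamma> * H x)) * indicator {z. H z < real k} x + ennreal (?r ^ k) * indicator ?S x"
      proof (cases "real k \<le> H x \<and> H x < real (Suc k)")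
        case True
        then have "exp (- \<gamma> * H x) \<le> ?r ^ k" using \<gamma>_pos unfolding pw[symmetric] by simp
        then have "ennreal (exp (- \<gamma> * H x)) \<le> ennreal (?r ^ k)" by (rule ennreal_leI)
        then show ?thesis using True x by simp
      qed (auto simp: indicator_def)
    qed
    also have "\<dots> = s k + ennreal (?r ^ k) * emeasure \<nu> ?S"
      unfolding s_def by (subst nn_integral_add[OF Hm]) (auto simp: nn_integral_cmult_indicator H_sets)
    also have "\<dots> \<le> s k + ennreal (?r ^ k) * (ennreal Q * s k)"
      by (intro add_left_mono mult_left_mono u k) simp
    also have "\<dots> = s k + ennreal (Q * ?r ^ k) * s k"
      using Q(1) by (simp add: ennreal_mult ac_simps)
    finally show ?thesis .
  qed
  have r: "0 \<le> ?r" "?r < 1" using \<gamma>_pos by auto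
  obtain S where S: "0 \<le> S" "\<And>k. k0 \<le> k \<Longrightarrow> s k \<le> ennreal S"
    using discrete_gronwall[OF sfin r Q(1) step] by blast
  let ?f = "emeasure \<nu> {x \<in> nonneg_orthant. H x < real k0 + 1}"
  have "emeasure \<nu> {x \<in> nonneg_orthant. real k \<le> H x \<and> H x < real k + 1} \<le> ennreal (Q * S + enn2real ?f)" for k
  proof (cases "k0 \<le> k")
    case True
    have "emeasure \<nu> {x \<in> nonneg_orthant. real k \<le> H x \<and> H x < real k + 1}
        \<le> emeasure \<nu> {x \<in> nonneg_orthant. real k \<le> H x \<and> H x \<le> real k + 1}"
      by (intro emeasure_mono H_sets) auto
    also have "\<dots> \<le> ennreal Q * ennreal S" using u[OF True] S(2)[OF True] by (meson mult_left_mono order_trans zero_le)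
    also have "\<dots> \<le> ennreal (Q * S + enn2real ?f)"
      using Q(1) S(1) by (simp add: ennreal_mult[symmetric] ennreal_leI)
    finally show ?thesis .
  next
    case False
    then have "emeasure \<nu> {x \<in> nonneg_orthant. real k \<le> H x \<and> H x < real k + 1} \<le> ?f"
      by (intro emeasure_mono H_sets) auto
    also have "?f = ennreal (enn2real ?f)" using H_less_finite[of "real k0 + 1"] by simp
    also have "\<dots> \<le> ennreal (Q * S + enn2real ?f)" using Q(1) S(1) by (intro ennreal_leI) simp
    finally show ?thesis .
  qed
  then show ?thesis using Q(1) S(1) by (intro that[of "Q * S + enn2real ?f"]) auto
qed

text \<open>Unit shells have bounded mass, so the integral is dominated by a two-sided geometric series.\<close>

lemma exp_decay_integral:
  assumes Cu: "0 \<le> Cu" "\<And>k :: nat. emeasure \<nu> {x \<in> nonneg_orthant. real k \<le> H x \<and> H x < real k + 1} \<le> ennreal Cu"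
    and c: "0 < c"
  shows "(\<integral>\<^sup>+x. ennreal (exp (- c * \<bar>H x - real n\<bar>)) \<partial>\<nu>) \<le> ennreal (Cu * exp c * (2 / (1 - exp (- c))))"
proof -
  let ?S = "\<lambda>k :: nat. {x \<in> nonneg_orthant. real k \<le> H x \<and> H x < real k + 1}"
  let ?a = "\<lambda>k. exp c * exp (- c * \<bar>real k - real n\<bar>)"
  have "(\<integral>\<^sup>+x. ennreal (exp (- c * \<bar>H x - real n\<bar>)) \<partial>\<nu>) \<le> (\<integral>\<^sup>+x. (\<Sum>k. ennreal (?a k) * indicator (?S k) x) \<partial>\<nu>)"
  proof (rule nn_integral_mono)
    fix x assume "x \<in> space \<nu>"
    then have x: "x \<in> nonneg_orthant" by (simp add: space_\<nu>)
    let ?k = "nat \<lfloor>H x\<rfloor>"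
    have k: "real ?k \<le> H x" "H x < real ?k + 1" using H_nonneg[of x] by linarith+
    have "- c * \<bar>H x - real n\<bar> \<le> c + - c * \<bar>real ?k - real n\<bar>"
    proof -
      have "c * \<bar>real ?k - real n\<bar> \<le> c * (1 + \<bar>H x - real n\<bar>)" using c k by (intro mult_left_mono) linarith+
      then show ?thesis by (simp add: algebra_simps)
    qed
    then have "exp (- c * \<bar>H x - real n\<bar>) \<le> ?a ?k" unfolding exp_add[symmetric] by simp
    then have "ennreal (exp (- c * \<bar>H x - real n\<bar>)) \<le> ennreal (?a ?k) * indicator (?S ?k) x"
      using k x by (simp add: ennreal_leI)
    also have "\<dots> = (\<Sum>k\<in>{?k}. ennreal (?a k) * indicator (?S k) x)" by simp
    also have "\<dots> \<le> (\<Sum>k. ennreal (?a k) * indicator (?S k) x)" by (rule sum_le_suminf) auto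
    finally show "ennreal (exp (- c * \<bar>H x - real n\<bar>)) \<le> (\<Sum>k. ennreal (?a k) * indicator (?S k) x)" .
  qed
  also have "\<dots> = (\<Sum>k. \<integral>\<^sup>+x. ennreal (?a k) * indicator (?S k) x \<partial>\<nu>)"
    by (rule nn_integral_suminf) (intro borel_measurable_times_ennreal borel_measurable_const borel_measurable_indicator H_sets)
  also have "\<dots> = (\<Sum>k. ennreal (?a k) * emeasure \<nu> (?S k))"
    by (intro suminf_cong nn_integral_cmult_indicator H_sets)
  also have "\<dots> \<le> ennreal (Cu * exp c * (2 / (1 - exp (- c))))"
  proof (rule suminf_le_const)
    fix N
    have "(\<Sum>k<N. ennreal (?a k) * emeasure \<nu> (?S k)) \<le> (\<Sum>k<N. ennreal (?a k) * ennreal Cu)"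
      by (intro sum_mono mult_left_mono Cu(2)) simp
    also have "\<dots> = ennreal (Cu * exp c * (\<Sum>k<N. exp (- c * \<bar>real k - real n\<bar>)))"
      using Cu(1) by (simp add: ennreal_mult[symmetric] sum_distrib_left sum_ennreal ac_simps)
    also have "\<dots> \<le> ennreal (Cu * exp c * (2 / (1 - exp (- c))))"
      using Cu(1) two_sided_geometric_sum[OF c, where N = N and n = n] by (intro ennreal_leI mult_left_mono) auto
    finally show "(\<Sum>k<N. ennreal (?a k) * emeasure \<nu> (?S k)) \<le> ennreal (Cu * exp c * (2 / (1 - exp (- c))))" .
  qed simp
  finally show ?thesis .
qed

text \<open>On \<open>H = 0\<close> the tent has its maximal value \<open>n\<close>, and escaping to \<open>H \<ge> 1\<close> lowers its average by at least \<open>p\<close>.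
Invariance forces an equal gain elsewhere, which by \<open>w_substep\<close> happens near level \<open>n\<close>. The part of that
gain at distance more than \<open>R\<close> from level \<open>n\<close> is negligible for large \<open>R\<close> by \<open>exp_decay_integral\<close>.\<close>

lemma window_mass_positive:
  assumes Cu: "0 \<le> Cu" "\<And>k :: nat. emeasure \<nu> {x \<in> nonneg_orthant. real k \<le> H x \<and> H x < real k + 1} \<le> ennreal Cu"
    and D0: "emeasure \<nu> {x \<in> nonneg_orthant. H x = 0} \<noteq> 0"
    and p: "0 < p" and escape: "\<And>x. x \<in> nonneg_orthant \<Longrightarrow>
      ennreal p \<le> (astep ^^ m) (indicator {z \<in> nonneg_orthant. exp (1 + C) \<le> l1norm z}) x"
  obtains R c where "0 < c" "\<And>n :: nat. 1 \<le> n \<Longrightarrow>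
    ennreal c \<le> emeasure \<nu> {x \<in> nonneg_orthant. \<bar>H x - real n\<bar> \<le> R}"
proof -
  obtain D where D: "0 < D" "\<And>T x. x \<in> nonneg_orthant \<Longrightarrow>
    astep (w T) x \<le> w T x + ennreal (D * exp (- \<gamma> * \<bar>H x - T\<bar>))"
    using w_substep by blast
  let ?Z = "{x \<in> nonneg_orthant. H x = 0}"
  let ?E = "{z \<in> nonneg_orthant. exp (1 + C) \<le> l1norm (z :: real^'n)}"
  define d where "d = measure \<nu> ?Z"
  have Zfin: "emeasure \<nu> ?Z < \<infinity>"
  proof -
    have "emeasure \<nu> ?Z \<le> emeasure \<nu> {x \<in> nonneg_orthant. H x < 1}"
      by (intro emeasure_mono H_sets) auto
    then show ?thesis using H_less_finite[of 1] by (rule order.strict_trans1)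
  qed
  then have dZ: "emeasure \<nu> ?Z = ennreal d" by (simp add: d_def emeasure_eq_ennreal_measure less_top[symmetric])
  have d: "0 < d" using D0 unfolding dZ by (simp add: ennreal_eq_0_iff)
  have E_H: "1 \<le> H z" if "z \<in> ?E" for z
  proof -
    have e: "0 < exp (1 + C)" by simp
    have zp: "0 < l1norm z" using that less_le_trans[OF e, of "l1norm z"] by (simp del: l1norm_pos_iff)
    then have "z \<in> punctured_orthant" using that by auto
    moreover have "ln (exp (1 + C)) \<le> ln (l1norm z)"
      using that e zp by (subst ln_le_cancel_iff) auto
    ultimately show ?thesis using H_ge[of z] by simp
  qed
  \<comment> \<open>The balance at level \<open>n\<close>: the loss on \<open>H = 0\<close> is at most the gain near level \<open>n\<close>.\<close>
  have balance: "ennreal (p * d) \<le> of_nat m * (\<integral>\<^sup>+x. ennreal (D * exp (- \<gamma> * \<bar>H x - real n\<bar>)) \<partial>\<nu>)"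
    if n: "1 \<le> n" for n :: nat
  proof -
    let ?g = "\<lambda>x. ennreal (D * exp (- \<gamma> * \<bar>H x - real n\<bar>))"
    let ?w = "w (real n)" and ?I = "\<integral>\<^sup>+x. w (real n) x \<partial>\<nu>"
    have gm: "?g \<in> borel_measurable borel" by measurable
    have m1: "?w \<in> borel_measurable \<nu>" "(astep ^^ i) ?w \<in> borel_measurable \<nu>"
      "(astep ^^ i) ?g \<in> borel_measurable \<nu>" for i
      using w_measurable gm by (auto intro!: borel_\<nu> astep_iterate_measurable)
    have ms: "(\<lambda>x. \<Sum>i<m. (astep ^^ i) ?g x) \<in> borel_measurable \<nu>"
      by (intro borel_measurable_sum m1)
    have mZ: "(\<lambda>x. ennreal p * indicator ?Z x) \<in> borel_measurable \<nu>"
      by (intro borel_measurable_times_ennreal borel_measurable_const borel_measurable_indicator H_sets)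
    have "?I + ennreal (p * d) = (\<integral>\<^sup>+x. (astep ^^ m) ?w x + ennreal p * indicator ?Z x \<partial>\<nu>)"
      using p d H_sets(6)[of 0] by (simp add: nn_integral_add[OF m1(2) mZ] nn_integral_cmult_indicator dZ
          ennreal_mult invariance_iterate[OF w_measurable])
    also have "\<dots> \<le> (\<integral>\<^sup>+x. ?w x + (\<Sum>i<m. (astep ^^ i) ?g x) \<partial>\<nu>)"
    proof (rule nn_integral_mono)
      fix x assume "x \<in> space \<nu>"
      then have x: "x \<in> nonneg_orthant" by (simp add: space_\<nu>)
      show "(astep ^^ m) ?w x + ennreal p * indicator ?Z x \<le> ?w x + (\<Sum>i<m. (astep ^^ i) ?g x)"
      proof (cases "x \<in> ?Z")
        case True
        have Em: "indicator ?E \<in> borel_measurable (borel :: (real^'n) measure)" by measurable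
        have "(astep ^^ m) ?w x + ennreal p \<le> (astep ^^ m) ?w x + (astep ^^ m) (indicator ?E) x"
          by (intro add_left_mono escape x)
        also have "\<dots> = (astep ^^ m) (\<lambda>x. ?w x + indicator ?E x) x"
          by (rule astep_iterate_add[OF w_measurable Em, symmetric])
        also have "\<dots> \<le> (astep ^^ m) (\<lambda>_. ennreal (real n)) x"
        proof (rule astep_iterate_mono[OF _ x])
          fix z :: "real^'n"
          show "?w z + indicator ?E z \<le> ennreal (real n)"
          proof (cases "z \<in> ?E")
            case zE: True
            have "?w z \<le> ennreal (real n - 1)" using E_H[OF zE] by (auto simp: w_def intro!: ennreal_leI)
            then have "?w z + 1 \<le> ennreal (real n - 1) + ennreal 1" by (simp add: add_right_mono)
            also have "\<dots> = ennreal (real n)" using n by (subst ennreal_plus[symmetric]) auto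
            finally show ?thesis using zE by simp
          qed (auto simp: w_def intro!: ennreal_leI)
        qed
        also have "\<dots> = ?w x" using True by (simp add: astep_iterate_const w_def)
        finally show ?thesis using True by (simp add: add_increasing2)
      qed (use astep_iterate_sub[OF w_measurable gm D(2) x] in simp)
    qed
    also have "\<dots> = ?I + of_nat m * (\<integral>\<^sup>+x. ?g x \<partial>\<nu>)"
      by (simp only: nn_integral_add[OF m1(1) ms] integral_astep_sum[OF gm])
    finally show ?thesis using w_integral_finite[of "real n"] by (auto simp: ennreal_add_left_cancel_le)
  qed
  define J where "J = Cu * exp (\<gamma> / 2) * (2 / (1 - exp (- (\<gamma> / 2))))"
  have J: "(\<integral>\<^sup>+x. ennreal (exp (- (\<gamma> / 2) * \<bar>H x - real n\<bar>)) \<partial>\<nu>) \<le> ennreal J" for n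
    unfolding J_def using \<gamma>_pos by (intro exp_decay_integral Cu) auto
  have J0: "0 \<le> J" unfolding J_def using Cu(1) \<gamma>_pos by (intro mult_nonneg_nonneg divide_nonneg_pos) auto
  define K where "K = real m * D + 1"
  have K: "0 < K" "real m * D \<le> K" using D(1) by (auto simp: K_def intro: add_nonneg_pos)
  obtain R where R: "0 \<le> R" "K * J * exp (- (\<gamma> / 2) * R) \<le> p * d / 2"
  proof -
    have "((\<lambda>R. K * J * exp (- (\<gamma> / 2) * R)) \<longlongrightarrow> K * J * 0) at_top"
    proof (intro tendsto_intros)
      have "filterlim (\<lambda>R. \<gamma> / 2 * R) at_top at_top"
        using \<gamma>_pos by (intro filterlim_tendsto_pos_mult_at_top[OF tendsto_const]) (auto intro: filterlim_ident)
      then have "filterlim (\<lambda>R. - (\<gamma> / 2 * R)) at_bot at_top" by (simp add: filterlim_uminus_at_bot)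
      then show "((\<lambda>R. exp (- (\<gamma> / 2) * R)) \<longlongrightarrow> 0) at_top"
        using filterlim_compose[OF exp_at_bot] by simp
    qed
    then have "\<forall>\<^sub>F R in at_top. K * J * exp (- (\<gamma> / 2) * R) < p * d / 2"
      using p d by (intro order_tendstoD(2)[where y = "K * J * 0"]) auto
    then have "\<forall>\<^sub>F R in at_top. 0 \<le> R \<and> K * J * exp (- (\<gamma> / 2) * R) < p * d / 2"
      by (intro eventually_conj eventually_ge_at_top)
    then obtain R where "0 \<le> R" "K * J * exp (- (\<gamma> / 2) * R) < p * d / 2"
      by (auto simp: eventually_at_top_linorder)
    then show ?thesis using that[of R] by simp
  qed
  have "ennreal (p * d / 2 / K) \<le> emeasure \<nu> {x \<in> nonneg_orthant. \<bar>H x - real n\<bar> \<le> R}" if n: "1 \<le> n" for n :: nat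
  proof -
    let ?W = "{x \<in> nonneg_orthant. \<bar>H x - real n\<bar> \<le> R}"
    let ?x = "exp (- (\<gamma> / 2) * R)"
    let ?k = "\<lambda>x. ennreal (exp (- (\<gamma> / 2) * \<bar>H x - real n\<bar>))"
    have km: "?k \<in> borel_measurable \<nu>" by (rule borel_\<nu>) measurable
    have Wm: "indicator ?W \<in> borel_measurable \<nu>" by (intro borel_measurable_indicator H_sets)
    have fin: "emeasure \<nu> ?W < \<infinity>"
    proof -
      have "emeasure \<nu> ?W \<le> emeasure \<nu> {x \<in> nonneg_orthant. H x < real n + R + 1}"
        by (intro emeasure_mono H_sets) auto
      then show ?thesis using H_less_finite by (rule order.strict_trans1)
    qed
    then obtain e where e: "0 \<le> e" "emeasure \<nu> ?W = ennreal e" by (cases "emeasure \<nu> ?W") auto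
    have "(\<integral>\<^sup>+x. ennreal (D * exp (- \<gamma> * \<bar>H x - real n\<bar>)) \<partial>\<nu>)
        \<le> (\<integral>\<^sup>+x. ennreal D * (indicator ?W x + ennreal ?x * ?k x) \<partial>\<nu>)"
    proof (rule nn_integral_mono)
      fix x assume "x \<in> space \<nu>"
      then have x: "x \<in> nonneg_orthant" by (simp add: space_\<nu>)
      let ?u = "\<bar>H x - real n\<bar>"
      have "ennreal (exp (- \<gamma> * ?u)) \<le> indicator ?W x + ennreal ?x * ?k x"
      proof (cases "?u \<le> R")
        case True
        have "ennreal (exp (- \<gamma> * ?u)) \<le> ennreal 1" using \<gamma>_pos by (intro ennreal_leI) simp
        then show ?thesis using True x by (simp add: add_increasing2)
      next
        case False
        have "\<gamma> / 2 * R \<le> \<gamma> / 2 * ?u" using False \<gamma>_pos by (intro mult_left_mono) auto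
        then have "- \<gamma> * ?u \<le> - (\<gamma> / 2) * R + - (\<gamma> / 2) * ?u" by simp
        then have "exp (- \<gamma> * ?u) \<le> ?x * exp (- (\<gamma> / 2) * ?u)" unfolding exp_add[symmetric] by simp
        then have "ennreal (exp (- \<gamma> * ?u)) \<le> ennreal ?x * ?k x"
          by (subst ennreal_mult[symmetric]) (auto intro: ennreal_leI)
        then show ?thesis by (simp add: add_increasing)
      qed
      then have "ennreal D * ennreal (exp (- \<gamma> * ?u)) \<le> ennreal D * (indicator ?W x + ennreal ?x * ?k x)"
        by (rule mult_left_mono) simp
      then show "ennreal (D * exp (- \<gamma> * ?u)) \<le> ennreal D * (indicator ?W x + ennreal ?x * ?k x)"
        using D(1) by (simp add: ennreal_mult)
    qed
    also have "\<dots> = ennreal D * (emeasure \<nu> ?W + ennreal ?x * (\<integral>\<^sup>+x. ?k x \<partial>\<nu>))"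
    proof -
      have "(\<integral>\<^sup>+x. ennreal D * (indicator ?W x + ennreal ?x * ?k x) \<partial>\<nu>)
          = ennreal D * (\<integral>\<^sup>+x. indicator ?W x + ennreal ?x * ?k x \<partial>\<nu>)"
        by (intro nn_integral_cmult borel_measurable_add borel_measurable_times_ennreal Wm km borel_measurable_const)
      also have "(\<integral>\<^sup>+x. indicator ?W x + ennreal ?x * ?k x \<partial>\<nu>)
          = (\<integral>\<^sup>+x. indicator ?W x \<partial>\<nu>) + (\<integral>\<^sup>+x. ennreal ?x * ?k x \<partial>\<nu>)"
        by (intro nn_integral_add borel_measurable_times_ennreal Wm km borel_measurable_const)
      also have "(\<integral>\<^sup>+x. indicator ?W x \<partial>\<nu>) = emeasure \<nu> ?W" by (intro nn_integral_indicator H_sets)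
      also have "(\<integral>\<^sup>+x. ennreal ?x * ?k x \<partial>\<nu>) = ennreal ?x * (\<integral>\<^sup>+x. ?k x \<partial>\<nu>)"
        by (intro nn_integral_cmult km)
      finally show ?thesis .
    qed
    also have "\<dots> \<le> ennreal D * (emeasure \<nu> ?W + ennreal ?x * ennreal J)"
      by (intro mult_left_mono add_left_mono J) auto
    also have "\<dots> = ennreal (D * (e + ?x * J))"
      using e D(1) J0 by (simp add: ennreal_mult ennreal_plus)
    finally have "of_nat m * (\<integral>\<^sup>+x. ennreal (D * exp (- \<gamma> * \<bar>H x - real n\<bar>)) \<partial>\<nu>)
        \<le> ennreal (real m) * ennreal (D * (e + ?x * J))"
      unfolding ennreal_of_nat_eq_real_of_nat by (rule mult_left_mono) simp
    with balance[OF n] have "ennreal (p * d) \<le> ennreal (real m) * ennreal (D * (e + ?x * J))"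
      by (rule order_trans)
    also have "\<dots> = ennreal (real m * D * (e + ?x * J))"
      using D(1) e(1) J0 by (simp add: ennreal_mult[symmetric] mult.assoc)
    finally have "p * d \<le> real m * D * (e + ?x * J)"
      using D(1) e(1) J0 by (subst (asm) ennreal_le_iff) auto
    also have "\<dots> \<le> K * (e + ?x * J)" using K e(1) J0 by (intro mult_right_mono add_nonneg_nonneg) auto
    finally have "p * d \<le> K * e + K * J * ?x" by (simp add: algebra_simps)
    with R(2) have "p * d / 2 \<le> K * e" by linarith
    then have "p * d / 2 / K \<le> e" using K(1) by (simp add: field_simps)
    then show ?thesis unfolding e(2) by (rule ennreal_leI)
  qed
  then show ?thesis using p d K(1) by (intro that[of "p * d / 2 / K" R]) auto
qed

end

section \<open>The mass of annuli\<close>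

context log_harmonic_invariant
begin

lemma annulus_in_\<nu>: "{z \<in> nonneg_orthant. l1norm z \<in> {s..t}} \<in> sets \<nu>"
  by (rule set_in_\<nu>) measurable

text \<open>An annulus with fixed ratio of radii meets a bounded number of unit shells.\<close>

lemma annulus_mass_le:
  assumes Cu: "\<And>k :: nat. emeasure \<nu> {x \<in> nonneg_orthant. real k \<le> H x \<and> H x < real k + 1} \<le> ennreal Cu"
    and Cu0: "0 \<le> Cu" and ab: "0 < a" "a < b"
  obtains C1 where "0 \<le> C1"
    "\<forall>\<^sub>F t in at_top. emeasure \<nu> {z \<in> nonneg_orthant. l1norm z \<in> {t * a..t * b}} \<le> ennreal C1"
proof -
  define N where "N = nat \<lceil>ln b - ln a + 2 * C\<rceil> + 2"
  have N: "ln b - ln a + 2 * C + 1 < real N" unfolding N_def by linarith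
  have "emeasure \<nu> {z \<in> nonneg_orthant. l1norm z \<in> {t * a..t * b}} \<le> ennreal (real N * Cu)"
    if t: "max 1 (1 / a) \<le> t" for t
  proof -
    have t0: "0 < t" and ta: "1 \<le> t * a" using t ab by (auto simp: field_simps)
    define n where "n = nat \<lfloor>max 0 (ln t + ln a - C)\<rfloor>"
    have n: "real n \<le> max 0 (ln t + ln a - C)" "ln t + ln a - C < real n + 1" unfolding n_def by linarith+
    let ?S = "\<lambda>k. {x \<in> nonneg_orthant. real k \<le> H x \<and> H x < real k + 1}"
    have "{z \<in> nonneg_orthant. l1norm z \<in> {t * a..t * b}} \<subseteq> (\<Union>i<N. ?S (n + i))"
    proof
      fix z :: "real^'n" assume "z \<in> {z \<in> nonneg_orthant. l1norm z \<in> {t * a..t * b}}"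
      then have z: "z \<in> nonneg_orthant" "t * a \<le> l1norm z" "l1norm z \<le> t * b" by auto
      have z1: "1 \<le> l1norm z" using z(2) ta by linarith
      then have zp: "z \<in> punctured_orthant" using z(1) by auto
      have ln1: "ln t + ln a \<le> ln (l1norm z)"
      proof -
        have "ln (t * a) \<le> ln (l1norm z)" using z(2) ta z1 by (subst ln_le_cancel_iff) auto
        then show ?thesis using t0 ab by (simp add: ln_mult)
      qed
      have ln2: "ln (l1norm z) \<le> ln t + ln b"
      proof -
        have "ln (l1norm z) \<le> ln (t * b)" using z(3) z1 t0 ab by (subst ln_le_cancel_iff) auto
        then show ?thesis using t0 ab by (simp add: ln_mult)
      qed
      have lo: "real n \<le> H z" using n(1) H_ge[OF zp] ln1 H_nonneg[of z] by linarith
      have hi: "H z < real n + real N" using n(2) H_le_big[OF z(1) z1] ln2 N by linarith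
      define i where "i = nat \<lfloor>H z\<rfloor> - n"
      have fl: "real (nat \<lfloor>H z\<rfloor>) \<le> H z" "H z < real (nat \<lfloor>H z\<rfloor>) + 1" using H_nonneg[of z] by linarith+
      have "n \<le> nat \<lfloor>H z\<rfloor>" using lo by linarith
      then have ni: "n + i = nat \<lfloor>H z\<rfloor>" by (simp add: i_def)
      have "real (n + i) < real n + real N" unfolding ni using fl(1) hi by linarith
      then have "i < N" by simp
      moreover have "z \<in> ?S (n + i)" using fl z(1) unfolding ni by simp
      ultimately show "z \<in> (\<Union>i<N. ?S (n + i))" by blast
    qed
    then have "emeasure \<nu> {z \<in> nonneg_orthant. l1norm z \<in> {t * a..t * b}} \<le> emeasure \<nu> (\<Union>i<N. ?S (n + i))"
      by (rule emeasure_mono) (intro sets.finite_UN H_sets finite_lessThan)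
    also have "\<dots> \<le> (\<Sum>i<N. emeasure \<nu> (?S (n + i)))"
      by (rule emeasure_subadditive_finite) (auto intro!: H_sets)
    also have "\<dots> \<le> (\<Sum>i<N. ennreal Cu)" by (intro sum_mono Cu)
    also have "\<dots> = ennreal (real N * Cu)"
      using Cu0 by (simp add: ennreal_of_nat_eq_real_of_nat ennreal_mult)
    finally show ?thesis .
  qed
  then have "\<forall>\<^sub>F t in at_top. emeasure \<nu> {z \<in> nonneg_orthant. l1norm z \<in> {t * a..t * b}} \<le> ennreal (real N * Cu)"
    unfolding eventually_at_top_linorder by blast
  then show ?thesis using Cu0 by (intro that[of "real N * Cu"]) auto
qed

text \<open>The window at level \<open>n\<close>, with \<open>n\<close> close to \<open>ln t\<close>, lies in \<open>t K\<close> for a fixed compact set \<open>K\<close>; from there the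
annulus is reached within \<open>m\<close> steps with probability at least \<open>p\<close>.\<close>

lemma annulus_mass_ge:
  assumes win: "\<And>n :: nat. 1 \<le> n \<Longrightarrow> ennreal c \<le> emeasure \<nu> {x \<in> nonneg_orthant. \<bar>H x - real n\<bar> \<le> R}"
    and c: "0 < c"
    and orbit: "\<And>x. x \<in> punctured_orthant \<Longrightarrow> \<exists>g\<in>semigroup_of supp. a < l1norm (g *v x) \<and> l1norm (g *v x) < b"
  obtains c1 where "0 < c1"
    "\<forall>\<^sub>F t in at_top. ennreal c1 \<le> emeasure \<nu> {z \<in> nonneg_orthant. l1norm z \<in> {t * a..t * b}}"
proof -
  define K where "K = {y \<in> nonneg_orthant. l1norm (y :: real^'n) \<le> exp (1 + R + C)} \<inter> {y. exp (- R - C) \<le> l1norm y}"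
  define V where "V = {z :: real^'n. a < l1norm z} \<inter> {z. l1norm z < b}"
  have K: "compact K" unfolding K_def
    by (intro compact_Int_closed compact_orthant_ball closed_Collect_le continuous_intros)
  have V: "open V" unfolding V_def by (intro open_Int open_Collect_less continuous_intros)
  have orb: "\<exists>g\<in>semigroup_of supp. g *v x \<in> V" if "x \<in> K" for x
  proof -
    have "0 < exp (- R - C)" by simp
    also have "exp (- R - C) \<le> l1norm x" using that by (simp add: K_def)
    finally have "x \<in> punctured_orthant" using that by (simp add: K_def)
    from orbit[OF this] show ?thesis by (simp add: V_def)
  qed
  obtain m p t0 where r: "0 < p" "0 < t0"
    "\<And>t y. t0 \<le> t \<Longrightarrow> y \<in> K \<Longrightarrow> y \<in> nonneg_orthant \<Longrightarrow>
      \<exists>k\<le>m. ennreal p \<le> (astep ^^ k) (indicator {z. (1 / t) *\<^sub>R z \<in> V}) (t *\<^sub>R y)"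
  proof (rule reaches_uniformly[OF K V orb])
    fix m p t0 assume a: "0 < p" "0 < t0"
      and b: "\<And>t y. t0 \<le> t \<Longrightarrow> y \<in> K \<Longrightarrow> y \<in> nonneg_orthant \<Longrightarrow>
        \<exists>k\<le>m. ennreal p \<le> (astep ^^ k) (indicator {z. (1 / t) *\<^sub>R z \<in> V}) (t *\<^sub>R y)"
    show thesis by (rule that[OF a b])
  qed
  let ?t1 = "max t0 (exp (max 1 (R + C + 1)))"
  have "ennreal (p * c / real (Suc m)) \<le> emeasure \<nu> {z \<in> nonneg_orthant. l1norm z \<in> {t * a..t * b}}"
    if t: "?t1 \<le> t" for t
  proof -
    have t': "t0 \<le> t" "exp (max 1 (R + C + 1)) \<le> t" using t by auto
    have tp: "0 < t" using t'(2) exp_gt_zero[of "max 1 (R + C + 1)"] by linarith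
    have lt: "max 1 (R + C + 1) \<le> ln t"
      using t'(2) tp by (subst ln_ge_iff) auto
    define n where "n = nat \<lceil>ln t\<rceil>"
    have n: "ln t \<le> real n" "real n \<le> ln t + 1" "1 \<le> n" using lt unfolding n_def by linarith+
    let ?W = "{x \<in> nonneg_orthant. \<bar>H x - real n\<bar> \<le> R}"
    let ?F = "{z :: real^'n. l1norm z \<in> {t * a..t * b}}"
    have Fm: "indicator ?F \<in> borel_measurable (borel :: (real^'n) measure)" by measurable
    have "ennreal p * ennreal c \<le> ennreal p * emeasure \<nu> ?W" by (intro mult_left_mono win n) simp
    also have "\<dots> = (\<integral>\<^sup>+x. ennreal p * indicator ?W x \<partial>\<nu>)"
      by (rule nn_integral_cmult_indicator[symmetric]) (rule H_sets)
    also have "\<dots> \<le> (\<integral>\<^sup>+x. (\<Sum>k<Suc m. (astep ^^ k) (indicator ?F) x) \<partial>\<nu>)"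
    proof (rule nn_integral_mono)
      fix x assume "x \<in> space \<nu>"
      show "ennreal p * indicator ?W x \<le> (\<Sum>k<Suc m. (astep ^^ k) (indicator ?F) x)"
      proof (cases "x \<in> ?W")
        case True
        then have x: "x \<in> nonneg_orthant" "\<bar>H x - real n\<bar> \<le> R" by auto
        have "C < H x" using x(2) n(1) lt by linarith
        then have big: "1 \<le> l1norm x" using H_le_small[OF x(1)] by linarith
        then have xp: "x \<in> punctured_orthant" "0 < l1norm x" using x(1) by auto
        have "ln t + (- R - C) \<le> ln (l1norm x)" using H_le_big[OF x(1) big] x(2) n(1) by linarith
        then have "exp (ln t + (- R - C)) \<le> exp (ln (l1norm x))" by simp
        then have lo: "t * exp (- R - C) \<le> l1norm x" using tp xp by (simp only: exp_add exp_ln)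
        have "ln (l1norm x) \<le> ln t + (1 + R + C)" using H_ge[OF xp(1)] x(2) n(2) by linarith
        then have "exp (ln (l1norm x)) \<le> exp (ln t + (1 + R + C))" by simp
        then have hi: "l1norm x \<le> t * exp (1 + R + C)" using tp xp by (simp only: exp_add exp_ln)
        let ?y = "(1 / t) *\<^sub>R x"
        have yo: "?y \<in> nonneg_orthant" using x(1) tp by (intro orthant_scaleR) auto
        have yn: "l1norm ?y = l1norm x / t" using tp by simp
        have "?y \<in> K" unfolding K_def using yo yn lo hi tp by (simp add: field_simps)
        then obtain k where k: "k \<le> m" "ennreal p \<le> (astep ^^ k) (indicator {z. (1 / t) *\<^sub>R z \<in> V}) (t *\<^sub>R ?y)"
          using r(3)[OF t'(1) _ yo] by blast
        have "ennreal p \<le> (astep ^^ k) (indicator {z. (1 / t) *\<^sub>R z \<in> V}) x" using k(2) tp by simp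
        also have "\<dots> \<le> (astep ^^ k) (indicator ?F) x"
        proof (rule astep_iterate_mono[OF _ x(1)])
          fix z :: "real^'n"
          have "(1 / t) *\<^sub>R z \<in> V \<Longrightarrow> z \<in> ?F" using tp by (simp add: V_def field_simps)
          then show "indicator {z. (1 / t) *\<^sub>R z \<in> V} z \<le> (indicator ?F z :: ennreal)"
            by (auto simp: indicator_def)
        qed
        also have "\<dots> \<le> (\<Sum>k<Suc m. (astep ^^ k) (indicator ?F) x)" using k(1) by (intro member_le_sum) auto
        finally show ?thesis using True by simp
      qed simp
    qed
    also have "\<dots> = of_nat (Suc m) * (\<integral>\<^sup>+x. indicator ?F x \<partial>\<nu>)" by (rule integral_astep_sum[OF Fm])
    also have "(\<integral>\<^sup>+x. indicator ?F x \<partial>\<nu>) = (\<integral>\<^sup>+x. indicator {z \<in> nonneg_orthant. l1norm z \<in> {t * a..t * b}} x \<partial>\<nu>)"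
      by (rule nn_integral_cong) (auto simp: space_\<nu> indicator_def)
    also have "\<dots> = emeasure \<nu> {z \<in> nonneg_orthant. l1norm z \<in> {t * a..t * b}}"
      by (rule nn_integral_indicator[OF annulus_in_\<nu>])
    finally have "ennreal (1 / real (Suc m)) * (ennreal p * ennreal c)
        \<le> ennreal (1 / real (Suc m)) * (of_nat (Suc m) * emeasure \<nu> {z \<in> nonneg_orthant. l1norm z \<in> {t * a..t * b}})"
      by (rule mult_left_mono) simp
    moreover have "ennreal (1 / real (Suc m)) * (ennreal p * ennreal c) = ennreal (p * c / real (Suc m))"
      using r(1) c by (simp add: ennreal_mult[symmetric] del: of_nat_Suc)
    moreover have "ennreal (1 / real (Suc m)) * (of_nat (Suc m) * I) = I" for I
      by (simp add: ennreal_of_nat_eq_real_of_nat mult.assoc[symmetric] ennreal_mult[symmetric] del: of_nat_Suc)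
    ultimately show ?thesis by simp
  qed
  then have "\<forall>\<^sub>F t in at_top. ennreal (p * c / real (Suc m)) \<le> emeasure \<nu> {z \<in> nonneg_orthant. l1norm z \<in> {t * a..t * b}}"
    unfolding eventually_at_top_linorder by blast
  then show ?thesis using r(1) c by (intro that[of "p * c / real (Suc m)"]) auto
qed

end

text \<open>Subtracting a constant from \<open>h\<close> moves the level at which \<open>H\<close> is cut off.\<close>

lemma (in affine_pair) loglike_shift:
  fixes C s :: real
  assumes h: "loglike C h" "avg h = h"
  defines "h' \<equiv> \<lambda>x. if x \<in> punctured_orthant then h x - s else 0"
  shows "loglike (C + \<bar>s\<bar>) h'" "avg h' = h'"
proof -
  have m: "h \<in> borel_measurable borel" by (rule loglike_measurable[OF h(1)])
  show "loglike (C + \<bar>s\<bar>) h'"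
    unfolding loglike_def
  proof (intro conjI ballI allI impI)
    show "h' \<in> borel_measurable borel" unfolding h'_def using m by measurable
    show "h' x = 0" if "x \<notin> punctured_orthant" for x unfolding h'_def using that by (rule if_not_P)
    fix x :: "real^'n" assume x: "x \<in> punctured_orthant"
    have hx: "h' x = h x - s" unfolding h'_def using x by (rule if_P)
    { fix c :: real assume c: "0 < c"
      have "h' (c *\<^sub>R x) = h (c *\<^sub>R x) - s"
        unfolding h'_def using punctured_orthant_scaleR[OF x c] by (rule if_P)
      then show "h' (c *\<^sub>R x) = h' x + ln c" using loglike_scale[OF h(1) x c] hx by simp }
    { fix y assume y: "\<forall>i. x $ i \<le> y $ i"
      have "h' y = h y - s"
        unfolding h'_def using punctured_orthant_upward[OF x y[rule_format]] by (rule if_P)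
      then show "h' x \<le> h' y" using loglike_mono[OF h(1) x y[rule_format]] hx by simp }
    show "\<bar>h' x - ln (l1norm x)\<bar> \<le> C + \<bar>s\<bar>" using loglike_bound[OF h(1) x] hx by linarith
  qed
  show "avg h' = h'"
  proof
    fix x
    show "avg h' x = h' x"
    proof (cases "x \<in> punctured_orthant")
      case x: True
      have "avg h' x = (\<integral>\<omega>. h' (A \<omega> *v x) \<partial>M)" unfolding avg_def using x by (rule if_P)
      also have "\<dots> = (\<integral>\<omega>. h (A \<omega> *v x) - s \<partial>M)"
        using A_punctured[OF _ x] by (intro Bochner_Integration.integral_cong) (auto simp: h'_def)
      also have "\<dots> = (\<integral>\<omega>. h (A \<omega> *v x) \<partial>M) - s"
        using avg_integrable[OF h(1) x] by (simp add: prob_space)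
      also have "(\<integral>\<omega>. h (A \<omega> *v x) \<partial>M) = avg h x" unfolding avg_def using x by (rule if_P[symmetric])
      also have "avg h x - s = h' x" unfolding h(2) h'_def using x by (rule if_P[symmetric])
      finally show ?thesis .
    next
      case False
      have "avg h' x = 0" unfolding avg_def using False by (rule if_not_P)
      moreover have "h' x = 0" unfolding h'_def using False by (rule if_not_P)
      ultimately show ?thesis by simp
    qed
  qed
qed

lemma spec_radius_bounds:
  fixes g :: "real^'n^'n"
  assumes g: "g \<in> pos_matrices"
  shows "iota_min g \<le> spec_radius g" "spec_radius g \<le> matnorm g"
proof -
  obtain u v \<rho> where uv: "\<And>i. 0 < u $ i" "\<And>i. 0 < v $ i" "0 < \<rho>"
    "g *v v = \<rho> *\<^sub>R v" "u v* g = \<rho> *\<^sub>R u"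
    using perron_pair[OF g] by metis
  have sr: "spec_radius g = \<rho>" by (rule spec_radius_eq_perron_root[OF g uv])
  have al: "g \<in> allowable" using g pos_matrices_allowable by blast
  have v: "v \<in> nonneg_orthant" using uv(2) by (simp add: nonneg_orthant_def less_imp_le)
  have "v \<noteq> 0" using uv(2) by (metis less_irrefl zero_index)
  then have lv: "0 < l1norm v" by simp
  show "iota_min g \<le> spec_radius g"
    using l1norm_mult_ge[OF al v] uv(3) lv unfolding uv(4) sr by (simp del: l1norm_pos_iff)
  show "spec_radius g \<le> matnorm g"
    using l1norm_mult_le[OF al v] uv(3) lv unfolding uv(4) sr by (simp del: l1norm_pos_iff)
qed

lemma pos_matrices_mult:
  assumes "g \<in> pos_matrices" "h \<in> pos_matrices"
  shows "g ** h \<in> (pos_matrices :: (real^'n^'n) set)"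
  using assms unfolding pos_matrices_def matrix_matrix_mult_def by (auto intro!: sum_pos)

lemma closed_semigroup_gen_mult:
  "g \<in> closed_semigroup_gen S \<Longrightarrow> h \<in> closed_semigroup_gen S \<Longrightarrow> g ** h \<in> closed_semigroup_gen S"
  unfolding closed_semigroup_gen_def by auto

lemma semigroup_of_subset_closed_semigroup_gen: "semigroup_of S \<subseteq> closed_semigroup_gen S"
  unfolding closed_semigroup_gen_def by (intro Inter_greatest semigroup_of_subset) auto

text \<open>By continuity of the product, the closure of a semigroup of allowable matrices, intersected with the
allowable matrices, is again a semigroup.\<close>

lemma closed_semigroup_gen_subset_closure:
  fixes S :: "(real^'n^'n) set"
  assumes S: "S \<subseteq> allowable"
  shows "closed_semigroup_gen S \<subseteq> closure (semigroup_of S)"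
proof -
  let ?T = "allowable \<inter> closure (semigroup_of S)"
  have "S \<subseteq> ?T" using S semigroup_of.base closure_subset by blast
  moreover have "closedin (top_of_set allowable) ?T" by (rule closedin_closed_Int) simp
  moreover have "g ** h \<in> ?T" if g: "g \<in> ?T" and h: "h \<in> ?T" for g h
  proof -
    have al: "g ** h \<in> allowable" using g h by (intro allowable_mult) auto
    have "g \<in> closure (semigroup_of S)" "h \<in> closure (semigroup_of S)" using g h by auto
    then obtain f k where f: "\<And>n. f n \<in> semigroup_of S" "f \<longlonglongrightarrow> g" and k: "\<And>n. k n \<in> semigroup_of S" "k \<longlonglongrightarrow> h"
      unfolding closure_sequential by metis
    have "(\<lambda>n. f n ** k n) \<longlonglongrightarrow> g ** h"
      unfolding matrix_matrix_mult_def by (intro tendsto_intros f k)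
    then have "g ** h \<in> closure (semigroup_of S)"
      unfolding closure_sequential using semigroup_of_mult[OF f(1) k(1)]
      by (intro exI[of _ "\<lambda>n. f n ** k n"]) auto
    then show ?thesis using al by simp
  qed
  ultimately have "closed_semigroup_gen S \<subseteq> ?T"
    unfolding closed_semigroup_gen_def by (intro Inter_lower) auto
  then show ?thesis by blast
qed

theorem theorem2p2:
  fixes M :: "'w measure"
    and A :: "'w \<Rightarrow> real^'n^'n" and B :: "'w \<Rightarrow> real^'n"
    and As :: "nat \<Rightarrow> 'w \<Rightarrow> real^'n^'n" and Bs :: "nat \<Rightarrow> 'w \<Rightarrow> real^'n"
    and S \<Gamma> :: "(real^'n^'n) set"
    and \<kappa> :: real
    and \<nu> :: "(real^'n) measure"
  assumes prob: "prob_space M"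
    and meas: "A \<in> borel_measurable M" "B \<in> borel_measurable M"
    and vals: "\<forall>\<omega>\<in>space M. A \<omega> \<in> allowable \<and> B \<omega> \<in> nonneg_orthant"
    and copies_indep: "prob_space.indep_vars M (\<lambda>_. borel) (\<lambda>n \<omega>. (As n \<omega>, Bs n \<omega>)) {1..}"
    and copies_distr: "\<forall>n\<ge>1. distr M borel (\<lambda>\<omega>. (As n \<omega>, Bs n \<omega>)) =
                              distr M borel (\<lambda>\<omega>. (A \<omega>, B \<omega>))"
    and S_def: "S = msupport (distr M borel A)"
    and \<Gamma>_def: "\<Gamma> = closed_semigroup_gen S"
    and H1: "\<Gamma> \<subseteq> allowable" "\<Gamma> \<inter> pos_matrices \<noteq> {}"
    and H2: "\<exists>\<delta>>0. (\<integral>\<^sup>+\<omega>. ennreal (Nmax (A \<omega>) powr \<delta>) \<partial>M) < \<infinity> \<and>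
                   measure M {\<omega>\<in>space M. iota_min (A \<omega>) \<ge> 1 + \<delta>} > 0 \<and>
                   (\<integral>\<^sup>+\<omega>. ennreal (l1norm (B \<omega>) powr \<delta>) \<partial>M) < \<infinity> \<and>
                   (\<integral>\<^sup>+\<omega>. inverse (ennreal (l1norm (B \<omega>) powr \<delta>)) \<partial>M) < \<infinity>"
    and H3: "closure (group_closure ((\<lambda>g. ln (spec_radius g)) ` (\<Gamma> \<inter> pos_matrices))) = UNIV"
    and H4: "AE \<omega> in M. (\<lambda>n. ln (matnorm (left_prod (\<lambda>k. As k \<omega>) n)) / real n) \<longlonglongrightarrow> 0"
    and H5: "\<kappa> > 1"
            "\<forall>g\<in>S. (\<forall>i j. 0 < g $ i $ j) \<and>
                   Max (range (\<lambda>(i, j). g $ i $ j)) / Min (range (\<lambda>(i, j). g $ i $ j)) \<le> \<kappa>"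
    and H6: "\<not> (\<exists>W. affine W \<and> (\<exists>w\<in>W \<inter> nonneg_orthant. w \<noteq> 0) \<and> bounded (W \<inter> nonneg_orthant) \<and>
                   (\<forall>g\<in>S. \<forall>w\<in>W \<inter> nonneg_orthant. g *v w \<in> W \<inter> nonneg_orthant))"
    and \<nu>_radon: "radon_on_orthant \<nu>"
    and \<nu>_nonzero: "emeasure \<nu> (space \<nu>) \<noteq> 0"
    and \<nu>_inv: "invariant_measure M A B \<nu>"
  shows "\<forall>a b::real. 0 < a \<and> a < b \<longrightarrow>
           (\<exists>c\<^sub>1 C\<^sub>1 :: real. 0 \<le> c\<^sub>1 \<and> c\<^sub>1 \<le> C\<^sub>1 \<and>
              ennreal c\<^sub>1 \<le> Liminf at_top (\<lambda>t::real. emeasure \<nu> {z\<in>nonneg_orthant. l1norm z \<in> {t * a..t * b}}) \<and>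
              Liminf at_top (\<lambda>t::real. emeasure \<nu> {z\<in>nonneg_orthant. l1norm z \<in> {t * a..t * b}})
                \<le> Limsup at_top (\<lambda>t::real. emeasure \<nu> {z\<in>nonneg_orthant. l1norm z \<in> {t * a..t * b}}) \<and>
              Limsup at_top (\<lambda>t::real. emeasure \<nu> {z\<in>nonneg_orthant. l1norm z \<in> {t * a..t * b}}) \<le> ennreal C\<^sub>1 \<and>
              (b / a > \<kappa> * real CARD('n) \<longrightarrow> 0 < c\<^sub>1))"
proof (intro allI impI)
  fix a b :: real assume ab: "0 < a \<and> a < b"
  interpret P: prob_space M by (rule prob)
  have A_al: "A \<omega> \<in> allowable" if "\<omega> \<in> space M" for \<omega> using vals that by blast
  have B_o: "B \<omega> \<in> nonneg_orthant" if "\<omega> \<in> space M" for \<omega> using vals that by blast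
  note [measurable] = meas Nmax_measurable[OF meas(1) A_al]
  obtain \<delta> where \<delta>: "0 < \<delta>" "(\<integral>\<^sup>+\<omega>. ennreal (Nmax (A \<omega>) powr \<delta>) \<partial>M) < \<infinity>"
    "0 < measure M {\<omega>\<in>space M. 1 + \<delta> \<le> iota_min (A \<omega>)}"
    "(\<integral>\<^sup>+\<omega>. ennreal (l1norm (B \<omega>) powr \<delta>) \<partial>M) < \<infinity>"
    "(\<integral>\<^sup>+\<omega>. inverse (ennreal (l1norm (B \<omega>) powr \<delta>)) \<partial>M) < \<infinity>"
    using H2 by auto
  \<comment> \<open>At most \<open>1\<close>, as needed for \<open>ln (1 + u) \<le> u\<^sup>\<gamma> / \<gamma>\<close>, and at most \<open>\<delta> / 2\<close>, so that \<open>2 \<gamma>\<close>-moments exist.\<close>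
  define \<gamma> where "\<gamma> = min \<delta> 1 / 2"
  have \<gamma>: "0 < \<gamma>" "\<gamma> \<le> 1" "2 * \<gamma> \<le> \<delta>" using \<delta>(1) by (auto simp: \<gamma>_def min_def)
  have AE_S: "AE \<omega> in M. A \<omega> \<in> S" unfolding S_def by (rule AE_msupport[OF meas(1) A_al])
  have S_bal: "g $ i $ j \<le> \<kappa> * g $ i $ k" if g: "g \<in> S" for g i j k
  proof -
    let ?R = "range (\<lambda>(i, j). g $ i $ j)"
    have pos: "0 < g $ i $ j" for i j using H5(2) g by blast
    have "Min ?R \<in> ?R" by (intro Min_in) auto
    then have m: "0 < Min ?R" using pos by auto
    have "g $ i $ j \<le> Max ?R" by (intro Max_ge) auto
    also have "\<dots> \<le> \<kappa> * Min ?R" using H5(2) g m by (auto simp: divide_le_eq)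
    also have "\<dots> \<le> \<kappa> * g $ i $ k" using H5(1) by (intro mult_left_mono Min_le) auto
    finally show ?thesis .
  qed
  interpret affine_pair M A B \<kappa> \<gamma>
  proof
    show "AE \<omega> in M. \<forall>i j k. A \<omega> $ i $ j \<le> \<kappa> * A \<omega> $ i $ k"
      using AE_S by eventually_elim (use S_bal in blast)
    show "integrable M (\<lambda>\<omega>. Nmax (A \<omega>) powr (2 * \<gamma>))"
    proof (rule Bochner_Integration.integrable_bound[where f = "\<lambda>\<omega>. Nmax (A \<omega>) powr \<delta>"])
      show "integrable M (\<lambda>\<omega>. Nmax (A \<omega>) powr \<delta>)"
        using \<delta>(2) by (intro integrableI_nonneg) auto
      show "AE \<omega> in M. norm (Nmax (A \<omega>) powr (2 * \<gamma>)) \<le> norm (Nmax (A \<omega>) powr \<delta>)"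
        using Nmax_ge_1[OF A_al] \<gamma>(3) by (intro AE_I2) (auto intro!: powr_mono)
    qed measurable
    show "integrable M (\<lambda>\<omega>. l1norm (B \<omega>) powr (2 * \<gamma>))"
    proof (rule Bochner_Integration.integrable_bound[where f = "\<lambda>\<omega>. 1 + l1norm (B \<omega>) powr \<delta>"])
      have "integrable M (\<lambda>\<omega>. l1norm (B \<omega>) powr \<delta>)"
        using \<delta>(4) by (intro integrableI_nonneg) auto
      then show "integrable M (\<lambda>\<omega>. 1 + l1norm (B \<omega>) powr \<delta>)" by simp
      have "r powr (2 * \<gamma>) \<le> 1 + r powr \<delta>" if r: "0 \<le> r" for r :: real
      proof (cases "r \<le> 1")
        case True
        then have "r powr (2 * \<gamma>) \<le> 1" using r \<gamma>(1) by (intro powr_le1) auto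
        then show ?thesis by (simp add: add_increasing2)
      next
        case False
        then have "r powr (2 * \<gamma>) \<le> r powr \<delta>" using \<gamma>(3) by (intro powr_mono) auto
        then show ?thesis by simp
      qed
      then show "AE \<omega> in M. norm (l1norm (B \<omega>) powr (2 * \<gamma>)) \<le> norm (1 + l1norm (B \<omega>) powr \<delta>)"
        by (intro AE_I2) simp
    qed measurable
  qed (use meas A_al B_o H5(1) \<gamma> in auto)
  interpret I: affine_invariant M A B \<kappa> \<gamma> \<nu>
    by unfold_locales (rule \<nu>_radon, rule \<nu>_inv)
  have fst_meas: "fst \<in> borel_measurable (borel :: ((real^'n^'n) \<times> (real^'n)) measure)"
    by (intro borel_measurable_continuous_onI continuous_intros)
  have As_indep: "P.indep_vars (\<lambda>_. borel) As {1..}"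
    using P.indep_vars_compose2[OF copies_indep, of "\<lambda>_. fst" "\<lambda>_. borel"] fst_meas by simp
  have As_distr: "distr M borel (As k) = distr M borel A" if k: "1 \<le> k" for k
  proof -
    have pm: "(\<lambda>\<omega>. (As k \<omega>, Bs k \<omega>)) \<in> borel_measurable M"
      using copies_indep k by (auto simp: P.indep_vars_def)
    have am: "(\<lambda>\<omega>. (A \<omega>, B \<omega>)) \<in> borel_measurable M" by (rule borel_measurable_Pair[OF meas])
    have "distr M borel (As k) = distr (distr M borel (\<lambda>\<omega>. (As k \<omega>, Bs k \<omega>))) borel fst"
      by (subst distr_distr[OF fst_meas pm]) (simp add: comp_def)
    also have "\<dots> = distr (distr M borel (\<lambda>\<omega>. (A \<omega>, B \<omega>))) borel fst" using copies_distr k by simp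
    also have "\<dots> = distr M borel A" by (subst distr_distr[OF fst_meas am]) (simp add: comp_def)
    finally show ?thesis .
  qed
  obtain h0 C0 where h0: "loglike C0 h0" "avg h0 = h0"
    by (rule harmonic_exists[OF growth_bounded[OF growth_rate_zero[OF As_indep As_distr H4]]])
  obtain r0 :: nat where r0: "1 \<le> r0" "emeasure \<nu> {x \<in> nonneg_orthant. l1norm x \<le> real r0} \<noteq> 0"
  proof (rule ccontr)
    assume no: "\<not> thesis"
    have "emeasure \<nu> {x \<in> nonneg_orthant. l1norm x \<le> real (Suc n)} = 0" for n
      using no that[of "Suc n"] by auto
    then have "{x \<in> nonneg_orthant. l1norm x \<le> real (Suc n)} \<in> null_sets \<nu>" for n
      using I.ball_in_\<nu> by (auto simp: null_sets_def)
    then have "(\<Union>n. {x \<in> nonneg_orthant. l1norm x \<le> real (Suc n)}) \<in> null_sets \<nu>" by (rule null_sets_UN)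
    moreover have "(\<Union>n. {x \<in> nonneg_orthant. l1norm (x :: real^'n) \<le> real (Suc n)}) = space \<nu>"
    proof -
      have "\<exists>n. l1norm x \<le> real (Suc n)" for x :: "real^'n"
        using real_arch_simple[of "l1norm x"] by (metis le_SucI order_trans of_nat_mono le_refl of_nat_le_iff)
      then show ?thesis unfolding I.space_\<nu> by blast
    qed
    ultimately show False using \<nu>_nonzero by (simp add: null_sets_def)
  qed
  \<comment> \<open>The harmonic function is normalised so that \<open>H\<close> vanishes on a ball of positive mass.\<close>
  define s where "s = C0 + ln (real r0)"
  define h where "h = (\<lambda>x. if x \<in> punctured_orthant then h0 x - s else 0)"
  have h: "loglike (C0 + \<bar>s\<bar>) h" "avg h = h"
    unfolding h_def by (rule loglike_shift[OF h0])+
  interpret L: log_harmonic_invariant M A B \<kappa> \<gamma> h "C0 + \<bar>s\<bar>" \<nu>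
    by unfold_locales (rule h)+
  have Z: "emeasure \<nu> {x \<in> nonneg_orthant. L.H x = 0} \<noteq> 0"
  proof
    assume 0: "emeasure \<nu> {x \<in> nonneg_orthant. L.H x = 0} = 0"
    have "{x \<in> nonneg_orthant. l1norm x \<le> real r0} \<subseteq> {x \<in> nonneg_orthant. L.H x = 0}"
    proof clarsimp
      fix x :: "real^'n" assume x: "x \<in> nonneg_orthant" "l1norm x \<le> real r0"
      show "L.H x = 0"
      proof (cases "x = 0")
        case False
        then have xp: "x \<in> punctured_orthant" using x by simp
        have "ln (l1norm x) \<le> ln (real r0)" using x False r0(1) by (subst ln_le_cancel_iff) auto
        then have "h0 x \<le> s" using loglike_bound[OF h0(1) xp] by (simp add: s_def abs_le_iff)
        moreover have "h x = h0 x - s" unfolding h_def using xp by (rule if_P)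
        ultimately show ?thesis by (simp add: L.H_def)
      qed simp
    qed
    then have "emeasure \<nu> {x \<in> nonneg_orthant. l1norm x \<le> real r0} \<le> 0"
      unfolding 0[symmetric] by (intro emeasure_mono L.H_sets)
    then show False using r0(2) by simp
  qed
  obtain g0 where g0: "g0 \<in> semigroup_of supp" "matnorm g0 < 1"
    using contracting_element[OF h \<delta>(1,3)] by blast
  have B0: "0 < measure M {\<omega> \<in> space M. B \<omega> \<noteq> 0}"
  proof -
    have "AE \<omega> in M. inverse (ennreal (l1norm (B \<omega>) powr \<delta>)) \<noteq> \<infinity>"
      using \<delta>(5) by (intro nn_integral_PInf_AE) auto
    then have "AE \<omega> in M. B \<omega> \<noteq> 0" by eventually_elim auto
    then have "measure M {\<omega> \<in> space M. B \<omega> \<noteq> 0} = 1" by (subst P.prob_Collect_eq_1) auto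
    then show ?thesis by simp
  qed
  obtain m p where esc: "0 < p" "\<And>x. x \<in> nonneg_orthant \<Longrightarrow>
      ennreal p \<le> (astep ^^ m) (indicator {z \<in> nonneg_orthant. exp (1 + (C0 + \<bar>s\<bar>)) \<le> l1norm z}) x"
    using escape_probability[OF \<delta>(1,3) B0, of "exp (1 + (C0 + \<bar>s\<bar>))"] by blast
  obtain Cu where Cu: "0 \<le> Cu"
    "\<And>k :: nat. emeasure \<nu> {x \<in> nonneg_orthant. real k \<le> L.H x \<and> L.H x < real k + 1} \<le> ennreal Cu"
    using L.shell_mass_bounded[OF g0] by blast
  obtain R c where win: "0 < c" "\<And>n :: nat. 1 \<le> n \<Longrightarrow>
    ennreal c \<le> emeasure \<nu> {x \<in> nonneg_orthant. \<bar>L.H x - real n\<bar> \<le> R}"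
    using L.window_mass_positive[OF Cu Z esc] by blast
  have pos_S: "S \<subseteq> pos_matrices" using H5(2) by (auto simp: pos_matrices_def)
  have semi_pos: "semigroup_of S \<subseteq> pos_matrices" by (rule semigroup_of_subset[OF pos_S pos_matrices_mult])
  have semi_\<Gamma>: "semigroup_of S \<subseteq> \<Gamma>" unfolding \<Gamma>_def by (rule semigroup_of_subset_closed_semigroup_gen)
  obtain p1 where p1: "p1 \<in> \<Gamma> \<inter> pos_matrices" "1 < spec_radius p1"
  proof -
    have "\<exists>\<omega>\<in>space M. A \<omega> \<in> S \<and> 1 + \<delta> \<le> iota_min (A \<omega>)"
    proof (rule ccontr)
      assume no: "\<not> (\<exists>\<omega>\<in>space M. A \<omega> \<in> S \<and> 1 + \<delta> \<le> iota_min (A \<omega>))"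
      have "AE \<omega> in M. \<not> 1 + \<delta> \<le> iota_min (A \<omega>)"
        using AE_S AE_space by eventually_elim (use no in blast)
      then have "measure M {\<omega>\<in>space M. 1 + \<delta> \<le> iota_min (A \<omega>)} = 0" by (rule P.prob_eq_0_AE)
      then show False using \<delta>(3) by simp
    qed
    then obtain \<omega> where \<omega>: "A \<omega> \<in> S" "1 + \<delta> \<le> iota_min (A \<omega>)" by blast
    have "A \<omega> \<in> \<Gamma>" using \<omega>(1) semi_\<Gamma> semigroup_of.base by blast
    moreover have "A \<omega> \<in> pos_matrices" using \<omega>(1) pos_S by blast
    moreover from this have "1 < spec_radius (A \<omega>)"
      using spec_radius_bounds(1)[of "A \<omega>"] \<omega>(2) \<delta>(1) by linarith
    ultimately show ?thesis by (intro that) auto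
  qed
  have q1: "g0 \<in> \<Gamma> \<inter> pos_matrices" using g0(1) semi_\<Gamma> semi_pos unfolding S_def by blast
  have q2: "0 < spec_radius g0" "spec_radius g0 < 1"
  proof -
    have "g0 \<in> allowable" using q1 H1(1) by blast
    then show "0 < spec_radius g0" using spec_radius_bounds(1)[of g0] iota_min_pos[of g0] q1 by auto
    show "spec_radius g0 < 1" using spec_radius_bounds(2)[of g0] g0(2) q1 by auto
  qed
  have S_al: "S \<subseteq> allowable" unfolding S_def by (rule supp_allowable)
  have orbit: "\<exists>g\<in>semigroup_of supp. a < l1norm (g *v x) \<and> l1norm (g *v x) < b"
    if x: "x \<in> punctured_orthant" for x
  proof -
    obtain W where W: "W \<in> \<Gamma>" "a < l1norm (W *v x)" "l1norm (W *v x) < b"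
    proof (rule orbit_norms_dense[OF _ H1(1) H3 p1 q1 q2 x])
      show "g ** h \<in> \<Gamma>" if "g \<in> \<Gamma>" "h \<in> \<Gamma>" for g h
        using that unfolding \<Gamma>_def by (rule closed_semigroup_gen_mult)
    qed (use ab in auto)
    let ?U = "{g :: real^'n^'n. a < l1norm (g *v x)} \<inter> {g. l1norm (g *v x) < b}"
    have "open ?U" by (intro open_Int open_Collect_less continuous_intros)
    moreover have "W \<in> closure (semigroup_of S)"
      using W(1) closed_semigroup_gen_subset_closure[OF S_al] unfolding \<Gamma>_def by blast
    moreover have "W \<in> ?U" using W by simp
    ultimately have "?U \<inter> semigroup_of S \<noteq> {}"
      using open_Int_closure_eq_empty[of ?U "semigroup_of S"] by blast
    then show ?thesis unfolding S_def by blast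
  qed
  obtain C1 where C1: "0 \<le> C1"
    "\<forall>\<^sub>F t in at_top. emeasure \<nu> {z \<in> nonneg_orthant. l1norm z \<in> {t * a..t * b}} \<le> ennreal C1"
    using L.annulus_mass_le[OF Cu(2,1), of a b] ab by blast
  obtain c1 where c1: "0 < c1"
    "\<forall>\<^sub>F t in at_top. ennreal c1 \<le> emeasure \<nu> {z \<in> nonneg_orthant. l1norm z \<in> {t * a..t * b}}"
    using L.annulus_mass_ge[OF win(2,1) orbit] by blast
  let ?f = "\<lambda>t::real. emeasure \<nu> {z\<in>nonneg_orthant. l1norm z \<in> {t * a..t * b}}"
  have 1: "ennreal c1 \<le> Liminf at_top ?f" by (rule Liminf_bounded[OF c1(2)])
  have 2: "Liminf at_top ?f \<le> Limsup at_top ?f" by (rule Liminf_le_Limsup) simp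
  have 3: "Limsup at_top ?f \<le> ennreal C1" by (rule Limsup_bounded[OF C1(2)])
  have "ennreal c1 \<le> ennreal C1" using 1 2 3 by (meson order_trans)
  then have "c1 \<le> C1" using C1(1) by (subst (asm) ennreal_le_iff) auto
  with 1 2 3 c1(1) show "\<exists>c\<^sub>1 C\<^sub>1 :: real. 0 \<le> c\<^sub>1 \<and> c\<^sub>1 \<le> C\<^sub>1 \<and>
              ennreal c\<^sub>1 \<le> Liminf at_top ?f \<and> Liminf at_top ?f \<le> Limsup at_top ?f \<and>
              Limsup at_top ?f \<le> ennreal C\<^sub>1 \<and> (b / a > \<kappa> * real CARD('n) \<longrightarrow> 0 < c\<^sub>1)"
    by (intro exI[of _ c1] exI[of _ C1]) auto
qed

end
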